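(* Let $\mathcal{V}$ be an $\mathcal{M}$-bimodule category. Then there exists a natural action, by composition of functors, $$\triangleright\colon \mathcal{Z}_{\mathcal{B}}(\mathcal{M})\times \mathrm{BiMod}_{\mathcal{M}}(\mathcal{M}^{\mathrm{reg}},\mathcal{V})\longrightarrow \mathrm{BiMod}_{\mathcal{M}}(\mathcal{M}^{\mathrm{reg}},\mathcal{V}),\qquad (V,c)\triangleright H = H\circ\Phi_{(V,c)}.$$ In particular, for a monoidal category $\mathcal{V}$ with monoidal functors $F'\colon\mathcal{V}\to\mathcal{B}$ and $G_1,G_2\colon\mathcal{M}\to\mathcal{V}$ satisfying $F'G_i= F$, applying this to the bimodule ${}^{G_1}\mathcal{V}^{G_2}$, the action restricts to an action $$\triangleright\colon \mathcal{Z}_{\mathcal{B}}(\mathcal{M})\times {}^{G_1}\mathcal{Z}^{G_2}_{\mathcal{B}}(\mathcal{M})\longrightarrow {}^{G_1}\mathcal{Z}^{G_2}_{\mathcal{B}}(\mathcal{M}).$$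
   Context: Conventions. Monoidal categories have associativity isomorphism $\alpha_{X,Y,Z}\colon (X\otimes Y)\otimes Z\to X\otimes(Y\otimes Z)$ and a strict unit $I$; monoidal functors are strong, with coherence $\mu^G_{X,Y}\colon G(X\otimes Y)\to G(X)\otimes G(Y)$. Setting. $(\mathcal{B},\Psi)$ is a strict braided monoidal category; $\mathcal{M}$ is a monoidal category with monoidal functors $F\colon\mathcal{M}\to\mathcal{B}$, $P\colon\mathcal{B}\to\mathcal{M}$ and a monoidal natural isomorphism $\tau\colon FP\Rightarrow\mathrm{id}_{\mathcal{B}}$. Bimodules. An $\mathcal{M}$-bimodule is a category $\mathcal{V}$ with a strictly unital left action $\triangleright$ and right action $\triangleleft$ of $\mathcal{M}$ and coherent natural isomorphisms $\chi\colon X\triangleright(Y\triangleright V)\to(X\otimes Y)\triangleright V$, $\xi\colon (V\triangleleft X)\triangleleft Y\to V\triangleleft(X\otimes Y)$, $\zeta\colon (X\triangleright V)\triangleleft Y\to X\triangleright(V\triangleleft Y)$ (i.e. a bimodule category in the usual sense). Objects of $\mathrm{BiMod}_{\mathcal{M}}(\mathcal{V},\mathcal{W})$ are functors $H\colon\mathcal{V}\to\mathcal{W}$ with natural isomorphisms $\rho\colon H(V\triangleleft X)\to H(V)\triangleleft X$ and $\lambda\colon H(X\triangleright V)\to X\triangleright H(V)$ compatible with the structure isomorphisms; morphisms are natural transformations commuting with $\rho$ and $\lambda$. $\mathcal{M}^{\mathrm{reg}}$ is $\mathcal{M}$ acting on itself by $\otimes$ on both sides. For monoidal functors $G_1,G_2\colon\mathcal{M}\to\mathcal{V}$,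 ${}^{G_1}\mathcal{V}^{G_2}$ is $\mathcal{V}$ with $X\triangleright V=G_1(X)\otimes V$, $V\triangleleft X=V\otimes G_2(X)$. Mixed relative centers. ${}^{G_1}\mathcal{Z}^{G_2}_{\mathcal{B}}(\mathcal{M})$ has objects $(V,c)$ with $V\in\mathcal{V}$ and $c_X\colon V\otimes G_2(X)\to G_1(X)\otimes V$ a natural isomorphism such that: (1) $c_{X\otimes Y}$ equals, up to the coherences $\alpha,\mu^{G_i}$, the composite $(\mathrm{id}_{G_1X}\otimes c_Y)(c_X\otimes\mathrm{id}_{G_2Y})$; (2) ($(F,P)$-admissibility) for each $X\in\mathcal{B}$, the composite $F'(V)\otimes X\cong F'(V\otimes G_2P(X))\xrightarrow{F'(c_{P(X)})}F'(G_1P(X)\otimes V)\cong X\otimes F'(V)$ (using $\tau$, $\mu^{F'}$) equals $\Psi_{F'(V),X}$. Morphisms are morphisms of $\mathcal{V}$ commuting with the $c$'s. One identifies ${}^{G_1}\mathcal{Z}^{G_2}_{\mathcal{B}}(\mathcal{M})$ with a full subcategory of $\mathrm{BiMod}_{\mathcal{M}}(\mathcal{M}^{\mathrm{reg}},{}^{G_1}\mathcal{V}^{G_2})$ (up to equivalence) by letting a bimodule functor $H$ correspond to $V=H(I)$ with $c_X=\lambda_{X,I}\rho^{-1}_{I,X}\colon V\triangleleft X\to H(X)\to X\triangleright V$. $\mathcal{Z}_{\mathcal{B}}(\mathcal{M}):={}^{\mathrm{id}}\mathcal{Z}^{\mathrm{id}}_{\mathcal{B}}(\mathcal{M})$ (with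 $\mathcal{V}=\mathcal{M}$, $F'=F$), monoidal via $(V,c^V)\otimes(W,c^W)=(V\otimes W,c^{V\otimes W})$ with $c^{V\otimes W}_X=\alpha(c^V_X\otimes \mathrm{id}_W)\alpha^{-1}(\mathrm{id}_V\otimes c^W_X)\alpha$. For $(V,c)\in\mathcal{Z}_{\mathcal{B}}(\mathcal{M})$, $\Phi_{(V,c)}\colon\mathcal{M}^{\mathrm{reg}}\to\mathcal{M}^{\mathrm{reg}}$ is the corresponding bimodule endofunctor $X\mapsto X\otimes V$, with left structure given by $\alpha$ and right structure $(X\otimes Y)\otimes V\xrightarrow{\alpha} X\otimes(Y\otimes V)\xrightarrow{\mathrm{id}\otimes c_Y^{-1}}X\otimes(V\otimes Y)\xrightarrow{\alpha^{-1}}(X\otimes V)\otimes Y$. "Action" means a (left) module category structure over the monoidal category $\mathcal{Z}_{\mathcal{B}}(\mathcal{M})$. *)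

theory Defs
  imports "HOL-Library.FuncSet"
begin

section \<open>Categories and functors\<close>

text \<open>
  A category is a record with carrier sets of objects and arrows. Functions of such a record
  are only meaningful on the carriers; composition is written in applicative order.
\<close>

record ('o, 'a) category =
  Obj :: "'o set"
  Arr :: "'a set"
  Dom :: "'a \<Rightarrow> 'o"
  Cod :: "'a \<Rightarrow> 'o"
  ident :: "'o \<Rightarrow> 'a"
  Comp :: "'a \<Rightarrow> 'a \<Rightarrow> 'a"  (infixr "\<cdot>\<index>" 55)

definition hom :: "('o, 'a, 'm) category_scheme \<Rightarrow> 'o \<Rightarrow> 'o \<Rightarrow> 'a set" where
  "hom C X Y = {f \<in> Arr C. Dom C f = X \<and> Cod C f = Y}"

locale category =
  fixes C :: "('o, 'a, 'm) category_scheme" (structure)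
  assumes Dom_in: "f \<in> Arr C \<Longrightarrow> Dom C f \<in> Obj C"
    and Cod_in: "f \<in> Arr C \<Longrightarrow> Cod C f \<in> Obj C"
    and ident_in: "X \<in> Obj C \<Longrightarrow> ident C X \<in> hom C X X"
    and Comp_in: "\<lbrakk>f \<in> hom C X Y; g \<in> hom C Y Z\<rbrakk> \<Longrightarrow> g \<cdot> f \<in> hom C X Z"
    and Comp_ident_left: "f \<in> hom C X Y \<Longrightarrow> ident C Y \<cdot> f = f"
    and Comp_ident_right: "f \<in> hom C X Y \<Longrightarrow> f \<cdot> ident C X = f"
    and Comp_assoc: "\<lbrakk>f \<in> hom C W X; g \<in> hom C X Y; h \<in> hom C Y Z\<rbrakk> \<Longrightarrow>
      (h \<cdot> g) \<cdot> f = h \<cdot> (g \<cdot> f)"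

definition inverse_arrows :: "('o, 'a, 'm) category_scheme \<Rightarrow> 'a \<Rightarrow> 'a \<Rightarrow> bool" where
  "inverse_arrows C f g \<longleftrightarrow> f \<in> Arr C \<and> g \<in> hom C (Cod C f) (Dom C f) \<and>
    g \<cdot>\<^bsub>C\<^esub> f = ident C (Dom C f) \<and> f \<cdot>\<^bsub>C\<^esub> g = ident C (Cod C f)"

definition iso :: "('o, 'a, 'm) category_scheme \<Rightarrow> 'o \<Rightarrow> 'o \<Rightarrow> 'a set" where
  "iso C X Y = {f \<in> hom C X Y. \<exists>g. inverse_arrows C f g}"

definition inv_arr :: "('o, 'a, 'm) category_scheme \<Rightarrow> 'a \<Rightarrow> 'a" where
  "inv_arr C f = (THE g. inverse_arrows C f g)"

definition full_subcategory ::
  "('o, 'a, 'm) category_scheme \<Rightarrow> 'o set \<Rightarrow> ('o, 'a) category" where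
  "full_subcategory C S =
    \<lparr>Obj = Obj C \<inter> S,
     Arr = {f \<in> Arr C. Dom C f \<in> S \<and> Cod C f \<in> S},
     Dom = Dom C, Cod = Cod C, ident = ident C, Comp = Comp C\<rparr>"

record ('o, 'a, 'p, 'b) cfunctor =
  fobj :: "'o \<Rightarrow> 'p"
  farr :: "'a \<Rightarrow> 'b"

locale cfunctor = C: category C + D: category D
  for C :: "('o, 'a, 'm) category_scheme"
    and D :: "('p, 'b, 'n) category_scheme"
    and F :: "('o, 'a, 'p, 'b, 'k) cfunctor_scheme" +
  assumes fobj_in: "X \<in> Obj C \<Longrightarrow> fobj F X \<in> Obj D"
    and farr_in: "f \<in> hom C X Y \<Longrightarrow> farr F f \<in> hom D (fobj F X) (fobj F Y)"
    and farr_ident: "X \<in> Obj C \<Longrightarrow> farr F (ident C X) = ident D (fobj F X)"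
    and farr_Comp: "\<lbrakk>f \<in> hom C X Y; g \<in> hom C Y Z\<rbrakk> \<Longrightarrow>
      farr F (g \<cdot>\<^bsub>C\<^esub> f) = farr F g \<cdot>\<^bsub>D\<^esub> farr F f"

definition cfunctor_id :: "('o, 'a, 'o, 'a) cfunctor" where
  "cfunctor_id = \<lparr>fobj = (\<lambda>X. X), farr = (\<lambda>f. f)\<rparr>"

definition cfunctor_comp ::
  "('p, 'b, 'q, 'c, 'k) cfunctor_scheme \<Rightarrow> ('o, 'a, 'p, 'b, 'l) cfunctor_scheme \<Rightarrow>
    ('o, 'a, 'q, 'c) cfunctor" where
  "cfunctor_comp G F = \<lparr>fobj = (\<lambda>X. fobj G (fobj F X)), farr = (\<lambda>f. farr G (farr F f))\<rparr>"

locale nat_transformation = F: cfunctor C D F + G: cfunctor C D G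
  for C :: "('o, 'a, 'm) category_scheme"
    and D :: "('p, 'b, 'n) category_scheme"
    and F :: "('o, 'a, 'p, 'b, 'k) cfunctor_scheme"
    and G :: "('o, 'a, 'p, 'b, 'l) cfunctor_scheme"
    and \<theta> :: "'o \<Rightarrow> 'b" +
  assumes component_in: "X \<in> Obj C \<Longrightarrow> \<theta> X \<in> hom D (fobj F X) (fobj G X)"
    and naturality: "f \<in> hom C X Y \<Longrightarrow>
      \<theta> Y \<cdot>\<^bsub>D\<^esub> farr F f = farr G f \<cdot>\<^bsub>D\<^esub> \<theta> X"

locale nat_isomorphism = nat_transformation C D F G \<theta>
  for C :: "('o, 'a, 'm) category_scheme"
    and D :: "('p, 'b, 'n) category_scheme"
    and F :: "('o, 'a, 'p, 'b, 'k) cfunctor_scheme"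
    and G :: "('o, 'a, 'p, 'b, 'l) cfunctor_scheme"
    and \<theta> :: "'o \<Rightarrow> 'b" +
  assumes component_iso: "X \<in> Obj C \<Longrightarrow> \<theta> X \<in> iso D (fobj F X) (fobj G X)"

definition equivalence ::
  "('o, 'a, 'm) category_scheme \<Rightarrow> ('p, 'b, 'n) category_scheme \<Rightarrow>
    ('o, 'a, 'p, 'b, 'k) cfunctor_scheme \<Rightarrow> bool" where
  "equivalence C D E \<longleftrightarrow> cfunctor C D E \<and>
    (\<exists>(K :: ('p, 'b, 'o, 'a) cfunctor) \<eta> \<epsilon>. cfunctor D C K \<and>
      nat_isomorphism C C cfunctor_id (cfunctor_comp K E) \<eta> \<and>
      nat_isomorphism D D (cfunctor_comp E K) cfunctor_id \<epsilon>)"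


section \<open>Monoidal categories and monoidal functors\<close>

record ('o, 'a) monoidal = "('o, 'a) category" +
  tunit :: "'o"
  tobj :: "'o \<Rightarrow> 'o \<Rightarrow> 'o"  (infixr "\<otimes>\<index>" 70)
  tarr :: "'a \<Rightarrow> 'a \<Rightarrow> 'a"  (infixr "\<boxtimes>\<index>" 70)
  assoc :: "'o \<Rightarrow> 'o \<Rightarrow> 'o \<Rightarrow> 'a"

text \<open>The unit is strict, so that the unit constraints are identities.\<close>

locale monoidal_category = category C
  for C :: "('o, 'a, 'm) monoidal_scheme" (structure) +
  assumes tunit_in: "tunit C \<in> Obj C"
    and tobj_in: "\<lbrakk>X \<in> Obj C; Y \<in> Obj C\<rbrakk> \<Longrightarrow> X \<otimes> Y \<in> Obj C"
    and tarr_in: "\<lbrakk>f \<in> hom C X X'; g \<in> hom C Y Y'\<rbrakk> \<Longrightarrow> f \<boxtimes> g \<in> hom C (X \<otimes> Y) (X' \<otimes> Y')"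
    and tarr_ident: "\<lbrakk>X \<in> Obj C; Y \<in> Obj C\<rbrakk> \<Longrightarrow>
      ident C X \<boxtimes> ident C Y = ident C (X \<otimes> Y)"
    and tarr_Comp: "\<lbrakk>f \<in> hom C X X'; f' \<in> hom C X' X''; g \<in> hom C Y Y'; g' \<in> hom C Y' Y''\<rbrakk> \<Longrightarrow>
      (f' \<cdot> f) \<boxtimes> (g' \<cdot> g) = (f' \<boxtimes> g') \<cdot> (f \<boxtimes> g)"
    and tunit_obj_left: "X \<in> Obj C \<Longrightarrow> tunit C \<otimes> X = X"
    and tunit_obj_right: "X \<in> Obj C \<Longrightarrow> X \<otimes> tunit C = X"
    and tunit_arr_left: "f \<in> Arr C \<Longrightarrow> ident C (tunit C) \<boxtimes> f = f"
    and tunit_arr_right: "f \<in> Arr C \<Longrightarrow> f \<boxtimes> ident C (tunit C) = f"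
    and assoc_iso: "\<lbrakk>X \<in> Obj C; Y \<in> Obj C; Z \<in> Obj C\<rbrakk> \<Longrightarrow>
      assoc C X Y Z \<in> iso C ((X \<otimes> Y) \<otimes> Z) (X \<otimes> (Y \<otimes> Z))"
    and assoc_natural: "\<lbrakk>f \<in> hom C X X'; g \<in> hom C Y Y'; h \<in> hom C Z Z'\<rbrakk> \<Longrightarrow>
      assoc C X' Y' Z' \<cdot> ((f \<boxtimes> g) \<boxtimes> h) = (f \<boxtimes> (g \<boxtimes> h)) \<cdot> assoc C X Y Z"
    and pentagon: "\<lbrakk>W \<in> Obj C; X \<in> Obj C; Y \<in> Obj C; Z \<in> Obj C\<rbrakk> \<Longrightarrow>
      (ident C W \<boxtimes> assoc C X Y Z) \<cdot> assoc C W (X \<otimes> Y) Z \<cdot> (assoc C W X Y \<boxtimes> ident C Z) =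
      assoc C W X (Y \<otimes> Z) \<cdot> assoc C (W \<otimes> X) Y Z"
    and assoc_unit: "\<lbrakk>X \<in> Obj C; Y \<in> Obj C\<rbrakk> \<Longrightarrow>
      assoc C (tunit C) X Y = ident C (X \<otimes> Y) \<and>
      assoc C X (tunit C) Y = ident C (X \<otimes> Y) \<and>
      assoc C X Y (tunit C) = ident C (X \<otimes> Y)"

record ('o, 'a) braided = "('o, 'a) monoidal" +
  braid :: "'o \<Rightarrow> 'o \<Rightarrow> 'a"

text \<open>With identity associativity isomorphisms the two hexagon axioms become triangles.\<close>

locale strict_braided_category = monoidal_category C
  for C :: "('o, 'a, 'm) braided_scheme" (structure) +
  assumes strict_obj: "\<lbrakk>X \<in> Obj C; Y \<in> Obj C; Z \<in> Obj C\<rbrakk> \<Longrightarrow>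
      (X \<otimes> Y) \<otimes> Z = X \<otimes> (Y \<otimes> Z)"
    and strict_assoc: "\<lbrakk>X \<in> Obj C; Y \<in> Obj C; Z \<in> Obj C\<rbrakk> \<Longrightarrow>
      assoc C X Y Z = ident C (X \<otimes> (Y \<otimes> Z))"
    and braid_iso: "\<lbrakk>X \<in> Obj C; Y \<in> Obj C\<rbrakk> \<Longrightarrow> braid C X Y \<in> iso C (X \<otimes> Y) (Y \<otimes> X)"
    and braid_natural: "\<lbrakk>f \<in> hom C X X'; g \<in> hom C Y Y'\<rbrakk> \<Longrightarrow>
      braid C X' Y' \<cdot> (f \<boxtimes> g) = (g \<boxtimes> f) \<cdot> braid C X Y"
    and hexagon_left: "\<lbrakk>X \<in> Obj C; Y \<in> Obj C; Z \<in> Obj C\<rbrakk> \<Longrightarrow>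
      braid C (X \<otimes> Y) Z = (braid C X Z \<boxtimes> ident C Y) \<cdot> (ident C X \<boxtimes> braid C Y Z)"
    and hexagon_right: "\<lbrakk>X \<in> Obj C; Y \<in> Obj C; Z \<in> Obj C\<rbrakk> \<Longrightarrow>
      braid C X (Y \<otimes> Z) = (ident C Y \<boxtimes> braid C X Z) \<cdot> (braid C X Y \<boxtimes> ident C Z)"

record ('o, 'a, 'p, 'b) mfunctor = "('o, 'a, 'p, 'b) cfunctor" +
  fmu :: "'o \<Rightarrow> 'o \<Rightarrow> 'b"

text \<open>
  A strong monoidal functor. Since all units are strict, the unit constraint is an identity:
  the functor preserves the unit object and the coherence is trivial at the unit.
\<close>

locale monoidal_functor =
  C: monoidal_category C + D: monoidal_category D + cfunctor C D G
  for C :: "('o, 'a, 'm) monoidal_scheme"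
    and D :: "('p, 'b, 'n) monoidal_scheme"
    and G :: "('o, 'a, 'p, 'b, 'k) mfunctor_scheme" +
  assumes fobj_unit: "fobj G (tunit C) = tunit D"
    and mu_iso: "\<lbrakk>X \<in> Obj C; Y \<in> Obj C\<rbrakk> \<Longrightarrow>
      fmu G X Y \<in> iso D (fobj G (X \<otimes>\<^bsub>C\<^esub> Y)) (fobj G X \<otimes>\<^bsub>D\<^esub> fobj G Y)"
    and mu_natural: "\<lbrakk>f \<in> hom C X X'; g \<in> hom C Y Y'\<rbrakk> \<Longrightarrow>
      fmu G X' Y' \<cdot>\<^bsub>D\<^esub> farr G (f \<boxtimes>\<^bsub>C\<^esub> g) = (farr G f \<boxtimes>\<^bsub>D\<^esub> farr G g) \<cdot>\<^bsub>D\<^esub> fmu G X Y"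
    and mu_assoc: "\<lbrakk>X \<in> Obj C; Y \<in> Obj C; Z \<in> Obj C\<rbrakk> \<Longrightarrow>
      assoc D (fobj G X) (fobj G Y) (fobj G Z) \<cdot>\<^bsub>D\<^esub>
        (fmu G X Y \<boxtimes>\<^bsub>D\<^esub> ident D (fobj G Z)) \<cdot>\<^bsub>D\<^esub> fmu G (X \<otimes>\<^bsub>C\<^esub> Y) Z =
      (ident D (fobj G X) \<boxtimes>\<^bsub>D\<^esub> fmu G Y Z) \<cdot>\<^bsub>D\<^esub> fmu G X (Y \<otimes>\<^bsub>C\<^esub> Z) \<cdot>\<^bsub>D\<^esub> farr G (assoc C X Y Z)"
    and mu_unit: "X \<in> Obj C \<Longrightarrow>
      fmu G (tunit C) X = ident D (fobj G X) \<and> fmu G X (tunit C) = ident D (fobj G X)"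

definition mfunctor_id :: "('o, 'a, 'm) monoidal_scheme \<Rightarrow> ('o, 'a, 'o, 'a) mfunctor" where
  "mfunctor_id C =
    \<lparr>fobj = (\<lambda>X. X), farr = (\<lambda>f. f), fmu = (\<lambda>X Y. ident C (X \<otimes>\<^bsub>C\<^esub> Y))\<rparr>"

definition mfunctor_comp ::
  "('q, 'c, 'm) monoidal_scheme \<Rightarrow> ('p, 'b, 'q, 'c, 'k) mfunctor_scheme \<Rightarrow>
    ('o, 'a, 'p, 'b, 'l) mfunctor_scheme \<Rightarrow> ('o, 'a, 'q, 'c) mfunctor" where
  "mfunctor_comp D G F =
    \<lparr>fobj = (\<lambda>X. fobj G (fobj F X)), farr = (\<lambda>f. farr G (farr F f)),
     fmu = (\<lambda>X Y. fmu G (fobj F X) (fobj F Y) \<cdot>\<^bsub>D\<^esub> farr G (fmu F X Y))\<rparr>"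

text \<open>Equality of monoidal functors, which as records may differ outside the carriers.\<close>

definition mfunctor_eq ::
  "('o, 'a, 'm) monoidal_scheme \<Rightarrow> ('o, 'a, 'p, 'b, 'k) mfunctor_scheme \<Rightarrow>
    ('o, 'a, 'p, 'b, 'l) mfunctor_scheme \<Rightarrow> bool" where
  "mfunctor_eq C F G \<longleftrightarrow>
    (\<forall>X\<in>Obj C. fobj F X = fobj G X) \<and> (\<forall>f\<in>Arr C. farr F f = farr G f) \<and>
    (\<forall>X\<in>Obj C. \<forall>Y\<in>Obj C. fmu F X Y = fmu G X Y)"

locale monoidal_nat_isomorphism =
  F: monoidal_functor C D F + G: monoidal_functor C D G + nat_isomorphism C D F G \<theta>
  for C :: "('o, 'a, 'm) monoidal_scheme"
    and D :: "('p, 'b, 'n) monoidal_scheme"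
    and F :: "('o, 'a, 'p, 'b, 'k) mfunctor_scheme"
    and G :: "('o, 'a, 'p, 'b, 'l) mfunctor_scheme"
    and \<theta> :: "'o \<Rightarrow> 'b" +
  assumes component_tensor: "\<lbrakk>X \<in> Obj C; Y \<in> Obj C\<rbrakk> \<Longrightarrow>
      fmu G X Y \<cdot>\<^bsub>D\<^esub> \<theta> (X \<otimes>\<^bsub>C\<^esub> Y) = (\<theta> X \<boxtimes>\<^bsub>D\<^esub> \<theta> Y) \<cdot>\<^bsub>D\<^esub> fmu F X Y"
    and component_unit: "\<theta> (tunit C) = ident D (tunit D)"


section \<open>Module and bimodule categories\<close>

text \<open>
  A left action of a monoidal category with objects \<open>'o\<close> and arrows \<open>'a\<close> on a category with
  objects \<open>'v\<close> and arrows \<open>'w\<close>; \<open>lassoc A X Y V\<close> is the arrow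
  \<open>\<chi>: X \<triangleright> (Y \<triangleright> V) \<rightarrow> (X \<otimes> Y) \<triangleright> V\<close>.
\<close>

record ('o, 'a, 'v, 'w) left_action =
  lobj :: "'o \<Rightarrow> 'v \<Rightarrow> 'v"  (infixr "\<triangleright>\<index>" 70)
  larr :: "'a \<Rightarrow> 'w \<Rightarrow> 'w"  (infixr "\<unrhd>\<index>" 70)
  lassoc :: "'o \<Rightarrow> 'o \<Rightarrow> 'v \<Rightarrow> 'w"

locale left_module_category = M: monoidal_category M + V: category V
  for M :: "('o, 'a, 'm) monoidal_scheme"
    and V :: "('v, 'w, 'n) category_scheme"
    and A :: "('o, 'a, 'v, 'w) left_action" (structure) +
  assumes lobj_in: "\<lbrakk>X \<in> Obj M; S \<in> Obj V\<rbrakk> \<Longrightarrow> X \<triangleright> S \<in> Obj V"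
    and larr_in: "\<lbrakk>f \<in> hom M X X'; h \<in> hom V S S'\<rbrakk> \<Longrightarrow> f \<unrhd> h \<in> hom V (X \<triangleright> S) (X' \<triangleright> S')"
    and larr_ident: "\<lbrakk>X \<in> Obj M; S \<in> Obj V\<rbrakk> \<Longrightarrow> ident M X \<unrhd> ident V S = ident V (X \<triangleright> S)"
    and larr_Comp: "\<lbrakk>f \<in> hom M X X'; f' \<in> hom M X' X''; h \<in> hom V S S'; h' \<in> hom V S' S''\<rbrakk> \<Longrightarrow>
      (f' \<cdot>\<^bsub>M\<^esub> f) \<unrhd> (h' \<cdot>\<^bsub>V\<^esub> h) = (f' \<unrhd> h') \<cdot>\<^bsub>V\<^esub> (f \<unrhd> h)"
    and lobj_unit: "S \<in> Obj V \<Longrightarrow> tunit M \<triangleright> S = S"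
    and larr_unit: "h \<in> Arr V \<Longrightarrow> ident M (tunit M) \<unrhd> h = h"
    and lassoc_iso: "\<lbrakk>X \<in> Obj M; Y \<in> Obj M; S \<in> Obj V\<rbrakk> \<Longrightarrow>
      lassoc A X Y S \<in> iso V (X \<triangleright> (Y \<triangleright> S)) ((X \<otimes>\<^bsub>M\<^esub> Y) \<triangleright> S)"
    and lassoc_natural: "\<lbrakk>f \<in> hom M X X'; g \<in> hom M Y Y'; h \<in> hom V S S'\<rbrakk> \<Longrightarrow>
      lassoc A X' Y' S' \<cdot>\<^bsub>V\<^esub> (f \<unrhd> (g \<unrhd> h)) = ((f \<boxtimes>\<^bsub>M\<^esub> g) \<unrhd> h) \<cdot>\<^bsub>V\<^esub> lassoc A X Y S"
    and lassoc_pentagon: "\<lbrakk>X \<in> Obj M; Y \<in> Obj M; Z \<in> Obj M; S \<in> Obj V\<rbrakk> \<Longrightarrow>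
      lassoc A X (Y \<otimes>\<^bsub>M\<^esub> Z) S \<cdot>\<^bsub>V\<^esub> (ident M X \<unrhd> lassoc A Y Z S) =
      (assoc M X Y Z \<unrhd> ident V S) \<cdot>\<^bsub>V\<^esub> lassoc A (X \<otimes>\<^bsub>M\<^esub> Y) Z S \<cdot>\<^bsub>V\<^esub> lassoc A X Y (Z \<triangleright> S)"
    and lassoc_unit: "\<lbrakk>X \<in> Obj M; S \<in> Obj V\<rbrakk> \<Longrightarrow>
      lassoc A (tunit M) X S = ident V (X \<triangleright> S) \<and> lassoc A X (tunit M) S = ident V (X \<triangleright> S)"

text \<open>Dually, \<open>rassoc A V X Y\<close> is the arrow \<open>\<xi>: (V \<triangleleft> X) \<triangleleft> Y \<rightarrow> V \<triangleleft> (X \<otimes> Y)\<close>.\<close>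

record ('o, 'a, 'v, 'w) right_action =
  robj :: "'v \<Rightarrow> 'o \<Rightarrow> 'v"  (infixl "\<triangleleft>\<index>" 70)
  rarr :: "'w \<Rightarrow> 'a \<Rightarrow> 'w"  (infixl "\<unlhd>\<index>" 70)
  rassoc :: "'v \<Rightarrow> 'o \<Rightarrow> 'o \<Rightarrow> 'w"

locale right_module_category = M: monoidal_category M + V: category V
  for M :: "('o, 'a, 'm) monoidal_scheme"
    and V :: "('v, 'w, 'n) category_scheme"
    and A :: "('o, 'a, 'v, 'w) right_action" (structure) +
  assumes robj_in: "\<lbrakk>S \<in> Obj V; X \<in> Obj M\<rbrakk> \<Longrightarrow> S \<triangleleft> X \<in> Obj V"
    and rarr_in: "\<lbrakk>h \<in> hom V S S'; f \<in> hom M X X'\<rbrakk> \<Longrightarrow> h \<unlhd> f \<in> hom V (S \<triangleleft> X) (S' \<triangleleft> X')"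
    and rarr_ident: "\<lbrakk>S \<in> Obj V; X \<in> Obj M\<rbrakk> \<Longrightarrow> ident V S \<unlhd> ident M X = ident V (S \<triangleleft> X)"
    and rarr_Comp: "\<lbrakk>h \<in> hom V S S'; h' \<in> hom V S' S''; f \<in> hom M X X'; f' \<in> hom M X' X''\<rbrakk> \<Longrightarrow>
      (h' \<cdot>\<^bsub>V\<^esub> h) \<unlhd> (f' \<cdot>\<^bsub>M\<^esub> f) = (h' \<unlhd> f') \<cdot>\<^bsub>V\<^esub> (h \<unlhd> f)"
    and robj_unit: "S \<in> Obj V \<Longrightarrow> S \<triangleleft> tunit M = S"
    and rarr_unit: "h \<in> Arr V \<Longrightarrow> h \<unlhd> ident M (tunit M) = h"
    and rassoc_iso: "\<lbrakk>S \<in> Obj V; X \<in> Obj M; Y \<in> Obj M\<rbrakk> \<Longrightarrow>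
      rassoc A S X Y \<in> iso V ((S \<triangleleft> X) \<triangleleft> Y) (S \<triangleleft> (X \<otimes>\<^bsub>M\<^esub> Y))"
    and rassoc_natural: "\<lbrakk>h \<in> hom V S S'; f \<in> hom M X X'; g \<in> hom M Y Y'\<rbrakk> \<Longrightarrow>
      rassoc A S' X' Y' \<cdot>\<^bsub>V\<^esub> ((h \<unlhd> f) \<unlhd> g) = (h \<unlhd> (f \<boxtimes>\<^bsub>M\<^esub> g)) \<cdot>\<^bsub>V\<^esub> rassoc A S X Y"
    and rassoc_pentagon: "\<lbrakk>S \<in> Obj V; X \<in> Obj M; Y \<in> Obj M; Z \<in> Obj M\<rbrakk> \<Longrightarrow>
      rassoc A S X (Y \<otimes>\<^bsub>M\<^esub> Z) \<cdot>\<^bsub>V\<^esub> rassoc A (S \<triangleleft> X) Y Z =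
      (ident V S \<unlhd> assoc M X Y Z) \<cdot>\<^bsub>V\<^esub> rassoc A S (X \<otimes>\<^bsub>M\<^esub> Y) Z \<cdot>\<^bsub>V\<^esub>
        (rassoc A S X Y \<unlhd> ident M Z)"
    and rassoc_unit: "\<lbrakk>S \<in> Obj V; X \<in> Obj M\<rbrakk> \<Longrightarrow>
      rassoc A S (tunit M) X = ident V (S \<triangleleft> X) \<and> rassoc A S X (tunit M) = ident V (S \<triangleleft> X)"

text \<open>\<open>mid V X S Y\<close> is the arrow \<open>\<zeta>: (X \<triangleright> S) \<triangleleft> Y \<rightarrow> X \<triangleright> (S \<triangleleft> Y)\<close>.\<close>

record ('o, 'a, 'v, 'w) bimodule = "('v, 'w) category" +
  left :: "('o, 'a, 'v, 'w) left_action"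
  right :: "('o, 'a, 'v, 'w) right_action"
  mid :: "'o \<Rightarrow> 'v \<Rightarrow> 'o \<Rightarrow> 'w"

locale bimodule_category =
  L: left_module_category M V "left V" + R: right_module_category M V "right V"
  for M :: "('o, 'a, 'm) monoidal_scheme"
    and V :: "('o, 'a, 'v, 'w) bimodule" +
  assumes mid_iso: "\<lbrakk>X \<in> Obj M; S \<in> Obj V; Y \<in> Obj M\<rbrakk> \<Longrightarrow>
      mid V X S Y \<in> iso V ((X \<triangleright>\<^bsub>left V\<^esub> S) \<triangleleft>\<^bsub>right V\<^esub> Y) (X \<triangleright>\<^bsub>left V\<^esub> (S \<triangleleft>\<^bsub>right V\<^esub> Y))"
    and mid_natural: "\<lbrakk>f \<in> hom M X X'; h \<in> hom V S S'; g \<in> hom M Y Y'\<rbrakk> \<Longrightarrow>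
      mid V X' S' Y' \<cdot>\<^bsub>V\<^esub> ((f \<unrhd>\<^bsub>left V\<^esub> h) \<unlhd>\<^bsub>right V\<^esub> g) =
      (f \<unrhd>\<^bsub>left V\<^esub> (h \<unlhd>\<^bsub>right V\<^esub> g)) \<cdot>\<^bsub>V\<^esub> mid V X S Y"
    and mid_left: "\<lbrakk>X \<in> Obj M; Y \<in> Obj M; S \<in> Obj V; Z \<in> Obj M\<rbrakk> \<Longrightarrow>
      lassoc (left V) X Y (S \<triangleleft>\<^bsub>right V\<^esub> Z) \<cdot>\<^bsub>V\<^esub> (ident M X \<unrhd>\<^bsub>left V\<^esub> mid V Y S Z) \<cdot>\<^bsub>V\<^esub>
        mid V X (Y \<triangleright>\<^bsub>left V\<^esub> S) Z =
      mid V (X \<otimes>\<^bsub>M\<^esub> Y) S Z \<cdot>\<^bsub>V\<^esub> (lassoc (left V) X Y S \<unlhd>\<^bsub>right V\<^esub> ident M Z)"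
    and mid_right: "\<lbrakk>X \<in> Obj M; S \<in> Obj V; Y \<in> Obj M; Z \<in> Obj M\<rbrakk> \<Longrightarrow>
      (ident M X \<unrhd>\<^bsub>left V\<^esub> rassoc (right V) S Y Z) \<cdot>\<^bsub>V\<^esub> mid V X (S \<triangleleft>\<^bsub>right V\<^esub> Y) Z \<cdot>\<^bsub>V\<^esub>
        (mid V X S Y \<unlhd>\<^bsub>right V\<^esub> ident M Z) =
      mid V X S (Y \<otimes>\<^bsub>M\<^esub> Z) \<cdot>\<^bsub>V\<^esub> rassoc (right V) (X \<triangleright>\<^bsub>left V\<^esub> S) Y Z"
    and mid_unit: "\<lbrakk>X \<in> Obj M; S \<in> Obj V\<rbrakk> \<Longrightarrow>
      mid V (tunit M) S X = ident V (S \<triangleleft>\<^bsub>right V\<^esub> X) \<and>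
      mid V X S (tunit M) = ident V (X \<triangleright>\<^bsub>left V\<^esub> S)"

definition regular :: "('o, 'a, 'm) monoidal_scheme \<Rightarrow> ('o, 'a, 'o, 'a) bimodule" where
  "regular M =
    \<lparr>Obj = Obj M, Arr = Arr M, Dom = Dom M, Cod = Cod M, ident = ident M, Comp = Comp M,
     left = \<lparr>lobj = tobj M, larr = tarr M, lassoc = (\<lambda>X Y V. inv_arr M (assoc M X Y V))\<rparr>,
     right = \<lparr>robj = tobj M, rarr = tarr M, rassoc = assoc M\<rparr>,
     mid = assoc M\<rparr>"

text \<open>The category \<open>N\<close> with \<open>X \<triangleright> V = G1 X \<otimes> V\<close> and \<open>V \<triangleleft> X = V \<otimes> G2 X\<close>.\<close>

definition twisted ::
  "('v, 'w, 'n) monoidal_scheme \<Rightarrow> ('o, 'a, 'v, 'w, 'k) mfunctor_scheme \<Rightarrow>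
    ('o, 'a, 'v, 'w, 'l) mfunctor_scheme \<Rightarrow> ('o, 'a, 'v, 'w) bimodule" where
  "twisted N G1 G2 =
    \<lparr>Obj = Obj N, Arr = Arr N, Dom = Dom N, Cod = Cod N, ident = ident N, Comp = Comp N,
     left = \<lparr>lobj = (\<lambda>X V. fobj G1 X \<otimes>\<^bsub>N\<^esub> V), larr = (\<lambda>f g. farr G1 f \<boxtimes>\<^bsub>N\<^esub> g),
       lassoc = (\<lambda>X Y V. (inv_arr N (fmu G1 X Y) \<boxtimes>\<^bsub>N\<^esub> ident N V) \<cdot>\<^bsub>N\<^esub>
         inv_arr N (assoc N (fobj G1 X) (fobj G1 Y) V))\<rparr>,
     right = \<lparr>robj = (\<lambda>V X. V \<otimes>\<^bsub>N\<^esub> fobj G2 X), rarr = (\<lambda>g f. g \<boxtimes>\<^bsub>N\<^esub> farr G2 f),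
       rassoc = (\<lambda>V X Y. (ident N V \<boxtimes>\<^bsub>N\<^esub> inv_arr N (fmu G2 X Y)) \<cdot>\<^bsub>N\<^esub>
         assoc N V (fobj G2 X) (fobj G2 Y))\<rparr>,
     mid = (\<lambda>X V Y. assoc N (fobj G1 X) V (fobj G2 Y))\<rparr>"


section \<open>Module functors and bimodule functors\<close>

text \<open>The arrow \<open>s (X, V)\<close> is the structure isomorphism \<open>H (X \<triangleright> V) \<rightarrow> X \<triangleright> H V\<close>.\<close>

locale left_module_functor =
  V: left_module_category M V A + W: left_module_category M W A' + cfunctor V W H
  for M :: "('o, 'a, 'm) monoidal_scheme"
    and V :: "('v, 'w, 'n) category_scheme"
    and A :: "('o, 'a, 'v, 'w) left_action"
    and W :: "('x, 'y, 'k) category_scheme"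
    and A' :: "('o, 'a, 'x, 'y) left_action"
    and H :: "('v, 'w, 'x, 'y, 'l) cfunctor_scheme"
    and s :: "'o \<times> 'v \<Rightarrow> 'y" +
  assumes lam_iso: "\<lbrakk>X \<in> Obj M; S \<in> Obj V\<rbrakk> \<Longrightarrow>
      s (X, S) \<in> iso W (fobj H (X \<triangleright>\<^bsub>A\<^esub> S)) (X \<triangleright>\<^bsub>A'\<^esub> fobj H S)"
    and lam_natural: "\<lbrakk>f \<in> hom M X X'; g \<in> hom V S S'\<rbrakk> \<Longrightarrow>
      s (X', S') \<cdot>\<^bsub>W\<^esub> farr H (f \<unrhd>\<^bsub>A\<^esub> g) = (f \<unrhd>\<^bsub>A'\<^esub> farr H g) \<cdot>\<^bsub>W\<^esub> s (X, S)"
    and lam_assoc: "\<lbrakk>X \<in> Obj M; Y \<in> Obj M; S \<in> Obj V\<rbrakk> \<Longrightarrow>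
      s (X \<otimes>\<^bsub>M\<^esub> Y, S) \<cdot>\<^bsub>W\<^esub> farr H (lassoc A X Y S) =
      lassoc A' X Y (fobj H S) \<cdot>\<^bsub>W\<^esub> (ident M X \<unrhd>\<^bsub>A'\<^esub> s (Y, S)) \<cdot>\<^bsub>W\<^esub> s (X, Y \<triangleright>\<^bsub>A\<^esub> S)"
    and lam_unit: "S \<in> Obj V \<Longrightarrow> s (tunit M, S) = ident W (fobj H S)"

locale right_module_functor =
  V: right_module_category M V A + W: right_module_category M W A' + cfunctor V W H
  for M :: "('o, 'a, 'm) monoidal_scheme"
    and V :: "('v, 'w, 'n) category_scheme"
    and A :: "('o, 'a, 'v, 'w) right_action"
    and W :: "('x, 'y, 'k) category_scheme"
    and A' :: "('o, 'a, 'x, 'y) right_action"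
    and H :: "('v, 'w, 'x, 'y, 'l) cfunctor_scheme"
    and s :: "'v \<times> 'o \<Rightarrow> 'y" +
  assumes rho_iso: "\<lbrakk>S \<in> Obj V; X \<in> Obj M\<rbrakk> \<Longrightarrow>
      s (S, X) \<in> iso W (fobj H (S \<triangleleft>\<^bsub>A\<^esub> X)) (fobj H S \<triangleleft>\<^bsub>A'\<^esub> X)"
    and rho_natural: "\<lbrakk>g \<in> hom V S S'; f \<in> hom M X X'\<rbrakk> \<Longrightarrow>
      s (S', X') \<cdot>\<^bsub>W\<^esub> farr H (g \<unlhd>\<^bsub>A\<^esub> f) = (farr H g \<unlhd>\<^bsub>A'\<^esub> f) \<cdot>\<^bsub>W\<^esub> s (S, X)"
    and rho_assoc: "\<lbrakk>S \<in> Obj V; X \<in> Obj M; Y \<in> Obj M\<rbrakk> \<Longrightarrow>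
      s (S, X \<otimes>\<^bsub>M\<^esub> Y) \<cdot>\<^bsub>W\<^esub> farr H (rassoc A S X Y) =
      rassoc A' (fobj H S) X Y \<cdot>\<^bsub>W\<^esub> (s (S, X) \<unlhd>\<^bsub>A'\<^esub> ident M Y) \<cdot>\<^bsub>W\<^esub> s (S \<triangleleft>\<^bsub>A\<^esub> X, Y)"
    and rho_unit: "S \<in> Obj V \<Longrightarrow> s (S, tunit M) = ident W (fobj H S)"

record ('o, 'v, 'w, 'x, 'y) bfunctor = "('v, 'w, 'x, 'y) cfunctor" +
  lam :: "'o \<times> 'v \<Rightarrow> 'y"
  rho :: "'v \<times> 'o \<Rightarrow> 'y"

locale bimodule_functor =
  V: bimodule_category M V + W: bimodule_category M W +
  L: left_module_functor M V "left V" W "left W" H "lam H" +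
  R: right_module_functor M V "right V" W "right W" H "rho H"
  for M :: "('o, 'a, 'm) monoidal_scheme"
    and V :: "('o, 'a, 'v, 'w) bimodule"
    and W :: "('o, 'a, 'x, 'y) bimodule"
    and H :: "('o, 'v, 'w, 'x, 'y) bfunctor" +
  assumes lam_rho: "\<lbrakk>X \<in> Obj M; S \<in> Obj V; Y \<in> Obj M\<rbrakk> \<Longrightarrow>
      (ident M X \<unrhd>\<^bsub>left W\<^esub> rho H (S, Y)) \<cdot>\<^bsub>W\<^esub> lam H (X, S \<triangleleft>\<^bsub>right V\<^esub> Y) \<cdot>\<^bsub>W\<^esub>
        farr H (mid V X S Y) =
      mid W X (fobj H S) Y \<cdot>\<^bsub>W\<^esub> (lam H (X, S) \<unlhd>\<^bsub>right W\<^esub> ident M Y) \<cdot>\<^bsub>W\<^esub>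
        rho H (X \<triangleright>\<^bsub>left V\<^esub> S, Y)"

definition bimodule_transformation ::
  "('o, 'a, 'm) monoidal_scheme \<Rightarrow> ('o, 'a, 'v, 'w) bimodule \<Rightarrow> ('o, 'a, 'x, 'y) bimodule \<Rightarrow>
    ('o, 'v, 'w, 'x, 'y) bfunctor \<Rightarrow> ('o, 'v, 'w, 'x, 'y) bfunctor \<Rightarrow> ('v \<Rightarrow> 'y) \<Rightarrow> bool" where
  "bimodule_transformation M V W H K \<theta> \<longleftrightarrow> nat_transformation V W H K \<theta> \<and>
    (\<forall>X\<in>Obj M. \<forall>S\<in>Obj V.
      (ident M X \<unrhd>\<^bsub>left W\<^esub> \<theta> S) \<cdot>\<^bsub>W\<^esub> lam H (X, S) = lam K (X, S) \<cdot>\<^bsub>W\<^esub> \<theta> (X \<triangleright>\<^bsub>left V\<^esub> S) \<and>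
      (\<theta> S \<unlhd>\<^bsub>right W\<^esub> ident M X) \<cdot>\<^bsub>W\<^esub> rho H (S, X) = rho K (S, X) \<cdot>\<^bsub>W\<^esub> \<theta> (S \<triangleleft>\<^bsub>right V\<^esub> X))"

text \<open>
  The category of bimodule functors. All data are extensional, i.e. \<open>undefined\<close> outside of the
  carriers, so that equality in HOL is equality of functors and of natural transformations.
  An arrow is a triple of its source, its target and the family of components.
\<close>

definition extensional_bfunctor ::
  "('o, 'a, 'm) monoidal_scheme \<Rightarrow> ('v, 'w, 'n) category_scheme \<Rightarrow>
    ('o, 'v, 'w, 'x, 'y) bfunctor \<Rightarrow> bool" where
  "extensional_bfunctor M V H \<longleftrightarrow>
    fobj H \<in> extensional (Obj V) \<and> farr H \<in> extensional (Arr V) \<and>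
    lam H \<in> extensional (Obj M \<times> Obj V) \<and> rho H \<in> extensional (Obj V \<times> Obj M)"

type_synonym ('o, 'v, 'w, 'x, 'y) btrans =
  "('o, 'v, 'w, 'x, 'y) bfunctor \<times> ('o, 'v, 'w, 'x, 'y) bfunctor \<times> ('v \<Rightarrow> 'y)"

definition BiMod ::
  "('o, 'a, 'm) monoidal_scheme \<Rightarrow> ('o, 'a, 'v, 'w) bimodule \<Rightarrow> ('o, 'a, 'x, 'y) bimodule \<Rightarrow>
    (('o, 'v, 'w, 'x, 'y) bfunctor, ('o, 'v, 'w, 'x, 'y) btrans) category" where
  "BiMod M V W =
    (let Ob = {H. bimodule_functor M V W H \<and> extensional_bfunctor M V H} in
    \<lparr>Obj = Ob,
     Arr = {(H, K, \<theta>). H \<in> Ob \<and> K \<in> Ob \<and> bimodule_transformation M V W H K \<theta> \<and>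
       \<theta> \<in> extensional (Obj V)},
     Dom = (\<lambda>(H, K, \<theta>). H),
     Cod = (\<lambda>(H, K, \<theta>). K),
     ident = (\<lambda>H. (H, H, \<lambda>S\<in>Obj V. ident W (fobj H S))),
     Comp = (\<lambda>(H', K', \<theta>') (H, K, \<theta>). (H, K', \<lambda>S\<in>Obj V. \<theta>' S \<cdot>\<^bsub>W\<^esub> \<theta> S))\<rparr>)"

text \<open>The composite \<open>H \<circ> K\<close> of bimodule functors \<open>K: U \<rightarrow> V\<close> and \<open>H: V \<rightarrow> W\<close>.\<close>

definition bfunctor_comp ::
  "('o, 'a, 'm) monoidal_scheme \<Rightarrow> ('u, 't, 'n) category_scheme \<Rightarrow> ('x, 'y, 'k) category_scheme \<Rightarrow>
    ('o, 'v, 'w, 'x, 'y) bfunctor \<Rightarrow> ('o, 'u, 't, 'v, 'w) bfunctor \<Rightarrow>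
    ('o, 'u, 't, 'x, 'y) bfunctor" where
  "bfunctor_comp M U W H K =
    \<lparr>fobj = (\<lambda>S\<in>Obj U. fobj H (fobj K S)),
     farr = (\<lambda>f\<in>Arr U. farr H (farr K f)),
     lam = (\<lambda>(X, S)\<in>Obj M \<times> Obj U. lam H (X, fobj K S) \<cdot>\<^bsub>W\<^esub> farr H (lam K (X, S))),
     rho = (\<lambda>(S, X)\<in>Obj U \<times> Obj M. rho H (fobj K S, X) \<cdot>\<^bsub>W\<^esub> farr H (rho K (S, X)))\<rparr>"


section \<open>Mixed relative centers\<close>

text \<open>
  In the admissibility condition the domain of \<open>\<tau> Q\<close> is \<open>F (P Q)\<close>, which agrees with
  \<open>F' (G1 (P Q))\<close> and \<open>F' (G2 (P Q))\<close> when \<open>F' G1 = F = F' G2\<close>.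
\<close>

locale center_object =
  M: monoidal_category M + N: monoidal_category N + B: strict_braided_category B
  for M :: "('o, 'a, 'm) monoidal_scheme"
    and B :: "('p, 'b, 'k) braided_scheme"
    and P :: "('p, 'b, 'o, 'a) mfunctor"
    and \<tau> :: "'p \<Rightarrow> 'b"
    and N :: "('v, 'w, 'n) monoidal_scheme"
    and F' :: "('v, 'w, 'p, 'b) mfunctor"
    and G1 G2 :: "('o, 'a, 'v, 'w) mfunctor"
    and V :: 'v
    and c :: "'o \<Rightarrow> 'w" +
  assumes V_in: "V \<in> Obj N"
    and c_extensional: "c \<in> extensional (Obj M)"
    and c_iso: "X \<in> Obj M \<Longrightarrow> c X \<in> iso N (V \<otimes>\<^bsub>N\<^esub> fobj G2 X) (fobj G1 X \<otimes>\<^bsub>N\<^esub> V)"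
    and c_natural: "f \<in> hom M X Y \<Longrightarrow>
      c Y \<cdot>\<^bsub>N\<^esub> (ident N V \<boxtimes>\<^bsub>N\<^esub> farr G2 f) = (farr G1 f \<boxtimes>\<^bsub>N\<^esub> ident N V) \<cdot>\<^bsub>N\<^esub> c X"
    and c_tensor: "\<lbrakk>X \<in> Obj M; Y \<in> Obj M\<rbrakk> \<Longrightarrow>
      c (X \<otimes>\<^bsub>M\<^esub> Y) =
      (inv_arr N (fmu G1 X Y) \<boxtimes>\<^bsub>N\<^esub> ident N V) \<cdot>\<^bsub>N\<^esub>
      inv_arr N (assoc N (fobj G1 X) (fobj G1 Y) V) \<cdot>\<^bsub>N\<^esub>
      (ident N (fobj G1 X) \<boxtimes>\<^bsub>N\<^esub> c Y) \<cdot>\<^bsub>N\<^esub>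
      assoc N (fobj G1 X) V (fobj G2 Y) \<cdot>\<^bsub>N\<^esub>
      (c X \<boxtimes>\<^bsub>N\<^esub> ident N (fobj G2 Y)) \<cdot>\<^bsub>N\<^esub>
      inv_arr N (assoc N V (fobj G2 X) (fobj G2 Y)) \<cdot>\<^bsub>N\<^esub>
      (ident N V \<boxtimes>\<^bsub>N\<^esub> fmu G2 X Y)"
    and c_admissible: "Q \<in> Obj B \<Longrightarrow>
      (\<tau> Q \<boxtimes>\<^bsub>B\<^esub> ident B (fobj F' V)) \<cdot>\<^bsub>B\<^esub>
      fmu F' (fobj G1 (fobj P Q)) V \<cdot>\<^bsub>B\<^esub>
      farr F' (c (fobj P Q)) \<cdot>\<^bsub>B\<^esub>
      inv_arr B (fmu F' V (fobj G2 (fobj P Q))) \<cdot>\<^bsub>B\<^esub>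
      (ident B (fobj F' V) \<boxtimes>\<^bsub>B\<^esub> inv_arr B (\<tau> Q)) =
      braid B (fobj F' V) Q"

text \<open>An arrow is a triple of its source, its target and the underlying arrow of \<open>N\<close>.\<close>

type_synonym ('o, 'v, 'w) cobj = "'v \<times> ('o \<Rightarrow> 'w)"

type_synonym ('o, 'v, 'w) carr = "('o, 'v, 'w) cobj \<times> ('o, 'v, 'w) cobj \<times> 'w"

definition mixed_center ::
  "('o, 'a, 'm) monoidal_scheme \<Rightarrow> ('p, 'b, 'k) braided_scheme \<Rightarrow> ('p, 'b, 'o, 'a) mfunctor \<Rightarrow>
    ('p \<Rightarrow> 'b) \<Rightarrow> ('v, 'w, 'n) monoidal_scheme \<Rightarrow> ('v, 'w, 'p, 'b) mfunctor \<Rightarrow>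
    ('o, 'a, 'v, 'w) mfunctor \<Rightarrow> ('o, 'a, 'v, 'w) mfunctor \<Rightarrow>
    (('o, 'v, 'w) cobj, ('o, 'v, 'w) carr) category" where
  "mixed_center M B P \<tau> N F' G1 G2 =
    (let Ob = {(V, c). center_object M B P \<tau> N F' G1 G2 V c} in
    \<lparr>Obj = Ob,
     Arr = {((V, c), (W, d), f). (V, c) \<in> Ob \<and> (W, d) \<in> Ob \<and> f \<in> hom N V W \<and>
       (\<forall>X\<in>Obj M. (ident N (fobj G1 X) \<boxtimes>\<^bsub>N\<^esub> f) \<cdot>\<^bsub>N\<^esub> c X =
         d X \<cdot>\<^bsub>N\<^esub> (f \<boxtimes>\<^bsub>N\<^esub> ident N (fobj G2 X)))},
     Dom = (\<lambda>(S, T, f). S),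
     Cod = (\<lambda>(S, T, f). T),
     ident = (\<lambda>(V, c). ((V, c), (V, c), ident N V)),
     Comp = (\<lambda>(S', T', g) (S, T, f). (S, T', g \<cdot>\<^bsub>N\<^esub> f))\<rparr>)"

definition center_tensor ::
  "('o, 'a, 'm) monoidal_scheme \<Rightarrow> ('o, 'o, 'a) cobj \<Rightarrow> ('o, 'o, 'a) cobj \<Rightarrow> ('o, 'o, 'a) cobj" where
  "center_tensor M = (\<lambda>(V, c) (W, d). (V \<otimes>\<^bsub>M\<^esub> W,
    \<lambda>X\<in>Obj M. assoc M X V W \<cdot>\<^bsub>M\<^esub> (c X \<boxtimes>\<^bsub>M\<^esub> ident M W) \<cdot>\<^bsub>M\<^esub> inv_arr M (assoc M V X W) \<cdot>\<^bsub>M\<^esub>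
      (ident M V \<boxtimes>\<^bsub>M\<^esub> d X) \<cdot>\<^bsub>M\<^esub> assoc M V W X))"

definition relative_center ::
  "('o, 'a, 'm) monoidal_scheme \<Rightarrow> ('p, 'b, 'k) braided_scheme \<Rightarrow> ('o, 'a, 'p, 'b) mfunctor \<Rightarrow>
    ('p, 'b, 'o, 'a) mfunctor \<Rightarrow> ('p \<Rightarrow> 'b) \<Rightarrow>
    (('o, 'o, 'a) cobj, ('o, 'o, 'a) carr) monoidal" where
  "relative_center M B F P \<tau> =
    category.extend (mixed_center M B P \<tau> M F (mfunctor_id M) (mfunctor_id M))
      (monoidal.fields
        (tunit M, \<lambda>X\<in>Obj M. ident M X)
        (center_tensor M)
        (\<lambda>(S, S', f) (T, T', g). (center_tensor M S T, center_tensor M S' T', f \<boxtimes>\<^bsub>M\<^esub> g))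
        (\<lambda>S T U. (center_tensor M (center_tensor M S T) U, center_tensor M S (center_tensor M T U),
          assoc M (fst S) (fst T) (fst U))))"


section \<open>The action by composition\<close>

definition Phi ::
  "('o, 'a, 'm) monoidal_scheme \<Rightarrow> ('o, 'o, 'a) cobj \<Rightarrow> ('o, 'o, 'a, 'o, 'a) bfunctor" where
  "Phi M = (\<lambda>(V, c).
    \<lparr>fobj = (\<lambda>X\<in>Obj M. X \<otimes>\<^bsub>M\<^esub> V),
     farr = (\<lambda>f\<in>Arr M. f \<boxtimes>\<^bsub>M\<^esub> ident M V),
     lam = (\<lambda>(X, Y)\<in>Obj M \<times> Obj M. assoc M X Y V),
     rho = (\<lambda>(X, Y)\<in>Obj M \<times> Obj M.
       inv_arr M (assoc M X V Y) \<cdot>\<^bsub>M\<^esub> (ident M X \<boxtimes>\<^bsub>M\<^esub> inv_arr M (c Y)) \<cdot>\<^bsub>M\<^esub> assoc M X Y V)\<rparr>)"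

text \<open>
  On objects the action is \<open>(V, c) \<triangleright> H = H \<circ> \<Phi>(V, c)\<close>. On arrows it is the horizontal
  composite of \<open>\<theta>: H \<Rightarrow> K\<close> with the natural transformation
  \<open>id \<otimes> f: \<Phi>(V, c) \<Rightarrow> \<Phi>(W, d)\<close>. Its associativity isomorphism is \<open>H\<close> applied to the
  components \<open>\<alpha>: (X \<otimes> V) \<otimes> W \<rightarrow> X \<otimes> (V \<otimes> W)\<close> of the isomorphism between
  \<open>\<Phi>(W, d) \<circ> \<Phi>(V, c)\<close> and \<open>\<Phi>((V, c) \<otimes> (W, d))\<close>.
\<close>

definition composition_action ::
  "('o, 'a, 'm) monoidal_scheme \<Rightarrow> ('o, 'a, 'v, 'w) bimodule \<Rightarrow>
    (('o, 'o, 'a) cobj, ('o, 'o, 'a) carr,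
     ('o, 'o, 'a, 'v, 'w) bfunctor, ('o, 'o, 'a, 'v, 'w) btrans) left_action" where
  "composition_action M V =
    (let act = (\<lambda>S H. bfunctor_comp M M V H (Phi M S)) in
    \<lparr>lobj = act,
     larr = (\<lambda>(S, T, f) (H, K, \<theta>). (act S H, act T K,
       \<lambda>X\<in>Obj M. \<theta> (X \<otimes>\<^bsub>M\<^esub> fst T) \<cdot>\<^bsub>V\<^esub> farr H (ident M X \<boxtimes>\<^bsub>M\<^esub> f))),
     lassoc = (\<lambda>S T H. (act S (act T H), act (center_tensor M S T) H,
       \<lambda>X\<in>Obj M. farr H (assoc M X (fst S) (fst T))))\<rparr>)"

text \<open>
  The functor identifying bimodule functors \<open>H\<close> from the regular bimodule to \<open>twisted N G1 G2\<close>
  with pairs of an object \<open>H I\<close> and a half-braiding, on arrows \<open>\<theta> \<mapsto> \<theta>\<^sub>I\<close>.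
\<close>

definition center_functor ::
  "('o, 'a, 'm) monoidal_scheme \<Rightarrow> ('v, 'w, 'n) monoidal_scheme \<Rightarrow>
    (('o, 'o, 'a, 'v, 'w) bfunctor, ('o, 'o, 'a, 'v, 'w) btrans,
     ('o, 'v, 'w) cobj, ('o, 'v, 'w) carr) cfunctor" where
  "center_functor M N =
    (let ev = (\<lambda>H. (fobj H (tunit M),
       \<lambda>X\<in>Obj M. lam H (X, tunit M) \<cdot>\<^bsub>N\<^esub> inv_arr N (rho H (tunit M, X)))) in
    \<lparr>fobj = ev, farr = (\<lambda>(H, K, \<theta>). (ev H, ev K, \<theta> (tunit M)))\<rparr>)"

text \<open>
  The full subcategory of bimodule functors corresponding to objects of the mixed relative
  center.
\<close>

definition admissible_BiMod ::
  "('o, 'a, 'm) monoidal_scheme \<Rightarrow> ('p, 'b, 'k) braided_scheme \<Rightarrow> ('p, 'b, 'o, 'a) mfunctor \<Rightarrow>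
    ('p \<Rightarrow> 'b) \<Rightarrow> ('v, 'w, 'n) monoidal_scheme \<Rightarrow> ('v, 'w, 'p, 'b) mfunctor \<Rightarrow>
    ('o, 'a, 'v, 'w) mfunctor \<Rightarrow> ('o, 'a, 'v, 'w) mfunctor \<Rightarrow>
    (('o, 'o, 'a, 'v, 'w) bfunctor, ('o, 'o, 'a, 'v, 'w) btrans) category" where
  "admissible_BiMod M B P \<tau> N F' G1 G2 =
    full_subcategory (BiMod M (regular M) (twisted N G1 G2))
      {H. fobj (center_functor M N) H \<in> Obj (mixed_center M B P \<tau> N F' G1 G2)}"

end

theory Submission
  imports Defs
begin

text \<open>
  The regular bimodule is free on the unit object \<open>I\<close>. A bimodule functor \<open>H\<close> from it to a bimodule
  \<open>V\<close> is isomorphic to \<open>X \<mapsto> X \<triangleright> H I\<close> (lemma \<open>unit_btransformation\<close>), its right structure amounts to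
  a half-braiding on \<open>H I\<close> (lemma \<open>half_braiding_of_half_braiding\<close>), and conversely each half-braided
  object defines such a functor (lemma \<open>free_functor_bimodule_functor\<close>). All this holds in an
  arbitrary bimodule.

  For endofunctors of the regular bimodule this explains the monoidal structure of the center: the
  object \<open>S \<otimes> T\<close> is the value at the unit of \<open>\<Phi> T \<circ> \<Phi> S\<close> (lemma \<open>half_braiding_of_PhiPhi\<close>), and the
  resulting isomorphism between \<open>\<Phi> T \<circ> \<Phi> S\<close> and \<open>\<Phi> (S \<otimes> T)\<close> has the associator as components.
  Composition of functors being strictly associative, \<open>H \<mapsto> H \<circ> \<Phi> S\<close> is an action whose coherence is
  inherited from the pentagon of \<open>M\<close> (lemma \<open>composition_module\<close>). The facts about tensor products of
  half-braidings are likewise obtained by evaluating transformations at the unit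
  (lemma \<open>unit_component_half_braiding\<close>) instead of by direct computation.

  Admissibility is the one condition that is not formal. The value of \<open>H \<circ> \<Phi> (V, c)\<close> at the unit is
  isomorphic to \<open>G1 V \<otimes> H I\<close>, with a half-braiding composed of \<open>G1 c\<close> and that of \<open>H I\<close>. Applying \<open>F'\<close>
  yields two braidings, which the hexagon identity combines into one (lemma \<open>admissible_tensor\<close>). This
  shows both that the relative center is closed under tensor products and that the action
  preserves admissible functors.

  Finally, evaluation at the unit and formation of free functors are mutually inverse equivalences
  between admissible bimodule functors and the mixed center, and evaluation after the free functor is
  the identity on the nose. Along such an equivalence a module structure with strict units can be
  transported (locale \<open>module_transport\<close>), which gives the action on the mixed center.
\<close>

section \<open>Arrows, isomorphisms and their inverses\<close>

lemma hom_iff [simp]: "f \<in> hom C X Y \<longleftrightarrow> f \<in> Arr C \<and> Dom C f = X \<and> Cod C f = Y"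
  by (auto simp: hom_def)

text \<open>
  Here isomorphisms form a set without prescribed endpoints, so that being invertible and the
  values of \<open>Dom\<close> and \<open>Cod\<close> are separate facts, each of which the simplifier can establish.
\<close>

definition isos :: "('o, 'a, 'm) category_scheme \<Rightarrow> 'a set" where
  "isos C = {f \<in> Arr C. \<exists>g. inverse_arrows C f g}"

lemma iso_iff [simp]: "f \<in> iso C X Y \<longleftrightarrow> f \<in> isos C \<and> Dom C f = X \<and> Cod C f = Y"
  by (auto simp: iso_def isos_def)

lemma isos_arr: "f \<in> isos C \<Longrightarrow> f \<in> Arr C"
  by (simp add: isos_def)

context category
begin

lemmas [simp] = Dom_in Cod_in

lemma Comp_arr [simp]: "\<lbrakk>f \<in> Arr C; g \<in> Arr C; Dom C g = Cod C f\<rbrakk> \<Longrightarrow> g \<cdot> f \<in> Arr C"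
  and Comp_dom [simp]: "\<lbrakk>f \<in> Arr C; g \<in> Arr C; Dom C g = Cod C f\<rbrakk> \<Longrightarrow> Dom C (g \<cdot> f) = Dom C f"
  and Comp_cod [simp]: "\<lbrakk>f \<in> Arr C; g \<in> Arr C; Dom C g = Cod C f\<rbrakk> \<Longrightarrow> Cod C (g \<cdot> f) = Cod C g"
  using Comp_in[of f "Dom C f" "Cod C f" g "Cod C g"] by auto

lemma ident_arr [simp]: "X \<in> Obj C \<Longrightarrow> ident C X \<in> Arr C"
  and ident_dom [simp]: "X \<in> Obj C \<Longrightarrow> Dom C (ident C X) = X"
  and ident_cod [simp]: "X \<in> Obj C \<Longrightarrow> Cod C (ident C X) = X"
  using ident_in[of X] by auto

lemma ident_left [simp]: "\<lbrakk>f \<in> Arr C; Cod C f = Y\<rbrakk> \<Longrightarrow> ident C Y \<cdot> f = f"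
  by (rule Comp_ident_left) auto

lemma ident_right [simp]: "\<lbrakk>f \<in> Arr C; Dom C f = X\<rbrakk> \<Longrightarrow> f \<cdot> ident C X = f"
  by (rule Comp_ident_right) auto

lemma comp_assoc [simp]:
  "\<lbrakk>f \<in> Arr C; g \<in> Arr C; h \<in> Arr C; Dom C g = Cod C f; Dom C h = Cod C g\<rbrakk> \<Longrightarrow>
    (h \<cdot> g) \<cdot> f = h \<cdot> (g \<cdot> f)"
  by (rule Comp_assoc) auto

text \<open>
  Composites are kept bracketed to the right, so an equation between composites has to be applied
  in front of a further arrow \<open>x\<close>; the next two rules put it into that form.
\<close>

lemma front2: "\<lbrakk>a \<cdot> b = c; a \<in> Arr C; b \<in> Arr C; Dom C a = Cod C b; x \<in> Arr C; Cod C x = Dom C b\<rbrakk> \<Longrightarrow>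
    a \<cdot> (b \<cdot> x) = c \<cdot> x"
  by (metis comp_assoc)

lemma front3: "\<lbrakk>a \<cdot> (b \<cdot> d) = c; a \<in> Arr C; b \<in> Arr C; d \<in> Arr C; Dom C a = Cod C b;
    Dom C b = Cod C d; x \<in> Arr C; Cod C x = Dom C d\<rbrakk> \<Longrightarrow>
    a \<cdot> (b \<cdot> (d \<cdot> x)) = c \<cdot> x"
  by (metis comp_assoc Comp_arr Comp_cod Comp_dom)

lemma inverse_unique:
  assumes "inverse_arrows C f g" "inverse_arrows C f h"
  shows "g = h"
proof -
  have "g = (h \<cdot> f) \<cdot> g" using assms by (auto simp: inverse_arrows_def)
  also have "\<dots> = h \<cdot> (f \<cdot> g)" using assms by (intro comp_assoc) (auto simp: inverse_arrows_def)
  also have "\<dots> = h" using assms by (auto simp: inverse_arrows_def)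
  finally show ?thesis .
qed

lemma isosI:
  assumes "f \<in> Arr C" "g \<in> Arr C" "Dom C g = Cod C f" "Cod C g = Dom C f"
    "g \<cdot> f = ident C (Dom C f)" "f \<cdot> g = ident C (Cod C f)"
  shows "f \<in> isos C" "inv_arr C f = g"
proof -
  have "inverse_arrows C f g" using assms by (simp add: inverse_arrows_def)
  then show "f \<in> isos C" "inv_arr C f = g"
    using assms inverse_unique by (auto simp: isos_def inv_arr_def)
qed

lemma inverse_inv_arr: "f \<in> isos C \<Longrightarrow> inverse_arrows C f (inv_arr C f)"
  using inverse_unique unfolding isos_def inv_arr_def by (auto intro: theI)

lemma inv_arr [simp]: "f \<in> isos C \<Longrightarrow> inv_arr C f \<in> Arr C"
  and inv_dom [simp]: "f \<in> isos C \<Longrightarrow> Dom C (inv_arr C f) = Cod C f"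
  and inv_cod [simp]: "f \<in> isos C \<Longrightarrow> Cod C (inv_arr C f) = Dom C f"
  and inv_comp [simp]: "f \<in> isos C \<Longrightarrow> inv_arr C f \<cdot> f = ident C (Dom C f)"
  and comp_inv [simp]: "f \<in> isos C \<Longrightarrow> f \<cdot> inv_arr C f = ident C (Cod C f)"
  using inverse_inv_arr[of f] by (auto simp: inverse_arrows_def)

lemma inv_comp_pre [simp]: "\<lbrakk>f \<in> isos C; x \<in> Arr C; Cod C x = Dom C f\<rbrakk> \<Longrightarrow> inv_arr C f \<cdot> (f \<cdot> x) = x"
  and comp_inv_pre [simp]: "\<lbrakk>f \<in> isos C; x \<in> Arr C; Cod C x = Cod C f\<rbrakk> \<Longrightarrow> f \<cdot> (inv_arr C f \<cdot> x) = x"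
  by (auto simp: isos_arr simp flip: comp_assoc)

lemma ident_isos [simp]: "X \<in> Obj C \<Longrightarrow> ident C X \<in> isos C"
  and inv_ident [simp]: "X \<in> Obj C \<Longrightarrow> inv_arr C (ident C X) = ident C X"
  using isosI[of "ident C X" "ident C X"] by auto

lemma inv_isos [simp]: "f \<in> isos C \<Longrightarrow> inv_arr C f \<in> isos C"
  and inv_inv [simp]: "f \<in> isos C \<Longrightarrow> inv_arr C (inv_arr C f) = f"
  using isosI[of "inv_arr C f" f] by (auto simp: isos_arr)

lemma Comp_isos [simp]: "\<lbrakk>f \<in> isos C; g \<in> isos C; Dom C g = Cod C f\<rbrakk> \<Longrightarrow> g \<cdot> f \<in> isos C"
  and inv_Comp: "\<lbrakk>f \<in> isos C; g \<in> isos C; Dom C g = Cod C f\<rbrakk> \<Longrightarrow>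
    inv_arr C (g \<cdot> f) = inv_arr C f \<cdot> inv_arr C g"
  using isosI[of "g \<cdot> f" "inv_arr C f \<cdot> inv_arr C g"] by (auto simp: isos_arr)

lemma inv_eqI:
  assumes "inv_arr C f = inv_arr C g" "f \<in> isos C" "g \<in> isos C"
  shows "f = g"
  using assms by (metis inv_inv)

lemma inv_square:
  assumes "l' \<cdot> p = q \<cdot> l" "l \<in> isos C" "l' \<in> isos C" "p \<in> Arr C" "q \<in> Arr C"
    "Dom C l' = Cod C p" "Dom C q = Cod C l" "Dom C p = Dom C l" "Cod C q = Cod C l'"
  shows "inv_arr C l' \<cdot> q = p \<cdot> inv_arr C l"
proof -
  have "inv_arr C l' \<cdot> q = inv_arr C l' \<cdot> ((q \<cdot> l) \<cdot> inv_arr C l)"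
    using assms(2-) by (simp add: isos_arr)
  also have "\<dots> = inv_arr C l' \<cdot> ((l' \<cdot> p) \<cdot> inv_arr C l)" using assms(1) by simp
  also have "\<dots> = p \<cdot> inv_arr C l" using assms(2-) by (simp add: isos_arr)
  finally show ?thesis .
qed

lemma iso_cancel_left:
  assumes "l \<cdot> p = l \<cdot> q" "l \<in> isos C" "p \<in> Arr C" "q \<in> Arr C" "Cod C p = Dom C l" "Cod C q = Dom C l"
  shows "p = q"
  using assms by (metis inv_comp_pre)

end

context cfunctor
begin

lemmas [simp] = fobj_in farr_ident

lemma farr_arr [simp]: "f \<in> Arr C \<Longrightarrow> farr F f \<in> Arr D"
  and farr_dom [simp]: "f \<in> Arr C \<Longrightarrow> Dom D (farr F f) = fobj F (Dom C f)"
  and farr_cod [simp]: "f \<in> Arr C \<Longrightarrow> Cod D (farr F f) = fobj F (Cod C f)"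
  using farr_in[of f "Dom C f" "Cod C f"] by auto

lemma farr_comp [simp]: "\<lbrakk>f \<in> Arr C; g \<in> Arr C; Dom C g = Cod C f\<rbrakk> \<Longrightarrow>
    farr F (g \<cdot>\<^bsub>C\<^esub> f) = farr F g \<cdot>\<^bsub>D\<^esub> farr F f"
  by (rule farr_Comp) auto

lemma farr_isos [simp]: "f \<in> isos C \<Longrightarrow> farr F f \<in> isos D"
  and farr_inv [simp]: "f \<in> isos C \<Longrightarrow> farr F (inv_arr C f) = inv_arr D (farr F f)"
proof -
  assume f: "f \<in> isos C"
  have "farr F (inv_arr C f) \<cdot>\<^bsub>D\<^esub> farr F f = ident D (Dom D (farr F f))"
    "farr F f \<cdot>\<^bsub>D\<^esub> farr F (inv_arr C f) = ident D (Cod D (farr F f))"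
    using f by (auto simp: isos_arr simp flip: farr_comp)
  then show "farr F f \<in> isos D" "farr F (inv_arr C f) = inv_arr D (farr F f)"
    using f D.isosI[of "farr F f" "farr F (inv_arr C f)"] by (auto simp: isos_arr)
qed

end

lemma (in nat_transformation) component_arr [simp]:
  "X \<in> Obj C \<Longrightarrow> \<theta> X \<in> Arr D"
  "X \<in> Obj C \<Longrightarrow> Dom D (\<theta> X) = fobj F X"
  "X \<in> Obj C \<Longrightarrow> Cod D (\<theta> X) = fobj G X"
  using component_in[of X] by auto

section \<open>Bifunctors and structure isomorphisms\<close>

context monoidal_category
begin

lemmas [simp] = tunit_in tobj_in tarr_ident tunit_obj_left tunit_obj_right tunit_arr_left
  tunit_arr_right

lemma tarr_arr [simp]: "\<lbrakk>f \<in> Arr C; g \<in> Arr C\<rbrakk> \<Longrightarrow> f \<boxtimes> g \<in> Arr C"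
  and tarr_dom [simp]: "\<lbrakk>f \<in> Arr C; g \<in> Arr C\<rbrakk> \<Longrightarrow> Dom C (f \<boxtimes> g) = Dom C f \<otimes> Dom C g"
  and tarr_cod [simp]: "\<lbrakk>f \<in> Arr C; g \<in> Arr C\<rbrakk> \<Longrightarrow> Cod C (f \<boxtimes> g) = Cod C f \<otimes> Cod C g"
  using tarr_in[of f "Dom C f" "Cod C f" g "Dom C g" "Cod C g"] by auto

lemma interchange: "\<lbrakk>f \<in> Arr C; f' \<in> Arr C; g \<in> Arr C; g' \<in> Arr C; Dom C f' = Cod C f;
    Dom C g' = Cod C g\<rbrakk> \<Longrightarrow> (f' \<boxtimes> g') \<cdot> (f \<boxtimes> g) = (f' \<cdot> f) \<boxtimes> (g' \<cdot> g)"
  by (rule tarr_Comp[symmetric]) auto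

lemma interchange_pre: "\<lbrakk>f \<in> Arr C; f' \<in> Arr C; g \<in> Arr C; g' \<in> Arr C; Dom C f' = Cod C f;
    Dom C g' = Cod C g; x \<in> Arr C; Cod C x = Dom C f \<otimes> Dom C g\<rbrakk> \<Longrightarrow>
    (f' \<boxtimes> g') \<cdot> ((f \<boxtimes> g) \<cdot> x) = ((f' \<cdot> f) \<boxtimes> (g' \<cdot> g)) \<cdot> x"
  by (rule front2[OF interchange]) auto

lemma tarr_isos [simp]: "\<lbrakk>f \<in> isos C; g \<in> isos C\<rbrakk> \<Longrightarrow> f \<boxtimes> g \<in> isos C"
  and inv_tarr: "\<lbrakk>f \<in> isos C; g \<in> isos C\<rbrakk> \<Longrightarrow> inv_arr C (f \<boxtimes> g) = inv_arr C f \<boxtimes> inv_arr C g"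
  using isosI[of "f \<boxtimes> g" "inv_arr C f \<boxtimes> inv_arr C g"] by (auto simp: isos_arr interchange)

lemma assoc_isos [simp]:
  "\<lbrakk>X \<in> Obj C; Y \<in> Obj C; Z \<in> Obj C\<rbrakk> \<Longrightarrow> assoc C X Y Z \<in> isos C"
  "\<lbrakk>X \<in> Obj C; Y \<in> Obj C; Z \<in> Obj C\<rbrakk> \<Longrightarrow> assoc C X Y Z \<in> Arr C"
  "\<lbrakk>X \<in> Obj C; Y \<in> Obj C; Z \<in> Obj C\<rbrakk> \<Longrightarrow> Dom C (assoc C X Y Z) = (X \<otimes> Y) \<otimes> Z"
  "\<lbrakk>X \<in> Obj C; Y \<in> Obj C; Z \<in> Obj C\<rbrakk> \<Longrightarrow> Cod C (assoc C X Y Z) = X \<otimes> (Y \<otimes> Z)"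
  using assoc_iso[of X Y Z] by (auto simp: isos_arr)

lemma assoc_unit_simps [simp]:
  "\<lbrakk>X \<in> Obj C; Y \<in> Obj C\<rbrakk> \<Longrightarrow> assoc C (tunit C) X Y = ident C (X \<otimes> Y)"
  "\<lbrakk>X \<in> Obj C; Y \<in> Obj C\<rbrakk> \<Longrightarrow> assoc C X (tunit C) Y = ident C (X \<otimes> Y)"
  "\<lbrakk>X \<in> Obj C; Y \<in> Obj C\<rbrakk> \<Longrightarrow> assoc C X Y (tunit C) = ident C (X \<otimes> Y)"
  using assoc_unit by auto

lemma assoc_square: "\<lbrakk>f \<in> Arr C; g \<in> Arr C; h \<in> Arr C\<rbrakk> \<Longrightarrow>
    assoc C (Cod C f) (Cod C g) (Cod C h) \<cdot> ((f \<boxtimes> g) \<boxtimes> h) =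
    (f \<boxtimes> (g \<boxtimes> h)) \<cdot> assoc C (Dom C f) (Dom C g) (Dom C h)"
  by (rule assoc_natural) auto

end

context monoidal_functor
begin

lemmas [simp] = fobj_unit

lemma mu_isos [simp]:
  "\<lbrakk>X \<in> Obj C; Y \<in> Obj C\<rbrakk> \<Longrightarrow> fmu G X Y \<in> isos D"
  "\<lbrakk>X \<in> Obj C; Y \<in> Obj C\<rbrakk> \<Longrightarrow> fmu G X Y \<in> Arr D"
  "\<lbrakk>X \<in> Obj C; Y \<in> Obj C\<rbrakk> \<Longrightarrow> Dom D (fmu G X Y) = fobj G (X \<otimes>\<^bsub>C\<^esub> Y)"
  "\<lbrakk>X \<in> Obj C; Y \<in> Obj C\<rbrakk> \<Longrightarrow> Cod D (fmu G X Y) = fobj G X \<otimes>\<^bsub>D\<^esub> fobj G Y"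
  using mu_iso[of X Y] by (auto simp: isos_arr)

lemma mu_unit_simps [simp]:
  "X \<in> Obj C \<Longrightarrow> fmu G (tunit C) X = ident D (fobj G X)"
  "X \<in> Obj C \<Longrightarrow> fmu G X (tunit C) = ident D (fobj G X)"
  using mu_unit by auto

lemma mu_square: "\<lbrakk>f \<in> Arr C; g \<in> Arr C\<rbrakk> \<Longrightarrow>
    fmu G (Cod C f) (Cod C g) \<cdot>\<^bsub>D\<^esub> farr G (f \<boxtimes>\<^bsub>C\<^esub> g) =
    (farr G f \<boxtimes>\<^bsub>D\<^esub> farr G g) \<cdot>\<^bsub>D\<^esub> fmu G (Dom C f) (Dom C g)"
  by (rule mu_natural) auto

end

context left_module_category
begin

lemmas [simp] = lobj_in larr_ident lobj_unit larr_unit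

lemma larr_arr [simp]: "\<lbrakk>f \<in> Arr M; h \<in> Arr V\<rbrakk> \<Longrightarrow> f \<unrhd> h \<in> Arr V"
  and larr_dom [simp]: "\<lbrakk>f \<in> Arr M; h \<in> Arr V\<rbrakk> \<Longrightarrow> Dom V (f \<unrhd> h) = Dom M f \<triangleright> Dom V h"
  and larr_cod [simp]: "\<lbrakk>f \<in> Arr M; h \<in> Arr V\<rbrakk> \<Longrightarrow> Cod V (f \<unrhd> h) = Cod M f \<triangleright> Cod V h"
  using larr_in[of f "Dom M f" "Cod M f" h "Dom V h" "Cod V h"] by auto

lemma linterchange: "\<lbrakk>f \<in> Arr M; f' \<in> Arr M; h \<in> Arr V; h' \<in> Arr V; Dom M f' = Cod M f;
    Dom V h' = Cod V h\<rbrakk> \<Longrightarrow> (f' \<unrhd> h') \<cdot>\<^bsub>V\<^esub> (f \<unrhd> h) = (f' \<cdot>\<^bsub>M\<^esub> f) \<unrhd> (h' \<cdot>\<^bsub>V\<^esub> h)"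
  by (rule larr_Comp[symmetric]) auto

lemma larr_isos [simp]: "\<lbrakk>f \<in> isos M; h \<in> isos V\<rbrakk> \<Longrightarrow> f \<unrhd> h \<in> isos V"
  and inv_larr: "\<lbrakk>f \<in> isos M; h \<in> isos V\<rbrakk> \<Longrightarrow> inv_arr V (f \<unrhd> h) = inv_arr M f \<unrhd> inv_arr V h"
  using V.isosI[of "f \<unrhd> h" "inv_arr M f \<unrhd> inv_arr V h"] by (auto simp: isos_arr linterchange)

lemma lassoc_isos [simp]:
  "\<lbrakk>X \<in> Obj M; Y \<in> Obj M; S \<in> Obj V\<rbrakk> \<Longrightarrow> lassoc A X Y S \<in> isos V"
  "\<lbrakk>X \<in> Obj M; Y \<in> Obj M; S \<in> Obj V\<rbrakk> \<Longrightarrow> lassoc A X Y S \<in> Arr V"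
  "\<lbrakk>X \<in> Obj M; Y \<in> Obj M; S \<in> Obj V\<rbrakk> \<Longrightarrow> Dom V (lassoc A X Y S) = X \<triangleright> (Y \<triangleright> S)"
  "\<lbrakk>X \<in> Obj M; Y \<in> Obj M; S \<in> Obj V\<rbrakk> \<Longrightarrow> Cod V (lassoc A X Y S) = (X \<otimes>\<^bsub>M\<^esub> Y) \<triangleright> S"
  using lassoc_iso[of X Y S] by (auto simp: isos_arr)

lemma lassoc_unit_simps [simp]:
  "\<lbrakk>X \<in> Obj M; S \<in> Obj V\<rbrakk> \<Longrightarrow> lassoc A (tunit M) X S = ident V (X \<triangleright> S)"
  "\<lbrakk>X \<in> Obj M; S \<in> Obj V\<rbrakk> \<Longrightarrow> lassoc A X (tunit M) S = ident V (X \<triangleright> S)"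
  using lassoc_unit by auto

lemma lassoc_square: "\<lbrakk>f \<in> Arr M; g \<in> Arr M; h \<in> Arr V\<rbrakk> \<Longrightarrow>
    lassoc A (Cod M f) (Cod M g) (Cod V h) \<cdot>\<^bsub>V\<^esub> (f \<unrhd> (g \<unrhd> h)) =
    ((f \<boxtimes>\<^bsub>M\<^esub> g) \<unrhd> h) \<cdot>\<^bsub>V\<^esub> lassoc A (Dom M f) (Dom M g) (Dom V h)"
  by (rule lassoc_natural) auto

end

context right_module_category
begin

lemmas [simp] = robj_in rarr_ident robj_unit rarr_unit

lemma rarr_arr [simp]: "\<lbrakk>h \<in> Arr V; f \<in> Arr M\<rbrakk> \<Longrightarrow> h \<unlhd> f \<in> Arr V"
  and rarr_dom [simp]: "\<lbrakk>h \<in> Arr V; f \<in> Arr M\<rbrakk> \<Longrightarrow> Dom V (h \<unlhd> f) = Dom V h \<triangleleft> Dom M f"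
  and rarr_cod [simp]: "\<lbrakk>h \<in> Arr V; f \<in> Arr M\<rbrakk> \<Longrightarrow> Cod V (h \<unlhd> f) = Cod V h \<triangleleft> Cod M f"
  using rarr_in[of h "Dom V h" "Cod V h" f "Dom M f" "Cod M f"] by auto

lemma rinterchange: "\<lbrakk>h \<in> Arr V; h' \<in> Arr V; f \<in> Arr M; f' \<in> Arr M; Dom M f' = Cod M f;
    Dom V h' = Cod V h\<rbrakk> \<Longrightarrow> (h' \<unlhd> f') \<cdot>\<^bsub>V\<^esub> (h \<unlhd> f) = (h' \<cdot>\<^bsub>V\<^esub> h) \<unlhd> (f' \<cdot>\<^bsub>M\<^esub> f)"
  by (rule rarr_Comp[symmetric]) auto

lemma rarr_isos [simp]: "\<lbrakk>h \<in> isos V; f \<in> isos M\<rbrakk> \<Longrightarrow> h \<unlhd> f \<in> isos V"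
  and inv_rarr: "\<lbrakk>h \<in> isos V; f \<in> isos M\<rbrakk> \<Longrightarrow> inv_arr V (h \<unlhd> f) = inv_arr V h \<unlhd> inv_arr M f"
  using V.isosI[of "h \<unlhd> f" "inv_arr V h \<unlhd> inv_arr M f"] by (auto simp: isos_arr rinterchange)

lemma rassoc_isos [simp]:
  "\<lbrakk>S \<in> Obj V; X \<in> Obj M; Y \<in> Obj M\<rbrakk> \<Longrightarrow> rassoc A S X Y \<in> isos V"
  "\<lbrakk>S \<in> Obj V; X \<in> Obj M; Y \<in> Obj M\<rbrakk> \<Longrightarrow> rassoc A S X Y \<in> Arr V"
  "\<lbrakk>S \<in> Obj V; X \<in> Obj M; Y \<in> Obj M\<rbrakk> \<Longrightarrow> Dom V (rassoc A S X Y) = (S \<triangleleft> X) \<triangleleft> Y"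
  "\<lbrakk>S \<in> Obj V; X \<in> Obj M; Y \<in> Obj M\<rbrakk> \<Longrightarrow> Cod V (rassoc A S X Y) = S \<triangleleft> (X \<otimes>\<^bsub>M\<^esub> Y)"
  using rassoc_iso[of S X Y] by (auto simp: isos_arr)

lemma rassoc_unit_simps [simp]:
  "\<lbrakk>S \<in> Obj V; X \<in> Obj M\<rbrakk> \<Longrightarrow> rassoc A S (tunit M) X = ident V (S \<triangleleft> X)"
  "\<lbrakk>S \<in> Obj V; X \<in> Obj M\<rbrakk> \<Longrightarrow> rassoc A S X (tunit M) = ident V (S \<triangleleft> X)"
  using rassoc_unit by auto

end

context bimodule_category
begin

lemma mid_isos [simp]:
  "\<lbrakk>X \<in> Obj M; S \<in> Obj V; Y \<in> Obj M\<rbrakk> \<Longrightarrow> mid V X S Y \<in> isos V"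
  "\<lbrakk>X \<in> Obj M; S \<in> Obj V; Y \<in> Obj M\<rbrakk> \<Longrightarrow> mid V X S Y \<in> Arr V"
  "\<lbrakk>X \<in> Obj M; S \<in> Obj V; Y \<in> Obj M\<rbrakk> \<Longrightarrow>
    Dom V (mid V X S Y) = (X \<triangleright>\<^bsub>left V\<^esub> S) \<triangleleft>\<^bsub>right V\<^esub> Y"
  "\<lbrakk>X \<in> Obj M; S \<in> Obj V; Y \<in> Obj M\<rbrakk> \<Longrightarrow>
    Cod V (mid V X S Y) = X \<triangleright>\<^bsub>left V\<^esub> (S \<triangleleft>\<^bsub>right V\<^esub> Y)"
  using mid_iso[of X S Y] by (auto simp: isos_arr)

lemma mid_unit_simps [simp]:
  "\<lbrakk>X \<in> Obj M; S \<in> Obj V\<rbrakk> \<Longrightarrow> mid V (tunit M) S X = ident V (S \<triangleleft>\<^bsub>right V\<^esub> X)"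
  "\<lbrakk>X \<in> Obj M; S \<in> Obj V\<rbrakk> \<Longrightarrow> mid V X S (tunit M) = ident V (X \<triangleright>\<^bsub>left V\<^esub> S)"
  using mid_unit by auto

end

context bimodule_functor
begin

lemma lam_isos [simp]:
  "\<lbrakk>X \<in> Obj M; S \<in> Obj V\<rbrakk> \<Longrightarrow> lam H (X, S) \<in> isos W"
  "\<lbrakk>X \<in> Obj M; S \<in> Obj V\<rbrakk> \<Longrightarrow> lam H (X, S) \<in> Arr W"
  "\<lbrakk>X \<in> Obj M; S \<in> Obj V\<rbrakk> \<Longrightarrow> Dom W (lam H (X, S)) = fobj H (X \<triangleright>\<^bsub>left V\<^esub> S)"
  "\<lbrakk>X \<in> Obj M; S \<in> Obj V\<rbrakk> \<Longrightarrow> Cod W (lam H (X, S)) = X \<triangleright>\<^bsub>left W\<^esub> fobj H S"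
  using L.lam_iso[of X S] by (auto simp: isos_arr)

lemma rho_isos [simp]:
  "\<lbrakk>X \<in> Obj M; S \<in> Obj V\<rbrakk> \<Longrightarrow> rho H (S, X) \<in> isos W"
  "\<lbrakk>X \<in> Obj M; S \<in> Obj V\<rbrakk> \<Longrightarrow> rho H (S, X) \<in> Arr W"
  "\<lbrakk>X \<in> Obj M; S \<in> Obj V\<rbrakk> \<Longrightarrow> Dom W (rho H (S, X)) = fobj H (S \<triangleleft>\<^bsub>right V\<^esub> X)"
  "\<lbrakk>X \<in> Obj M; S \<in> Obj V\<rbrakk> \<Longrightarrow> Cod W (rho H (S, X)) = fobj H S \<triangleleft>\<^bsub>right W\<^esub> X"
  using R.rho_iso[of S X] by (auto simp: isos_arr)

lemmas [simp] = L.lam_unit R.rho_unit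

end

section \<open>Coherence in the regular bimodule and in general bimodules\<close>

lemma regular_simps [simp]:
  "Obj (regular M) = Obj M" "Arr (regular M) = Arr M" "Dom (regular M) = Dom M"
  "Cod (regular M) = Cod M" "ident (regular M) = ident M" "Comp (regular M) = Comp M"
  "lobj (left (regular M)) = tobj M" "larr (left (regular M)) = tarr M"
  "lassoc (left (regular M)) X Y Z = inv_arr M (assoc M X Y Z)"
  "robj (right (regular M)) = tobj M" "rarr (right (regular M)) = tarr M"
  "rassoc (right (regular M)) = assoc M" "mid (regular M) = assoc M"
  by (simp_all add: regular_def)

lemma isos_cong:
  assumes "Obj C = Obj D" "Arr C = Arr D" "Dom C = Dom D" "Cod C = Cod D" "ident C = ident D"
    "Comp C = Comp D"
  shows "isos C = isos D" "inv_arr C = inv_arr D"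
  using assms by (auto simp: isos_def inv_arr_def inverse_arrows_def fun_eq_iff)

lemma category_cong:
  assumes "category C" "Obj C = Obj D" "Arr C = Arr D" "Dom C = Dom D" "Cod C = Cod D"
    "ident C = ident D" "Comp C = Comp D"
  shows "category D"
  using assms by (simp add: category_def)

lemma regular_isos [simp]: "isos (regular M) = isos M" "inv_arr (regular M) = inv_arr M"
  by (rule isos_cong; simp)+

context monoidal_category
begin

lemma pentagon_inv:
  assumes [simp]: "W \<in> Obj C" "X \<in> Obj C" "Y \<in> Obj C" "Z \<in> Obj C"
  shows "(inv_arr C (assoc C W X Y) \<boxtimes> ident C Z) \<cdot> inv_arr C (assoc C W (X \<otimes> Y) Z) \<cdot>
      (ident C W \<boxtimes> inv_arr C (assoc C X Y Z)) =
    inv_arr C (assoc C (W \<otimes> X) Y Z) \<cdot> inv_arr C (assoc C W X (Y \<otimes> Z))"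
  using arg_cong[OF pentagon[OF assms], of "inv_arr C"] by (simp add: inv_Comp inv_tarr)

text \<open>
  Half of the pentagon turned around. It underlies the compatibility of \<open>\<zeta>\<close> with the left
  action, both in the regular and in the twisted bimodules.
\<close>

lemma pentagon_mid:
  assumes [simp]: "X \<in> Obj C" "Y \<in> Obj C" "S \<in> Obj C" "Z \<in> Obj C"
  shows "inv_arr C (assoc C X Y (S \<otimes> Z)) \<cdot> (ident C X \<boxtimes> assoc C Y S Z) \<cdot> assoc C X (Y \<otimes> S) Z =
      assoc C (X \<otimes> Y) S Z \<cdot> (inv_arr C (assoc C X Y S) \<boxtimes> ident C Z)"
  using inv_square[of "assoc C X Y (S \<otimes> Z)" "assoc C (X \<otimes> Y) S Z"
      "(ident C X \<boxtimes> assoc C Y S Z) \<cdot> assoc C X (Y \<otimes> S) Z" "assoc C X Y S \<boxtimes> ident C Z"]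
  by (simp add: pentagon inv_tarr)

lemma regular_bimodule: "bimodule_category C (regular C)"
proof -
  have cat: "category (regular C)" by (rule category_cong[OF category_axioms]) simp_all
  have left: "left_module_category C (regular C) (left (regular C))"
  proof (intro left_module_category.intro left_module_category_axioms.intro cat monoidal_category_axioms)
    fix f X X' g Y Y' h S S'
    assume "f \<in> hom C X X'" "g \<in> hom C Y Y'" "h \<in> hom (regular C) S S'"
    then show "lassoc (left (regular C)) X' Y' S' \<cdot>\<^bsub>regular C\<^esub>
        (f \<unrhd>\<^bsub>left (regular C)\<^esub> (g \<unrhd>\<^bsub>left (regular C)\<^esub> h)) =
      ((f \<boxtimes> g) \<unrhd>\<^bsub>left (regular C)\<^esub> h) \<cdot>\<^bsub>regular C\<^esub> lassoc (left (regular C)) X Y S"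
      using inv_square[OF assoc_square[of f g h]] by auto
  next
    fix X Y Z S
    assume o: "X \<in> Obj C" "Y \<in> Obj C" "Z \<in> Obj C" "S \<in> Obj (regular C)"
    have "(assoc C X Y Z \<boxtimes> ident C S) \<cdot> ((inv_arr C (assoc C X Y Z) \<boxtimes> ident C S) \<cdot>
        inv_arr C (assoc C X (Y \<otimes> Z) S) \<cdot> (ident C X \<boxtimes> inv_arr C (assoc C Y Z S))) =
      inv_arr C (assoc C X (Y \<otimes> Z) S) \<cdot> (ident C X \<boxtimes> inv_arr C (assoc C Y Z S))"
      using o by (simp add: interchange_pre)
    then show "lassoc (left (regular C)) X (Y \<otimes> Z) S \<cdot>\<^bsub>regular C\<^esub>
        (ident C X \<unrhd>\<^bsub>left (regular C)\<^esub> lassoc (left (regular C)) Y Z S) =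
      (assoc C X Y Z \<unrhd>\<^bsub>left (regular C)\<^esub> ident (regular C) S) \<cdot>\<^bsub>regular C\<^esub>
        lassoc (left (regular C)) (X \<otimes> Y) Z S \<cdot>\<^bsub>regular C\<^esub>
        lassoc (left (regular C)) X Y (Z \<triangleright>\<^bsub>left (regular C)\<^esub> S)"
      using o by (simp add: pentagon_inv)
  qed (auto simp: interchange)
  have right: "right_module_category C (regular C) (right (regular C))"
    by (intro right_module_category.intro right_module_category_axioms.intro cat
        monoidal_category_axioms)
      (auto simp: interchange pentagon assoc_square)
  show ?thesis
    by (intro bimodule_category.intro bimodule_category_axioms.intro left right)
      (auto simp: assoc_square pentagon pentagon_mid)
qed

end

context bimodule_category
begin

abbreviation comp (infixr "\<bullet>" 55) where "g \<bullet> f \<equiv> g \<cdot>\<^bsub>V\<^esub> f"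
abbreviation lact (infixr "\<rhd>" 70) where "X \<rhd> S \<equiv> X \<triangleright>\<^bsub>left V\<^esub> S"
abbreviation lacta (infixr "\<succ>" 70) where "f \<succ> h \<equiv> f \<unrhd>\<^bsub>left V\<^esub> h"
abbreviation ract (infixl "\<lhd>" 70) where "S \<lhd> X \<equiv> S \<triangleleft>\<^bsub>right V\<^esub> X"
abbreviation racta (infixl "\<prec>" 70) where "h \<prec> f \<equiv> h \<unlhd>\<^bsub>right V\<^esub> f"
abbreviation inverse ("_\<^sup>-" [1000] 999) where "f\<^sup>- \<equiv> inv_arr V f"
abbreviation las ("\<chi>") where "\<chi> \<equiv> lassoc (left V)"
abbreviation ras ("\<xi>") where "\<xi> \<equiv> rassoc (right V)"
abbreviation mi ("\<zeta>") where "\<zeta> \<equiv> mid V"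

text \<open>
  The structure isomorphism of the free functor below is \<open>\<chi>\<^sup>-\<close>, so the bimodule axioms
  are needed with \<open>\<chi>\<close> inverted. Each of the next three lemmas lets a chain of structure isomorphisms
  be rewritten in one direction.
\<close>

lemma lassoc_pentagon_inv:
  assumes [simp]: "X \<in> Obj M" "Y \<in> Obj M" "Z \<in> Obj M" "S \<in> Obj V"
  shows "(ident M X \<succ> (\<chi> Y Z S)\<^sup>-) \<bullet> (\<chi> X (Y \<otimes>\<^bsub>M\<^esub> Z) S)\<^sup>- \<bullet> (assoc M X Y Z \<succ> ident V S) =
    (\<chi> X Y (Z \<rhd> S))\<^sup>- \<bullet> (\<chi> (X \<otimes>\<^bsub>M\<^esub> Y) Z S)\<^sup>-"
proof -
  have "(ident M X \<succ> (\<chi> Y Z S)\<^sup>-) \<bullet> (\<chi> X (Y \<otimes>\<^bsub>M\<^esub> Z) S)\<^sup>- =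
      (\<chi> X (Y \<otimes>\<^bsub>M\<^esub> Z) S \<bullet> (ident M X \<succ> \<chi> Y Z S))\<^sup>-"
    by (simp add: L.V.inv_Comp L.inv_larr)
  also have "\<dots> = (\<chi> X Y (Z \<rhd> S))\<^sup>- \<bullet> (\<chi> (X \<otimes>\<^bsub>M\<^esub> Y) Z S)\<^sup>- \<bullet> (inv_arr M (assoc M X Y Z) \<succ> ident V S)"
    by (simp only: L.lassoc_pentagon assms) (simp add: L.V.inv_Comp L.inv_larr)
  finally have e: "(ident M X \<succ> (\<chi> Y Z S)\<^sup>-) \<bullet> (\<chi> X (Y \<otimes>\<^bsub>M\<^esub> Z) S)\<^sup>- =
    (\<chi> X Y (Z \<rhd> S))\<^sup>- \<bullet> (\<chi> (X \<otimes>\<^bsub>M\<^esub> Y) Z S)\<^sup>- \<bullet> (inv_arr M (assoc M X Y Z) \<succ> ident V S)" .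
  show ?thesis using L.V.front2[OF e, of "assoc M X Y Z \<succ> ident V S"] by (simp add: L.linterchange)
qed

lemma mid_left_inv:
  assumes [simp]: "X \<in> Obj M" "Y \<in> Obj M" "S \<in> Obj V" "Z \<in> Obj M"
  shows "(ident M X \<succ> (\<zeta> Y S Z)\<^sup>-) \<bullet> (\<chi> X Y (S \<lhd> Z))\<^sup>- =
    \<zeta> X (Y \<rhd> S) Z \<bullet> ((\<chi> X Y S)\<^sup>- \<prec> ident M Z) \<bullet> (\<zeta> (X \<otimes>\<^bsub>M\<^esub> Y) S Z)\<^sup>-"
proof -
  have "\<zeta> X (Y \<rhd> S) Z \<bullet> ((\<chi> X Y S)\<^sup>- \<prec> ident M Z) \<bullet> (\<zeta> (X \<otimes>\<^bsub>M\<^esub> Y) S Z)\<^sup>- =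
      \<zeta> X (Y \<rhd> S) Z \<bullet> (\<zeta> (X \<otimes>\<^bsub>M\<^esub> Y) S Z \<bullet> (\<chi> X Y S \<prec> ident M Z))\<^sup>-"
    by (simp add: L.V.inv_Comp R.inv_rarr)
  also have "\<dots> = \<zeta> X (Y \<rhd> S) Z \<bullet> (\<chi> X Y (S \<lhd> Z) \<bullet> (ident M X \<succ> \<zeta> Y S Z) \<bullet> \<zeta> X (Y \<rhd> S) Z)\<^sup>-"
    by (simp only: mid_left assms)
  also have "\<dots> = (ident M X \<succ> (\<zeta> Y S Z)\<^sup>-) \<bullet> (\<chi> X Y (S \<lhd> Z))\<^sup>-"
    by (simp add: L.V.inv_Comp L.inv_larr)
  finally show ?thesis ..
qed

lemma mid_right_inv:
  assumes [simp]: "X \<in> Obj M" "S \<in> Obj V" "Y \<in> Obj M" "Z \<in> Obj M"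
  shows "(\<zeta> X S (Y \<otimes>\<^bsub>M\<^esub> Z))\<^sup>- \<bullet> (ident M X \<succ> \<xi> S Y Z) \<bullet> \<zeta> X (S \<lhd> Y) Z =
    \<xi> (X \<rhd> S) Y Z \<bullet> ((\<zeta> X S Y)\<^sup>- \<prec> ident M Z)"
  using L.V.inv_square[of "\<zeta> X S (Y \<otimes>\<^bsub>M\<^esub> Z)" "\<xi> (X \<rhd> S) Y Z"
      "(ident M X \<succ> \<xi> S Y Z) \<bullet> \<zeta> X (S \<lhd> Y) Z" "\<zeta> X S Y \<prec> ident M Z"]
  by (simp add: mid_right R.inv_rarr)

lemma lassoc_square_inv: "\<lbrakk>f \<in> Arr M; g \<in> Arr M; h \<in> Arr V\<rbrakk> \<Longrightarrow>
    (\<chi> (Cod M f) (Cod M g) (Cod V h))\<^sup>- \<bullet> ((f \<boxtimes>\<^bsub>M\<^esub> g) \<succ> h) =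
    (f \<succ> (g \<succ> h)) \<bullet> (\<chi> (Dom M f) (Dom M g) (Dom V h))\<^sup>-"
  by (rule L.V.inv_square[OF L.lassoc_square]) auto

lemma mid_square: "\<lbrakk>f \<in> Arr M; h \<in> Arr V; g \<in> Arr M\<rbrakk> \<Longrightarrow>
    \<zeta> (Cod M f) (Cod V h) (Cod M g) \<bullet> ((f \<succ> h) \<prec> g) =
    (f \<succ> (h \<prec> g)) \<bullet> \<zeta> (Dom M f) (Dom V h) (Dom M g)"
  by (rule mid_natural) auto

lemma mid_square_inv: "\<lbrakk>f \<in> Arr M; h \<in> Arr V; g \<in> Arr M\<rbrakk> \<Longrightarrow>
    (\<zeta> (Cod M f) (Cod V h) (Cod M g))\<^sup>- \<bullet> (f \<succ> (h \<prec> g)) =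
    ((f \<succ> h) \<prec> g) \<bullet> (\<zeta> (Dom M f) (Dom V h) (Dom M g))\<^sup>-"
  by (rule L.V.inv_square[OF mid_square]) auto

end

section \<open>Half-braided objects of a bimodule\<close>

text \<open>
  A half-braiding on an object \<open>V\<close> is exactly what makes the left module functor \<open>X \<mapsto> X \<triangleright> V\<close>
  a bimodule functor: to pull \<open>Y\<close> out of \<open>(X \<otimes> Y) \<triangleright> V\<close> to the right, it has to pass \<open>V\<close>. For the
  regular bimodule this is \<open>\<Phi>\<close>.
\<close>

definition free_functor ::
  "('o, 'a, 'm) monoidal_scheme \<Rightarrow> ('o, 'a, 'v, 'w) bimodule \<Rightarrow> ('o, 'v, 'w) cobj \<Rightarrow>
    ('o, 'o, 'a, 'v, 'w) bfunctor" where
  "free_functor M W = (\<lambda>(V, c).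
    \<lparr>fobj = (\<lambda>X\<in>Obj M. X \<triangleright>\<^bsub>left W\<^esub> V),
     farr = (\<lambda>f\<in>Arr M. f \<unrhd>\<^bsub>left W\<^esub> ident W V),
     lam = (\<lambda>(X, Y)\<in>Obj M \<times> Obj M. inv_arr W (lassoc (left W) X Y V)),
     rho = (\<lambda>(X, Y)\<in>Obj M \<times> Obj M. inv_arr W (mid W X V Y) \<cdot>\<^bsub>W\<^esub>
       (ident M X \<unrhd>\<^bsub>left W\<^esub> inv_arr W (c Y)) \<cdot>\<^bsub>W\<^esub> inv_arr W (lassoc (left W) X Y V))\<rparr>)"

lemma free_functor_simps [simp]:
  "X \<in> Obj M \<Longrightarrow> fobj (free_functor M W (V, c)) X = X \<triangleright>\<^bsub>left W\<^esub> V"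
  "f \<in> Arr M \<Longrightarrow> farr (free_functor M W (V, c)) f = f \<unrhd>\<^bsub>left W\<^esub> ident W V"
  "\<lbrakk>X \<in> Obj M; Y \<in> Obj M\<rbrakk> \<Longrightarrow>
    lam (free_functor M W (V, c)) (X, Y) = inv_arr W (lassoc (left W) X Y V)"
  "\<lbrakk>X \<in> Obj M; Y \<in> Obj M\<rbrakk> \<Longrightarrow>
    rho (free_functor M W (V, c)) (X, Y) = inv_arr W (mid W X V Y) \<cdot>\<^bsub>W\<^esub>
      (ident M X \<unrhd>\<^bsub>left W\<^esub> inv_arr W (c Y)) \<cdot>\<^bsub>W\<^esub> inv_arr W (lassoc (left W) X Y V)"
  by (simp_all add: free_functor_def)

lemma free_functor_extensional: "extensional_bfunctor M (regular M) (free_functor M W (V, c))"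
  by (simp add: extensional_bfunctor_def free_functor_def)

text \<open>
  The defining conditions of the center, read in an arbitrary bimodule. All formal properties of
  mixed centers hold at this level, and only admissibility refers to a particular target.
\<close>

locale half_braiding = bimodule_category M V
  for M :: "('o, 'a, 'm) monoidal_scheme"
    and V :: "('o, 'a, 'v, 'w) bimodule"
    and Z :: 'v
    and c :: "'o \<Rightarrow> 'w" +
  assumes Z_obj [simp]: "Z \<in> Obj V"
    and c_iso: "X \<in> Obj M \<Longrightarrow> c X \<in> iso V (Z \<lhd> X) (X \<rhd> Z)"
    and c_natural: "f \<in> hom M X Y \<Longrightarrow> c Y \<bullet> (ident V Z \<prec> f) = (f \<succ> ident V Z) \<bullet> c X"
    and c_tensor: "\<lbrakk>X \<in> Obj M; Y \<in> Obj M\<rbrakk> \<Longrightarrow>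
      c (X \<otimes>\<^bsub>M\<^esub> Y) = \<chi> X Y Z \<bullet> (ident M X \<succ> c Y) \<bullet> \<zeta> X Z Y \<bullet> (c X \<prec> ident M Y) \<bullet> (\<xi> Z X Y)\<^sup>-"
begin

lemma c_isos [simp]:
  "X \<in> Obj M \<Longrightarrow> c X \<in> isos V" "X \<in> Obj M \<Longrightarrow> c X \<in> Arr V"
  "X \<in> Obj M \<Longrightarrow> Dom V (c X) = Z \<lhd> X" "X \<in> Obj M \<Longrightarrow> Cod V (c X) = X \<rhd> Z"
  using c_iso[of X] by (auto simp: isos_arr)

text \<open>At the unit the tensor condition says that \<open>c I\<close> is an idempotent isomorphism.\<close>

lemma c_unit [simp]: "c (tunit M) = ident V Z"
proof -
  have "c (tunit M) \<bullet> c (tunit M) = c (tunit M) \<bullet> ident V Z"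
    using c_tensor[of "tunit M" "tunit M"] by simp
  then show ?thesis by (rule L.V.iso_cancel_left) simp_all
qed

lemma c_square_inv:
  "f \<in> Arr M \<Longrightarrow> (c (Cod M f))\<^sup>- \<bullet> (f \<succ> ident V Z) = (ident V Z \<prec> f) \<bullet> (c (Dom M f))\<^sup>-"
  by (rule L.V.inv_square[OF c_natural]) auto

lemma c_tensor_inv:
  assumes [simp]: "X \<in> Obj M" "Y \<in> Obj M"
  shows "(c (X \<otimes>\<^bsub>M\<^esub> Y))\<^sup>- = \<xi> Z X Y \<bullet> ((c X)\<^sup>- \<prec> ident M Y) \<bullet> (\<zeta> X Z Y)\<^sup>- \<bullet>
    (ident M X \<succ> (c Y)\<^sup>-) \<bullet> (\<chi> X Y Z)\<^sup>-"
  by (simp add: c_tensor L.V.inv_Comp L.inv_larr R.inv_rarr)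

text \<open>
  Since \<open>\<chi>\<^sup>-\<close> satisfies a pentagon, the left structure is coherent. In the two remaining axioms
  \<open>c\<^sup>-\<close> slides past \<open>\<chi>\<^sup>-\<close> by naturality, and \<open>mid_left_inv\<close> trades \<open>\<zeta>\<^sup>-\<close> under \<open>X \<triangleright> _\<close> for
  \<open>\<zeta>\<^sup>-\<close> at a tensor product. For the right associativity the tensor condition splits \<open>c\<^sup>-\<close> at
  \<open>X \<otimes> Y\<close> into two factors, and \<open>mid_right_inv\<close> recombines the outer ones.
\<close>

lemma free_functor_bimodule_functor: "bimodule_functor M (regular M) V (free_functor M V (Z, c))"
proof -
  note reg = L.M.regular_bimodule
  note reg_left = bimodule_category.axioms(1)[OF reg]
  note reg_right = bimodule_category.axioms(2)[OF reg]
  note reg_cat = left_module_category.axioms(2)[OF reg_left]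
  let ?K = "free_functor M V (Z, c)"
  have slide: "(ident M X \<succ> (ident M Y \<succ> f)) \<bullet> (\<chi> X Y (Dom V f))\<^sup>- =
      (\<chi> X Y (Cod V f))\<^sup>- \<bullet> (ident M (X \<otimes>\<^bsub>M\<^esub> Y) \<succ> f)"
    if "X \<in> Obj M" "Y \<in> Obj M" "f \<in> Arr V" for X Y f
    using that lassoc_square_inv[of "ident M X" "ident M Y" f] by simp
  have dist: "ident M X \<succ> (f \<bullet> g) = (ident M X \<succ> f) \<bullet> (ident M X \<succ> g)"
    "(f \<bullet> g) \<prec> ident M X = (f \<prec> ident M X) \<bullet> (g \<prec> ident M X)"
    if "X \<in> Obj M" "f \<in> Arr V" "g \<in> Arr V" "Dom V f = Cod V g" for X f g
    using that by (simp_all add: L.linterchange R.rinterchange)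
  have fun_K: "cfunctor (regular M) V ?K"
    by (intro cfunctor.intro cfunctor_axioms.intro reg_cat L.V.category_axioms)
      (auto simp: L.linterchange)
  have left: "left_module_functor M (regular M) (left (regular M)) V (left V) ?K (lam ?K)"
  proof (intro left_module_functor.intro left_module_functor_axioms.intro fun_K
      reg_left L.left_module_category_axioms)
    fix f X X' g S S'
    assume "f \<in> hom M X X'" "g \<in> hom (regular M) S S'"
    then show "lam ?K (X', S') \<bullet> farr ?K (f \<unrhd>\<^bsub>left (regular M)\<^esub> g) =
        (f \<succ> farr ?K g) \<bullet> lam ?K (X, S)"
      using lassoc_square_inv[of f g "ident V Z"] by auto
  next
    fix X Y S assume [simp]: "X \<in> Obj M" "Y \<in> Obj M" and "S \<in> Obj (regular M)"
    then have [simp]: "S \<in> Obj M" by simp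
    have "\<chi> X Y (S \<rhd> Z) \<bullet> ((ident M X \<succ> (\<chi> Y S Z)\<^sup>-) \<bullet> (\<chi> X (Y \<otimes>\<^bsub>M\<^esub> S) Z)\<^sup>- \<bullet>
        (assoc M X Y S \<succ> ident V Z)) \<bullet> (inv_arr M (assoc M X Y S) \<succ> ident V Z) =
      (\<chi> (X \<otimes>\<^bsub>M\<^esub> Y) S Z)\<^sup>- \<bullet> (inv_arr M (assoc M X Y S) \<succ> ident V Z)"
      by (simp add: lassoc_pentagon_inv)
    then show "lam ?K (X \<otimes>\<^bsub>M\<^esub> Y, S) \<bullet> farr ?K (lassoc (left (regular M)) X Y S) =
        \<chi> X Y (fobj ?K S) \<bullet> (ident M X \<succ> lam ?K (Y, S)) \<bullet> lam ?K (X, Y \<triangleright>\<^bsub>left (regular M)\<^esub> S)"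
      by (simp add: L.linterchange)
  qed auto
  have right: "right_module_functor M (regular M) (right (regular M)) V (right V) ?K (rho ?K)"
  proof (intro right_module_functor.intro right_module_functor_axioms.intro fun_K
      reg_right R.right_module_category_axioms)
    fix f X X' g S S'
    assume "g \<in> hom (regular M) S S'" "f \<in> hom M X X'"
    then have [simp]: "f \<in> Arr M" "g \<in> Arr M" and
      d: "X = Dom M f" "X' = Cod M f" "S = Dom M g" "S' = Cod M g" by auto
    have "(ident M (Cod M g) \<succ> (c (Cod M f))\<^sup>-) \<bullet> (g \<succ> (f \<succ> ident V Z)) =
        (g \<succ> (ident V Z \<prec> f)) \<bullet> (ident M (Dom M g) \<succ> (c (Dom M f))\<^sup>-)"
      by (simp add: L.linterchange c_square_inv)
    note e = L.V.front2[OF this]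
    note m = L.V.front2[OF mid_square_inv[of g "ident V Z" f]]
    show "rho ?K (S', X') \<bullet> farr ?K (g \<unlhd>\<^bsub>right (regular M)\<^esub> f) =
        (farr ?K g \<prec> f) \<bullet> rho ?K (S, X)"
      using lassoc_square_inv[of g f "ident V Z"] m e by (simp add: d)
  next
    fix S X Y assume "S \<in> Obj (regular M)" and [simp]: "X \<in> Obj M" "Y \<in> Obj M"
    then have [simp]: "S \<in> Obj M" by simp
    have slide_c: "(ident M S \<succ> ((c X)\<^sup>- \<prec> ident M Y)) \<bullet> \<zeta> S (X \<rhd> Z) Y =
        \<zeta> S (Z \<lhd> X) Y \<bullet> ((ident M S \<succ> (c X)\<^sup>-) \<prec> ident M Y)"
      using mid_square[of "ident M S" "(c X)\<^sup>-" "ident M Y"] by simp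
    note slides = L.V.front2[OF slide[of S X "(c Y)\<^sup>-"]] L.V.front2[OF mid_left_inv[of S X Z Y]]
      L.V.front2[OF slide_c] L.V.front3[OF mid_right_inv[of S Z X Y]]
    show "rho ?K (S, X \<otimes>\<^bsub>M\<^esub> Y) \<bullet> farr ?K (rassoc (right (regular M)) S X Y) =
        \<xi> (fobj ?K S) X Y \<bullet> (rho ?K (S, X) \<prec> ident M Y) \<bullet> rho ?K (S \<triangleleft>\<^bsub>right (regular M)\<^esub> X, Y)"
      using slides by (simp add: c_tensor_inv dist lassoc_pentagon_inv)
  qed auto
  show ?thesis
  proof (intro bimodule_functor.intro bimodule_functor_axioms.intro left right
      reg bimodule_category_axioms)
    fix X S Y assume [simp]: "X \<in> Obj M" "Y \<in> Obj M" and "S \<in> Obj (regular M)"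
    then have [simp]: "S \<in> Obj M" by simp
    show "(ident M X \<succ> rho ?K (S, Y)) \<bullet> lam ?K (X, S \<triangleleft>\<^bsub>right (regular M)\<^esub> Y) \<bullet>
        farr ?K (mid (regular M) X S Y) =
      \<zeta> X (fobj ?K S) Y \<bullet> (lam ?K (X, S) \<prec> ident M Y) \<bullet> rho ?K (X \<triangleright>\<^bsub>left (regular M)\<^esub> S, Y)"
      using L.V.front2[OF slide[of X S "(c Y)\<^sup>-"]] L.V.front2[OF mid_left_inv[of X S Z Y]]
      by (simp add: dist lassoc_pentagon_inv)
  qed
qed

end

section \<open>Composites of bimodule functors and of their transformations\<close>

text \<open>
  A bimodule transformation together with the fact that its source and target are bimodule
  functors.
\<close>

locale btransformation =
  H: bimodule_functor M V W H + K: bimodule_functor M V W K + nat_transformation V W H K \<theta>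
  for M :: "('o, 'a, 'm) monoidal_scheme"
    and V :: "('o, 'a, 'v, 'w) bimodule"
    and W :: "('o, 'a, 'x, 'y) bimodule"
    and H K :: "('o, 'v, 'w, 'x, 'y) bfunctor"
    and \<theta> :: "'v \<Rightarrow> 'y" +
  assumes lam_compat: "\<lbrakk>X \<in> Obj M; S \<in> Obj V\<rbrakk> \<Longrightarrow>
      (ident M X \<unrhd>\<^bsub>left W\<^esub> \<theta> S) \<cdot>\<^bsub>W\<^esub> lam H (X, S) = lam K (X, S) \<cdot>\<^bsub>W\<^esub> \<theta> (X \<triangleright>\<^bsub>left V\<^esub> S)"
    and rho_compat: "\<lbrakk>X \<in> Obj M; S \<in> Obj V\<rbrakk> \<Longrightarrow>
      (\<theta> S \<unlhd>\<^bsub>right W\<^esub> ident M X) \<cdot>\<^bsub>W\<^esub> rho H (S, X) = rho K (S, X) \<cdot>\<^bsub>W\<^esub> \<theta> (S \<triangleleft>\<^bsub>right V\<^esub> X)"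

lemma btransformation_iff: "btransformation M V W H K \<theta> \<longleftrightarrow>
    bimodule_functor M V W H \<and> bimodule_functor M V W K \<and> bimodule_transformation M V W H K \<theta>"
  unfolding btransformation_def btransformation_axioms_def bimodule_transformation_def by blast

lemma nat_transformationI:
  assumes "cfunctor C D F" "cfunctor C D G"
    and "\<And>X. X \<in> Obj C \<Longrightarrow> \<theta> X \<in> Arr D \<and> Dom D (\<theta> X) = fobj F X \<and> Cod D (\<theta> X) = fobj G X"
    and "\<And>f. f \<in> Arr C \<Longrightarrow> \<theta> (Cod C f) \<cdot>\<^bsub>D\<^esub> farr F f = farr G f \<cdot>\<^bsub>D\<^esub> \<theta> (Dom C f)"
  shows "nat_transformation C D F G \<theta>"
  using assms by (auto simp: nat_transformation_def nat_transformation_axioms_def)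

lemma bfunctor_comp_simps [simp]:
  "S \<in> Obj U \<Longrightarrow> fobj (bfunctor_comp M U W H K) S = fobj H (fobj K S)"
  "f \<in> Arr U \<Longrightarrow> farr (bfunctor_comp M U W H K) f = farr H (farr K f)"
  "\<lbrakk>X \<in> Obj M; S \<in> Obj U\<rbrakk> \<Longrightarrow> lam (bfunctor_comp M U W H K) (X, S) =
    lam H (X, fobj K S) \<cdot>\<^bsub>W\<^esub> farr H (lam K (X, S))"
  "\<lbrakk>X \<in> Obj M; S \<in> Obj U\<rbrakk> \<Longrightarrow> rho (bfunctor_comp M U W H K) (S, X) =
    rho H (fobj K S, X) \<cdot>\<^bsub>W\<^esub> farr H (rho K (S, X))"
  by (simp_all add: bfunctor_comp_def)

lemma bfunctor_comp_extensional: "extensional_bfunctor M U (bfunctor_comp M U W H K)"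
  by (simp add: extensional_bfunctor_def bfunctor_comp_def)

context bimodule_functor
begin

lemma lam_square: "\<lbrakk>f \<in> Arr M; g \<in> Arr V\<rbrakk> \<Longrightarrow>
    lam H (Cod M f, Cod V g) \<cdot>\<^bsub>W\<^esub> farr H (f \<unrhd>\<^bsub>left V\<^esub> g) =
    (f \<unrhd>\<^bsub>left W\<^esub> farr H g) \<cdot>\<^bsub>W\<^esub> lam H (Dom M f, Dom V g)"
  by (rule L.lam_natural) auto

lemma rho_square: "\<lbrakk>g \<in> Arr V; f \<in> Arr M\<rbrakk> \<Longrightarrow>
    rho H (Cod V g, Cod M f) \<cdot>\<^bsub>W\<^esub> farr H (g \<unlhd>\<^bsub>right V\<^esub> f) =
    (farr H g \<unlhd>\<^bsub>right W\<^esub> f) \<cdot>\<^bsub>W\<^esub> rho H (Dom V g, Dom M f)"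
  by (rule R.rho_natural) auto

lemma lam_slide: "\<lbrakk>X \<in> Obj M; g \<in> Arr V; S = Cod V g\<rbrakk> \<Longrightarrow>
    lam H (X, S) \<cdot>\<^bsub>W\<^esub> farr H (ident M X \<unrhd>\<^bsub>left V\<^esub> g) =
    (ident M X \<unrhd>\<^bsub>left W\<^esub> farr H g) \<cdot>\<^bsub>W\<^esub> lam H (X, Dom V g)"
  using lam_square[of "ident M X" g] by simp

lemma rho_slide: "\<lbrakk>X \<in> Obj M; g \<in> Arr V; S = Cod V g\<rbrakk> \<Longrightarrow>
    rho H (S, X) \<cdot>\<^bsub>W\<^esub> farr H (g \<unlhd>\<^bsub>right V\<^esub> ident M X) =
    (farr H g \<unlhd>\<^bsub>right W\<^esub> ident M X) \<cdot>\<^bsub>W\<^esub> rho H (Dom V g, X)"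
  using rho_square[of g "ident M X"] by simp

end

context bimodule_category
begin

lemma left_dist: "\<lbrakk>X \<in> Obj M; f \<in> Arr V; g \<in> Arr V; Dom V f = Cod V g\<rbrakk> \<Longrightarrow>
    ident M X \<succ> (f \<bullet> g) = (ident M X \<succ> f) \<bullet> (ident M X \<succ> g)"
  and right_dist: "\<lbrakk>X \<in> Obj M; f \<in> Arr V; g \<in> Arr V; Dom V f = Cod V g\<rbrakk> \<Longrightarrow>
    (f \<bullet> g) \<prec> ident M X = (f \<prec> ident M X) \<bullet> (g \<prec> ident M X)"
  by (simp_all add: L.linterchange R.rinterchange)

end

locale bfunctor_pair = K: bimodule_functor M U V K + H: bimodule_functor M V W H
  for M :: "('o, 'a, 'm) monoidal_scheme"
    and U :: "('o, 'a, 'u, 't) bimodule"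
    and V :: "('o, 'a, 'v, 'w) bimodule"
    and W :: "('o, 'a, 'x, 'y) bimodule"
    and K :: "('o, 'u, 't, 'v, 'w) bfunctor"
    and H :: "('o, 'v, 'w, 'x, 'y) bfunctor"
begin

abbreviation HK where "HK \<equiv> bfunctor_comp M U W H K"

lemma cfunctor_comp: "cfunctor U W HK"
  by (intro cfunctor.intro cfunctor_axioms.intro K.V.L.V.category_axioms H.W.L.V.category_axioms)
    auto

lemma left_comp: "left_module_functor M U (left U) W (left W) HK (lam HK)"
proof (intro left_module_functor.intro left_module_functor_axioms.intro cfunctor_comp
    K.V.L.left_module_category_axioms H.W.L.left_module_category_axioms)
  fix f X X' g S S'
  assume "f \<in> hom M X X'" "g \<in> hom U S S'"
  then have [simp]: "f \<in> Arr M" "g \<in> Arr U" and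
    d: "X = Dom M f" "X' = Cod M f" "S = Dom U g" "S' = Cod U g" by auto
  have "farr H (lam K (X', S')) \<cdot>\<^bsub>W\<^esub> farr H (farr K (f \<unrhd>\<^bsub>left U\<^esub> g)) =
      farr H (f \<unrhd>\<^bsub>left V\<^esub> farr K g) \<cdot>\<^bsub>W\<^esub> farr H (lam K (X, S))"
    using arg_cong[OF K.lam_square[of f g], of "farr H"] by (simp add: d)
  then show "lam HK (X', S') \<cdot>\<^bsub>W\<^esub> farr HK (f \<unrhd>\<^bsub>left U\<^esub> g) =
      (f \<unrhd>\<^bsub>left W\<^esub> farr HK g) \<cdot>\<^bsub>W\<^esub> lam HK (X, S)"
    using H.W.L.V.front2[OF H.lam_square[of f "farr K g"]] by (simp add: d)
next
  fix X Y S assume [simp]: "X \<in> Obj M" "Y \<in> Obj M" "S \<in> Obj U"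
  have e: "farr H (lam K (X \<otimes>\<^bsub>M\<^esub> Y, S)) \<cdot>\<^bsub>W\<^esub> farr H (farr K (lassoc (left U) X Y S)) =
      farr H (lassoc (left V) X Y (fobj K S)) \<cdot>\<^bsub>W\<^esub> farr H (ident M X \<unrhd>\<^bsub>left V\<^esub> lam K (Y, S)) \<cdot>\<^bsub>W\<^esub>
        farr H (lam K (X, Y \<triangleright>\<^bsub>left U\<^esub> S))"
    using arg_cong[OF K.L.lam_assoc[of X Y S], of "farr H"] by simp
  show "lam HK (X \<otimes>\<^bsub>M\<^esub> Y, S) \<cdot>\<^bsub>W\<^esub> farr HK (lassoc (left U) X Y S) =
      lassoc (left W) X Y (fobj HK S) \<cdot>\<^bsub>W\<^esub> (ident M X \<unrhd>\<^bsub>left W\<^esub> lam HK (Y, S)) \<cdot>\<^bsub>W\<^esub>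
        lam HK (X, Y \<triangleright>\<^bsub>left U\<^esub> S)"
    using H.W.L.V.front2[OF H.L.lam_assoc[of X Y "fobj K S"]]
      H.W.L.V.front2[OF H.lam_slide[of X "lam K (Y, S)"]]
    by (simp add: e H.W.left_dist)
qed auto

lemma right_comp: "right_module_functor M U (right U) W (right W) HK (rho HK)"
proof (intro right_module_functor.intro right_module_functor_axioms.intro cfunctor_comp
    K.V.R.right_module_category_axioms H.W.R.right_module_category_axioms)
  fix f X X' g S S'
  assume "g \<in> hom U S S'" "f \<in> hom M X X'"
  then have [simp]: "f \<in> Arr M" "g \<in> Arr U" and
    d: "X = Dom M f" "X' = Cod M f" "S = Dom U g" "S' = Cod U g" by auto
  have "farr H (rho K (S', X')) \<cdot>\<^bsub>W\<^esub> farr H (farr K (g \<unlhd>\<^bsub>right U\<^esub> f)) =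
      farr H (farr K g \<unlhd>\<^bsub>right V\<^esub> f) \<cdot>\<^bsub>W\<^esub> farr H (rho K (S, X))"
    using arg_cong[OF K.rho_square[of g f], of "farr H"] by (simp add: d)
  then show "rho HK (S', X') \<cdot>\<^bsub>W\<^esub> farr HK (g \<unlhd>\<^bsub>right U\<^esub> f) =
      (farr HK g \<unlhd>\<^bsub>right W\<^esub> f) \<cdot>\<^bsub>W\<^esub> rho HK (S, X)"
    using H.W.L.V.front2[OF H.rho_square[of "farr K g" f]] by (simp add: d)
next
  fix S X Y assume [simp]: "X \<in> Obj M" "Y \<in> Obj M" "S \<in> Obj U"
  have e: "farr H (rho K (S, X \<otimes>\<^bsub>M\<^esub> Y)) \<cdot>\<^bsub>W\<^esub> farr H (farr K (rassoc (right U) S X Y)) =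
      farr H (rassoc (right V) (fobj K S) X Y) \<cdot>\<^bsub>W\<^esub>
        farr H (rho K (S, X) \<unlhd>\<^bsub>right V\<^esub> ident M Y) \<cdot>\<^bsub>W\<^esub> farr H (rho K (S \<triangleleft>\<^bsub>right U\<^esub> X, Y))"
    using arg_cong[OF K.R.rho_assoc[of S X Y], of "farr H"] by simp
  show "rho HK (S, X \<otimes>\<^bsub>M\<^esub> Y) \<cdot>\<^bsub>W\<^esub> farr HK (rassoc (right U) S X Y) =
      rassoc (right W) (fobj HK S) X Y \<cdot>\<^bsub>W\<^esub> (rho HK (S, X) \<unlhd>\<^bsub>right W\<^esub> ident M Y) \<cdot>\<^bsub>W\<^esub>
        rho HK (S \<triangleleft>\<^bsub>right U\<^esub> X, Y)"
    using H.W.L.V.front2[OF H.R.rho_assoc[of "fobj K S" X Y]]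
      H.W.L.V.front2[OF H.rho_slide[of Y "rho K (S, X)"]]
    by (simp add: e H.W.right_dist)
qed auto

lemma bimodule_functor_comp: "bimodule_functor M U W HK"
proof (intro bimodule_functor.intro bimodule_functor_axioms.intro left_comp right_comp
    K.V.bimodule_category_axioms H.W.bimodule_category_axioms)
  fix X S Y assume [simp]: "X \<in> Obj M" "Y \<in> Obj M" "S \<in> Obj U"
  have e: "farr H (ident M X \<unrhd>\<^bsub>left V\<^esub> rho K (S, Y)) \<cdot>\<^bsub>W\<^esub> farr H (lam K (X, S \<triangleleft>\<^bsub>right U\<^esub> Y)) \<cdot>\<^bsub>W\<^esub>
        farr H (farr K (mid U X S Y)) =
      farr H (mid V X (fobj K S) Y) \<cdot>\<^bsub>W\<^esub> farr H (lam K (X, S) \<unlhd>\<^bsub>right V\<^esub> ident M Y) \<cdot>\<^bsub>W\<^esub>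
        farr H (rho K (X \<triangleright>\<^bsub>left U\<^esub> S, Y))"
    using arg_cong[OF K.lam_rho[of X S Y], of "farr H"] by simp
  note slide = H.lam_slide[of X "rho K (S, Y)", symmetric]
  show "(ident M X \<unrhd>\<^bsub>left W\<^esub> rho HK (S, Y)) \<cdot>\<^bsub>W\<^esub> lam HK (X, S \<triangleleft>\<^bsub>right U\<^esub> Y) \<cdot>\<^bsub>W\<^esub>
        farr HK (mid U X S Y) =
      mid W X (fobj HK S) Y \<cdot>\<^bsub>W\<^esub> (lam HK (X, S) \<unlhd>\<^bsub>right W\<^esub> ident M Y) \<cdot>\<^bsub>W\<^esub>
        rho HK (X \<triangleright>\<^bsub>left U\<^esub> S, Y)"
    using H.W.L.V.front2[OF slide] H.W.L.V.front3[OF H.lam_rho[of X "fobj K S" Y]]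
      H.W.L.V.front2[OF H.rho_slide[of Y "lam K (X, S)"]]
    by (simp add: e H.W.left_dist H.W.right_dist)
qed

end

locale btransformation_pair =
  \<phi>: btransformation M U V K K' \<phi> + \<theta>: btransformation M V W H H' \<theta>
  for M :: "('o, 'a, 'm) monoidal_scheme"
    and U :: "('o, 'a, 'u, 't) bimodule"
    and V :: "('o, 'a, 'v, 'w) bimodule"
    and W :: "('o, 'a, 'x, 'y) bimodule"
    and K K' :: "('o, 'u, 't, 'v, 'w) bfunctor"
    and \<phi> :: "'u \<Rightarrow> 'w"
    and H H' :: "('o, 'v, 'w, 'x, 'y) bfunctor"
    and \<theta> :: "'v \<Rightarrow> 'y"
begin

sublocale HK: bfunctor_pair M U V W K H ..
sublocale HK': bfunctor_pair M U V W K' H' ..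

text \<open>
  Naturality of \<open>\<theta>\<close> at the structure isomorphisms of \<open>K'\<close> lets \<open>\<theta>\<close> pass them, so that the
  two compatibilities of \<open>\<phi>\<close> and \<open>\<theta>\<close> can be used one after the other.
\<close>

lemma horizontal_composite:
  "btransformation M U W HK.HK HK'.HK (\<lambda>S\<in>Obj U. \<theta> (fobj K' S) \<cdot>\<^bsub>W\<^esub> farr H (\<phi> S))"
proof (intro btransformation.intro btransformation_axioms.intro HK.bimodule_functor_comp
    HK'.bimodule_functor_comp nat_transformationI HK.cfunctor_comp HK'.cfunctor_comp)
  fix f assume [simp]: "f \<in> Arr U"
  have e: "farr H (\<phi> (Cod U f)) \<cdot>\<^bsub>W\<^esub> farr H (farr K f) = farr H (farr K' f) \<cdot>\<^bsub>W\<^esub> farr H (\<phi> (Dom U f))"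
    using arg_cong[OF \<phi>.naturality[of f "Dom U f" "Cod U f"], of "farr H"] by simp
  have t: "\<theta> (fobj K' (Cod U f)) \<cdot>\<^bsub>W\<^esub> farr H (farr K' f) = farr H' (farr K' f) \<cdot>\<^bsub>W\<^esub> \<theta> (fobj K' (Dom U f))"
    by (rule \<theta>.naturality) simp
  show "(\<lambda>S\<in>Obj U. \<theta> (fobj K' S) \<cdot>\<^bsub>W\<^esub> farr H (\<phi> S)) (Cod U f) \<cdot>\<^bsub>W\<^esub> farr HK.HK f =
      farr HK'.HK f \<cdot>\<^bsub>W\<^esub> (\<lambda>S\<in>Obj U. \<theta> (fobj K' S) \<cdot>\<^bsub>W\<^esub> farr H (\<phi> S)) (Dom U f)"
    using \<theta>.H.W.L.V.front2[OF t] by (simp add: e)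
next
  fix X S assume [simp]: "X \<in> Obj M" "S \<in> Obj U"
  have e: "farr H (ident M X \<unrhd>\<^bsub>left V\<^esub> \<phi> S) \<cdot>\<^bsub>W\<^esub> farr H (lam K (X, S)) =
      farr H (lam K' (X, S)) \<cdot>\<^bsub>W\<^esub> farr H (\<phi> (X \<triangleright>\<^bsub>left U\<^esub> S))"
    using arg_cong[OF \<phi>.lam_compat[of X S], of "farr H"] by simp
  have t: "\<theta> (X \<triangleright>\<^bsub>left V\<^esub> fobj K' S) \<cdot>\<^bsub>W\<^esub> farr H (lam K' (X, S)) =
      farr H' (lam K' (X, S)) \<cdot>\<^bsub>W\<^esub> \<theta> (fobj K' (X \<triangleright>\<^bsub>left U\<^esub> S))"
    by (rule \<theta>.naturality) simp
  note slide = \<theta>.H.lam_slide[of X "\<phi> S", symmetric]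
  show "(ident M X \<unrhd>\<^bsub>left W\<^esub> (\<lambda>S\<in>Obj U. \<theta> (fobj K' S) \<cdot>\<^bsub>W\<^esub> farr H (\<phi> S)) S) \<cdot>\<^bsub>W\<^esub> lam HK.HK (X, S) =
      lam HK'.HK (X, S) \<cdot>\<^bsub>W\<^esub> (\<lambda>S\<in>Obj U. \<theta> (fobj K' S) \<cdot>\<^bsub>W\<^esub> farr H (\<phi> S)) (X \<triangleright>\<^bsub>left U\<^esub> S)"
    using \<theta>.H.W.L.V.front2[OF slide] \<theta>.H.W.L.V.front2[OF \<theta>.lam_compat[of X "fobj K' S"]]
      \<theta>.H.W.L.V.front2[OF t]
    by (simp add: e \<theta>.H.W.left_dist)
next
  fix X S assume [simp]: "X \<in> Obj M" "S \<in> Obj U"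
  have e: "farr H (\<phi> S \<unlhd>\<^bsub>right V\<^esub> ident M X) \<cdot>\<^bsub>W\<^esub> farr H (rho K (S, X)) =
      farr H (rho K' (S, X)) \<cdot>\<^bsub>W\<^esub> farr H (\<phi> (S \<triangleleft>\<^bsub>right U\<^esub> X))"
    using arg_cong[OF \<phi>.rho_compat[of X S], of "farr H"] by simp
  have t: "\<theta> (fobj K' S \<triangleleft>\<^bsub>right V\<^esub> X) \<cdot>\<^bsub>W\<^esub> farr H (rho K' (S, X)) =
      farr H' (rho K' (S, X)) \<cdot>\<^bsub>W\<^esub> \<theta> (fobj K' (S \<triangleleft>\<^bsub>right U\<^esub> X))"
    by (rule \<theta>.naturality) simp
  note slide = \<theta>.H.rho_slide[of X "\<phi> S", symmetric]
  show "((\<lambda>S\<in>Obj U. \<theta> (fobj K' S) \<cdot>\<^bsub>W\<^esub> farr H (\<phi> S)) S \<unlhd>\<^bsub>right W\<^esub> ident M X) \<cdot>\<^bsub>W\<^esub> rho HK.HK (S, X) =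
      rho HK'.HK (S, X) \<cdot>\<^bsub>W\<^esub> (\<lambda>S\<in>Obj U. \<theta> (fobj K' S) \<cdot>\<^bsub>W\<^esub> farr H (\<phi> S)) (S \<triangleleft>\<^bsub>right U\<^esub> X)"
    using \<theta>.H.W.L.V.front2[OF slide] \<theta>.H.W.L.V.front2[OF \<theta>.rho_compat[of X "fobj K' S"]]
      \<theta>.H.W.L.V.front2[OF t]
    by (simp add: e \<theta>.H.W.right_dist)
qed auto

end

section \<open>The category of bimodule functors\<close>

definition bfunctors :: "('o, 'a, 'm) monoidal_scheme \<Rightarrow> ('o, 'a, 'v, 'w) bimodule \<Rightarrow>
    ('o, 'a, 'x, 'y) bimodule \<Rightarrow> ('o, 'v, 'w, 'x, 'y) bfunctor set" where
  "bfunctors M V W = {H. bimodule_functor M V W H \<and> extensional_bfunctor M V H}"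

lemma BiMod_simps [simp]:
  "Obj (BiMod M V W) = bfunctors M V W"
  "(H, K, \<theta>) \<in> Arr (BiMod M V W) \<longleftrightarrow> H \<in> bfunctors M V W \<and> K \<in> bfunctors M V W \<and>
    btransformation M V W H K \<theta> \<and> \<theta> \<in> extensional (Obj V)"
  "Dom (BiMod M V W) (H, K, \<theta>) = H" "Cod (BiMod M V W) (H, K, \<theta>) = K"
  "ident (BiMod M V W) H = (H, H, \<lambda>S\<in>Obj V. ident W (fobj H S))"
  "(H', K', \<theta>') \<cdot>\<^bsub>BiMod M V W\<^esub> (H, K, \<theta>) = (H, K', \<lambda>S\<in>Obj V. \<theta>' S \<cdot>\<^bsub>W\<^esub> \<theta> S)"
  by (auto simp: BiMod_def bfunctors_def Let_def btransformation_iff)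

lemma BiMod_arrE:
  assumes "f \<in> Arr (BiMod M V W)"
  obtains H K \<theta> where "f = (H, K, \<theta>)" "H \<in> bfunctors M V W" "K \<in> bfunctors M V W"
    "btransformation M V W H K \<theta>" "\<theta> \<in> extensional (Obj V)"
  using assms by (cases f) auto

lemma (in bimodule_functor) ident_btransformation:
  "btransformation M V W H H (\<lambda>S\<in>Obj V. ident W (fobj H S))"
  by (intro btransformation.intro btransformation_axioms.intro bimodule_functor_axioms
      nat_transformationI L.cfunctor_axioms) auto

lemma btransformation_Comp:
  assumes "btransformation M V W H K \<theta>" "btransformation M V W K L \<psi>"
  shows "btransformation M V W H L (\<lambda>S\<in>Obj V. \<psi> S \<cdot>\<^bsub>W\<^esub> \<theta> S)"
proof -
  interpret \<theta>: btransformation M V W H K \<theta> by fact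
  interpret \<psi>: btransformation M V W K L \<psi> by fact
  show ?thesis
  proof (intro btransformation.intro btransformation_axioms.intro nat_transformationI
      \<theta>.H.bimodule_functor_axioms \<psi>.K.bimodule_functor_axioms
      \<theta>.H.L.cfunctor_axioms \<psi>.K.L.cfunctor_axioms)
    fix f assume [simp]: "f \<in> Arr V"
    have "\<theta> (Cod V f) \<cdot>\<^bsub>W\<^esub> farr H f = farr K f \<cdot>\<^bsub>W\<^esub> \<theta> (Dom V f)"
      "\<psi> (Cod V f) \<cdot>\<^bsub>W\<^esub> farr K f = farr L f \<cdot>\<^bsub>W\<^esub> \<psi> (Dom V f)"
      by (rule \<theta>.naturality \<psi>.naturality, simp)+
    then show "(\<lambda>S\<in>Obj V. \<psi> S \<cdot>\<^bsub>W\<^esub> \<theta> S) (Cod V f) \<cdot>\<^bsub>W\<^esub> farr H f =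
        farr L f \<cdot>\<^bsub>W\<^esub> (\<lambda>S\<in>Obj V. \<psi> S \<cdot>\<^bsub>W\<^esub> \<theta> S) (Dom V f)"
      by (simp add: \<theta>.H.W.L.V.front2[of "\<psi> (Cod V f)"])
  next
    fix X S assume [simp]: "X \<in> Obj M" "S \<in> Obj V"
    show "(ident M X \<unrhd>\<^bsub>left W\<^esub> (\<lambda>S\<in>Obj V. \<psi> S \<cdot>\<^bsub>W\<^esub> \<theta> S) S) \<cdot>\<^bsub>W\<^esub> lam H (X, S) =
        lam L (X, S) \<cdot>\<^bsub>W\<^esub> (\<lambda>S\<in>Obj V. \<psi> S \<cdot>\<^bsub>W\<^esub> \<theta> S) (X \<triangleright>\<^bsub>left V\<^esub> S)"
      by (simp add: \<theta>.H.W.left_dist \<theta>.lam_compat \<theta>.H.W.L.V.front2[OF \<psi>.lam_compat])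
    show "((\<lambda>S\<in>Obj V. \<psi> S \<cdot>\<^bsub>W\<^esub> \<theta> S) S \<unlhd>\<^bsub>right W\<^esub> ident M X) \<cdot>\<^bsub>W\<^esub> rho H (S, X) =
        rho L (S, X) \<cdot>\<^bsub>W\<^esub> (\<lambda>S\<in>Obj V. \<psi> S \<cdot>\<^bsub>W\<^esub> \<theta> S) (S \<triangleleft>\<^bsub>right V\<^esub> X)"
      by (simp add: \<theta>.H.W.right_dist \<theta>.rho_compat \<theta>.H.W.L.V.front2[OF \<psi>.rho_compat])
  qed auto
qed

lemma BiMod_category: "category (BiMod M V W)"
proof
  fix H assume "H \<in> Obj (BiMod M V W)"
  then show "ident (BiMod M V W) H \<in> hom (BiMod M V W) H H"
    by (simp add: bfunctors_def bimodule_functor.ident_btransformation)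
next
  fix f g H K L assume "f \<in> hom (BiMod M V W) H K" "g \<in> hom (BiMod M V W) K L"
  then show "g \<cdot>\<^bsub>BiMod M V W\<^esub> f \<in> hom (BiMod M V W) H L"
    by (auto elim!: BiMod_arrE intro: btransformation_Comp)
next
  fix f H K assume f: "f \<in> hom (BiMod M V W) H K"
  then obtain \<theta> where \<theta>: "f = (H, K, \<theta>)" "btransformation M V W H K \<theta>" "\<theta> \<in> extensional (Obj V)"
    by (auto elim!: BiMod_arrE)
  interpret btransformation M V W H K \<theta> by fact
  show "ident (BiMod M V W) K \<cdot>\<^bsub>BiMod M V W\<^esub> f = f" "f \<cdot>\<^bsub>BiMod M V W\<^esub> ident (BiMod M V W) H = f"
    using \<theta>(3) by (auto simp: \<theta>(1) intro!: extensionalityI[of _ "Obj V"])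
next
  fix f g h G H K L
  assume "f \<in> hom (BiMod M V W) G H" "g \<in> hom (BiMod M V W) H K" "h \<in> hom (BiMod M V W) K L"
  then obtain \<theta> \<phi> \<psi> where d: "f = (G, H, \<theta>)" "g = (H, K, \<phi>)" "h = (K, L, \<psi>)" and
    b: "btransformation M V W G H \<theta>" "btransformation M V W H K \<phi>" "btransformation M V W K L \<psi>"
    by (auto elim!: BiMod_arrE)
  interpret \<theta>: btransformation M V W G H \<theta> by fact
  interpret \<phi>: btransformation M V W H K \<phi> by fact
  interpret \<psi>: btransformation M V W K L \<psi> by fact
  show "(h \<cdot>\<^bsub>BiMod M V W\<^esub> g) \<cdot>\<^bsub>BiMod M V W\<^esub> f = h \<cdot>\<^bsub>BiMod M V W\<^esub> g \<cdot>\<^bsub>BiMod M V W\<^esub> f"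
    by (simp add: d cong: restrict_cong)
qed (auto elim!: BiMod_arrE)

lemma btransformation_inverse:
  assumes "btransformation M V W H K \<theta>" "\<And>S. S \<in> Obj V \<Longrightarrow> \<theta> S \<in> isos W"
  shows "btransformation M V W K H (\<lambda>S\<in>Obj V. inv_arr W (\<theta> S))"
proof -
  interpret btransformation M V W H K \<theta> by fact
  show ?thesis
  proof (intro btransformation.intro btransformation_axioms.intro nat_transformationI
      H.bimodule_functor_axioms K.bimodule_functor_axioms H.L.cfunctor_axioms K.L.cfunctor_axioms)
    fix f assume [simp]: "f \<in> Arr V"
    show "(\<lambda>S\<in>Obj V. inv_arr W (\<theta> S)) (Cod V f) \<cdot>\<^bsub>W\<^esub> farr K f =
        farr H f \<cdot>\<^bsub>W\<^esub> (\<lambda>S\<in>Obj V. inv_arr W (\<theta> S)) (Dom V f)"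
      using H.W.L.V.inv_square[OF naturality[of f "Dom V f" "Cod V f"]] assms(2) by simp
  next
    fix X S assume [simp]: "X \<in> Obj M" "S \<in> Obj V"
    show "(ident M X \<unrhd>\<^bsub>left W\<^esub> (\<lambda>S\<in>Obj V. inv_arr W (\<theta> S)) S) \<cdot>\<^bsub>W\<^esub> lam K (X, S) =
        lam H (X, S) \<cdot>\<^bsub>W\<^esub> (\<lambda>S\<in>Obj V. inv_arr W (\<theta> S)) (X \<triangleright>\<^bsub>left V\<^esub> S)"
      using H.W.L.V.inv_square[OF lam_compat[of X S]] assms(2) by (simp add: H.W.L.inv_larr)
    show "((\<lambda>S\<in>Obj V. inv_arr W (\<theta> S)) S \<unlhd>\<^bsub>right W\<^esub> ident M X) \<cdot>\<^bsub>W\<^esub> rho K (S, X) =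
        rho H (S, X) \<cdot>\<^bsub>W\<^esub> (\<lambda>S\<in>Obj V. inv_arr W (\<theta> S)) (S \<triangleleft>\<^bsub>right V\<^esub> X)"
      using H.W.L.V.inv_square[OF rho_compat[of X S]] assms(2) by (simp add: H.W.R.inv_rarr)
  qed (use assms(2) in auto)
qed

lemma BiMod_isos:
  assumes "(H, K, \<theta>) \<in> Arr (BiMod M V W)" "\<And>S. S \<in> Obj V \<Longrightarrow> \<theta> S \<in> isos W"
  shows "(H, K, \<theta>) \<in> isos (BiMod M V W)"
    "inv_arr (BiMod M V W) (H, K, \<theta>) = (K, H, \<lambda>S\<in>Obj V. inv_arr W (\<theta> S))"
proof -
  interpret B: category "BiMod M V W" by (rule BiMod_category)
  interpret btransformation M V W H K \<theta> using assms(1) by simp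
  show "(H, K, \<theta>) \<in> isos (BiMod M V W)"
    "inv_arr (BiMod M V W) (H, K, \<theta>) = (K, H, \<lambda>S\<in>Obj V. inv_arr W (\<theta> S))"
    using assms B.isosI[of "(H, K, \<theta>)" "(K, H, \<lambda>S\<in>Obj V. inv_arr W (\<theta> S))"]
      btransformation_inverse[of M V W H K \<theta>]
    by (auto cong: restrict_cong)
qed

section \<open>Bimodule functors on the regular bimodule\<close>

text \<open>
  The half-braiding on \<open>H I\<close> of a functor \<open>H\<close> on the regular bimodule: both \<open>H I \<triangleleft> X\<close> and
  \<open>X \<triangleright> H I\<close> are identified with \<open>H X\<close>.
\<close>

definition half_braiding_of ::
  "('o, 'a, 'm) monoidal_scheme \<Rightarrow> ('v, 'w, 'n) category_scheme \<Rightarrow>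
    ('o, 'o, 'a, 'v, 'w) bfunctor \<Rightarrow> 'o \<Rightarrow> 'w" where
  "half_braiding_of M V H =
    (\<lambda>X\<in>Obj M. lam H (X, tunit M) \<cdot>\<^bsub>V\<^esub> inv_arr V (rho H (tunit M, X)))"

lemma half_braiding_of_simps [simp]: "X \<in> Obj M \<Longrightarrow>
    half_braiding_of M V H X = lam H (X, tunit M) \<cdot>\<^bsub>V\<^esub> inv_arr V (rho H (tunit M, X))"
  "half_braiding_of M V H \<in> extensional (Obj M)"
  by (simp_all add: half_braiding_of_def)

locale regular_functor = bimodule_category M V + F: bimodule_functor M "regular M" V H
  for M :: "('o, 'a, 'm) monoidal_scheme"
    and V :: "('o, 'a, 'v, 'w) bimodule"
    and H :: "('o, 'o, 'a, 'v, 'w) bfunctor"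
begin

abbreviation I where "I \<equiv> tunit M"
abbreviation c where "c \<equiv> half_braiding_of M V H"

lemma regular_farr [simp]:
  "X \<in> Obj M \<Longrightarrow> farr H (ident M X) = ident V (fobj H X)"
  "\<lbrakk>f \<in> Arr M; g \<in> Arr M; Dom M g = Cod M f\<rbrakk> \<Longrightarrow> farr H (g \<cdot>\<^bsub>M\<^esub> f) = farr H g \<bullet> farr H f"
  "f \<in> isos M \<Longrightarrow> farr H (inv_arr M f) = (farr H f)\<^sup>-"
  using F.L.farr_ident[of X] F.L.farr_comp[of f g] F.L.farr_inv[of f] by simp_all

lemma lam_assoc_unit: "\<lbrakk>X \<in> Obj M; Y \<in> Obj M\<rbrakk> \<Longrightarrow>
    lam H (X \<otimes>\<^bsub>M\<^esub> Y, I) = \<chi> X Y (fobj H I) \<bullet> (ident M X \<succ> lam H (Y, I)) \<bullet> lam H (X, Y)"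
  using F.L.lam_assoc[of X Y I] by simp

lemma lam_rho_unit: "\<lbrakk>X \<in> Obj M; Y \<in> Obj M\<rbrakk> \<Longrightarrow>
    (ident M X \<succ> rho H (I, Y)) \<bullet> lam H (X, Y) =
    \<zeta> X (fobj H I) Y \<bullet> (lam H (X, I) \<prec> ident M Y) \<bullet> rho H (X, Y)"
  using F.lam_rho[of X I Y] by simp

text \<open>
  Compatibility of \<open>\<lambda>\<close> and \<open>\<rho>\<close> with associativity splits them at \<open>X \<otimes> Y\<close>; the two inner pieces
  \<open>\<lambda>\<close> and \<open>\<rho>\<close> at \<open>(X, Y)\<close> are exchanged by the compatibility of \<open>\<lambda>\<close> with \<open>\<rho>\<close>.
\<close>

lemma half_braiding_of_half_braiding: "half_braiding M V (fobj H I) c"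
proof (intro half_braiding.intro half_braiding_axioms.intro bimodule_category_axioms)
  fix f X Y assume "f \<in> hom M X Y"
  then have [simp]: "f \<in> Arr M" and d: "X = Dom M f" "Y = Cod M f" by auto
  have l: "lam H (Y, I) \<bullet> farr H f = (f \<succ> ident V (fobj H I)) \<bullet> lam H (X, I)"
    using F.lam_square[of f "ident M I"] by (simp add: d)
  have "rho H (I, Y) \<bullet> farr H f = (ident V (fobj H I) \<prec> f) \<bullet> rho H (I, X)"
    using F.rho_square[of "ident M I" f] by (simp add: d)
  from L.V.inv_square[OF this]
  have "(rho H (I, Y))\<^sup>- \<bullet> (ident V (fobj H I) \<prec> f) = farr H f \<bullet> (rho H (I, X))\<^sup>-"
    by (simp add: d)
  then show "c Y \<bullet> (ident V (fobj H I) \<prec> f) = (f \<succ> ident V (fobj H I)) \<bullet> c X"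
    using L.V.front2[OF l] by (simp add: d)
next
  fix X Y assume [simp]: "X \<in> Obj M" "Y \<in> Obj M"
  have r: "rho H (I, X \<otimes>\<^bsub>M\<^esub> Y) = \<xi> (fobj H I) X Y \<bullet> (rho H (I, X) \<prec> ident M Y) \<bullet> rho H (X, Y)"
    using F.R.rho_assoc[of I X Y] by simp
  have key: "(ident M X \<succ> (rho H (I, Y))\<^sup>-) \<bullet> \<zeta> X (fobj H I) Y \<bullet> (lam H (X, I) \<prec> ident M Y) =
      lam H (X, Y) \<bullet> (rho H (X, Y))\<^sup>-"
    using L.V.inv_square[of "ident M X \<succ> rho H (I, Y)" "lam H (X, Y)"
        "\<zeta> X (fobj H I) Y \<bullet> (lam H (X, I) \<prec> ident M Y)" "rho H (X, Y)"] lam_rho_unit[of X Y]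
    by (simp add: L.inv_larr)
  show "c (X \<otimes>\<^bsub>M\<^esub> Y) = \<chi> X Y (fobj H I) \<bullet> (ident M X \<succ> c Y) \<bullet> \<zeta> X (fobj H I) Y \<bullet>
      (c X \<prec> ident M Y) \<bullet> (\<xi> (fobj H I) X Y)\<^sup>-"
    using L.V.front3[OF key] by (simp add: r lam_assoc_unit left_dist right_dist L.V.inv_Comp R.inv_rarr)
qed auto

sublocale B: half_braiding M V "fobj H I" c
  by (rule half_braiding_of_half_braiding)

text \<open>
  The regular bimodule is free on its unit: \<open>H X = H (X \<otimes> I) \<cong> X \<triangleright> H I\<close>. The compatibility with
  \<open>\<lambda>\<close> is associativity of \<open>\<lambda>\<close>, and the compatibility with \<open>\<rho>\<close> is the
  compatibility of \<open>\<lambda>\<close> with \<open>\<rho>\<close>, both at the unit.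
\<close>

lemma unit_btransformation:
  "btransformation M (regular M) V H (free_functor M V (fobj H I, c)) (\<lambda>X\<in>Obj M. lam H (X, I))"
proof (intro btransformation.intro btransformation_axioms.intro nat_transformationI
    F.bimodule_functor_axioms B.free_functor_bimodule_functor F.L.cfunctor_axioms
    bimodule_functor.axioms(3)[OF B.free_functor_bimodule_functor, THEN left_module_functor.axioms(3)])
  let ?K = "free_functor M V (fobj H I, c)"
  let ?\<eta> = "\<lambda>X\<in>Obj M. lam H (X, I)"
  fix f assume "f \<in> Arr (regular M)"
  then show "?\<eta> (Cod (regular M) f) \<bullet> farr H f = farr ?K f \<bullet> ?\<eta> (Dom (regular M) f)"
    using F.lam_square[of f "ident M I"] by simp
next
  let ?K = "free_functor M V (fobj H I, c)"
  let ?\<eta> = "\<lambda>X\<in>Obj M. lam H (X, I)"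
  fix X S assume [simp]: "X \<in> Obj M" and "S \<in> Obj (regular M)"
  then have [simp]: "S \<in> Obj M" by simp
  show "(ident M X \<succ> ?\<eta> S) \<bullet> lam H (X, S) =
      lam ?K (X, S) \<bullet> ?\<eta> (X \<triangleright>\<^bsub>left (regular M)\<^esub> S)"
    by (simp add: lam_assoc_unit)
  have cancel: "(ident M S \<succ> (lam H (X, I))\<^sup>-) \<bullet> (ident M S \<succ> lam H (X, I)) =
      ident V (S \<rhd> fobj H X)"
    by (simp add: L.linterchange)
  show "(?\<eta> S \<prec> ident M X) \<bullet> rho H (S, X) =
      rho ?K (S, X) \<bullet> ?\<eta> (S \<triangleleft>\<^bsub>right (regular M)\<^esub> X)"
    using L.V.front2[OF cancel] by (simp add: lam_assoc_unit left_dist L.V.inv_Comp lam_rho_unit)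
qed auto

end

text \<open>
  The main source of morphisms in centers: every transformation between functors on the regular
  bimodule has a unit component, and this component commutes with the half-braidings.
\<close>

lemma unit_component_half_braiding:
  assumes "btransformation M (regular M) W H K \<theta>" and [simp]: "X \<in> Obj M"
  shows "(ident M X \<unrhd>\<^bsub>left W\<^esub> \<theta> (tunit M)) \<cdot>\<^bsub>W\<^esub> half_braiding_of M W H X =
    half_braiding_of M W K X \<cdot>\<^bsub>W\<^esub> (\<theta> (tunit M) \<unlhd>\<^bsub>right W\<^esub> ident M X)"
proof -
  interpret btransformation M "regular M" W H K \<theta> by fact
  have "(ident M X \<unrhd>\<^bsub>left W\<^esub> \<theta> (tunit M)) \<cdot>\<^bsub>W\<^esub> lam H (X, tunit M) = lam K (X, tunit M) \<cdot>\<^bsub>W\<^esub> \<theta> X"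
    using lam_compat[of X "tunit M"] by simp
  note l = H.W.L.V.front2[OF this]
  have "rho K (tunit M, X) \<cdot>\<^bsub>W\<^esub> \<theta> X = (\<theta> (tunit M) \<unlhd>\<^bsub>right W\<^esub> ident M X) \<cdot>\<^bsub>W\<^esub> rho H (tunit M, X)"
    using rho_compat[of X "tunit M"] by simp
  from H.W.L.V.inv_square[OF this] show ?thesis by (simp add: l)
qed

lemma free_btransformation:
  assumes "half_braiding M V Z c" "half_braiding M V Z' c'"
    and f: "f \<in> hom V Z Z'"
    and comm: "\<And>X. X \<in> Obj M \<Longrightarrow> (ident M X \<unrhd>\<^bsub>left V\<^esub> f) \<cdot>\<^bsub>V\<^esub> c X =
      c' X \<cdot>\<^bsub>V\<^esub> (f \<unlhd>\<^bsub>right V\<^esub> ident M X)"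
  shows "btransformation M (regular M) V (free_functor M V (Z, c)) (free_functor M V (Z', c'))
    (\<lambda>X\<in>Obj M. ident M X \<unrhd>\<^bsub>left V\<^esub> f)"
proof -
  interpret half_braiding M V Z c by fact
  interpret Z': half_braiding M V Z' c' by fact
  have [simp]: "f \<in> Arr V" "Dom V f = Z" "Cod V f = Z'" using f by auto
  show ?thesis
  proof (intro btransformation.intro btransformation_axioms.intro nat_transformationI
      free_functor_bimodule_functor Z'.free_functor_bimodule_functor
      free_functor_bimodule_functor[THEN bimodule_functor.axioms(3), THEN left_module_functor.axioms(3)]
      Z'.free_functor_bimodule_functor[THEN bimodule_functor.axioms(3), THEN left_module_functor.axioms(3)])
    fix X S assume [simp]: "X \<in> Obj M" and "S \<in> Obj (regular M)"
    then have [simp]: "S \<in> Obj M" by simp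
    have slide: "(\<chi> X Y Z')\<^sup>- \<bullet> (ident M (X \<otimes>\<^bsub>M\<^esub> Y) \<succ> f) = (ident M X \<succ> (ident M Y \<succ> f)) \<bullet> (\<chi> X Y Z)\<^sup>-"
      if "X \<in> Obj M" "Y \<in> Obj M" for X Y
      using that lassoc_square_inv[of "ident M X" "ident M Y" f] by simp
    show "(ident M X \<unrhd>\<^bsub>left V\<^esub> (\<lambda>X\<in>Obj M. ident M X \<unrhd>\<^bsub>left V\<^esub> f) S) \<cdot>\<^bsub>V\<^esub>
          lam (free_functor M V (Z, c)) (X, S) =
        lam (free_functor M V (Z', c')) (X, S) \<cdot>\<^bsub>V\<^esub>
          (\<lambda>X\<in>Obj M. ident M X \<unrhd>\<^bsub>left V\<^esub> f) (X \<triangleright>\<^bsub>left (regular M)\<^esub> S)"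
      by (simp add: slide)
    have mid: "(\<zeta> S Z' X)\<^sup>- \<bullet> (ident M S \<succ> (f \<prec> ident M X)) = ((ident M S \<succ> f) \<prec> ident M X) \<bullet> (\<zeta> S Z X)\<^sup>-"
      using mid_square_inv[of "ident M S" f "ident M X"] by simp
    have c: "(ident M S \<succ> (c' X)\<^sup>-) \<bullet> (ident M S \<succ> (ident M X \<succ> f)) =
        (ident M S \<succ> (f \<prec> ident M X)) \<bullet> (ident M S \<succ> (c X)\<^sup>-)"
      using L.V.inv_square[OF comm[symmetric]] by (simp add: L.linterchange)
    show "((\<lambda>X\<in>Obj M. ident M X \<unrhd>\<^bsub>left V\<^esub> f) S \<unlhd>\<^bsub>right V\<^esub> ident M X) \<cdot>\<^bsub>V\<^esub>
          rho (free_functor M V (Z, c)) (S, X) =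
        rho (free_functor M V (Z', c')) (S, X) \<cdot>\<^bsub>V\<^esub>
          (\<lambda>X\<in>Obj M. ident M X \<unrhd>\<^bsub>left V\<^esub> f) (S \<triangleleft>\<^bsub>right (regular M)\<^esub> X)"
      using L.V.front2[OF mid] L.V.front2[OF c] by (simp add: slide)
  qed (auto simp: L.linterchange)
qed

section \<open>Twisted bimodules and objects of mixed centers\<close>

lemma twisted_simps [simp]:
  "Obj (twisted N G1 G2) = Obj N" "Arr (twisted N G1 G2) = Arr N" "Dom (twisted N G1 G2) = Dom N"
  "Cod (twisted N G1 G2) = Cod N" "ident (twisted N G1 G2) = ident N"
  "Comp (twisted N G1 G2) = Comp N"
  "X \<triangleright>\<^bsub>left (twisted N G1 G2)\<^esub> V = fobj G1 X \<otimes>\<^bsub>N\<^esub> V"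
  "f \<unrhd>\<^bsub>left (twisted N G1 G2)\<^esub> g = farr G1 f \<boxtimes>\<^bsub>N\<^esub> g"
  "lassoc (left (twisted N G1 G2)) X Y V = (inv_arr N (fmu G1 X Y) \<boxtimes>\<^bsub>N\<^esub> ident N V) \<cdot>\<^bsub>N\<^esub>
    inv_arr N (assoc N (fobj G1 X) (fobj G1 Y) V)"
  "V \<triangleleft>\<^bsub>right (twisted N G1 G2)\<^esub> X = V \<otimes>\<^bsub>N\<^esub> fobj G2 X"
  "g \<unlhd>\<^bsub>right (twisted N G1 G2)\<^esub> f = g \<boxtimes>\<^bsub>N\<^esub> farr G2 f"
  "rassoc (right (twisted N G1 G2)) V X Y = (ident N V \<boxtimes>\<^bsub>N\<^esub> inv_arr N (fmu G2 X Y)) \<cdot>\<^bsub>N\<^esub>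
    assoc N V (fobj G2 X) (fobj G2 Y)"
  "mid (twisted N G1 G2) X V Y = assoc N (fobj G1 X) V (fobj G2 Y)"
  by (simp_all add: twisted_def)

lemma twisted_isos [simp]:
  "isos (twisted N G1 G2) = isos N" "inv_arr (twisted N G1 G2) = inv_arr N"
  by (rule isos_cong; simp)+

context monoidal_category
begin

lemma tarr_dist_left: "\<lbrakk>X \<in> Obj C; f \<in> Arr C; g \<in> Arr C; Dom C f = Cod C g\<rbrakk> \<Longrightarrow>
    ident C X \<boxtimes> (f \<cdot> g) = (ident C X \<boxtimes> f) \<cdot> (ident C X \<boxtimes> g)"
  and tarr_dist_right: "\<lbrakk>X \<in> Obj C; f \<in> Arr C; g \<in> Arr C; Dom C f = Cod C g\<rbrakk> \<Longrightarrow>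
    (f \<cdot> g) \<boxtimes> ident C X = (f \<boxtimes> ident C X) \<cdot> (g \<boxtimes> ident C X)"
  by (simp_all add: interchange)

lemma assoc_slide_left: "\<lbrakk>X \<in> Obj C; Y \<in> Obj C; h \<in> Arr C; Z = Cod C h\<rbrakk> \<Longrightarrow>
    assoc C X Y Z \<cdot> (ident C (X \<otimes> Y) \<boxtimes> h) =
    (ident C X \<boxtimes> (ident C Y \<boxtimes> h)) \<cdot> assoc C X Y (Dom C h)"
  using assoc_square[of "ident C X" "ident C Y" h] by simp

lemma assoc_slide_mid: "\<lbrakk>X \<in> Obj C; Z \<in> Obj C; h \<in> Arr C; Y = Cod C h\<rbrakk> \<Longrightarrow>
    assoc C X Y Z \<cdot> ((ident C X \<boxtimes> h) \<boxtimes> ident C Z) =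
    (ident C X \<boxtimes> (h \<boxtimes> ident C Z)) \<cdot> assoc C X (Dom C h) Z"
  using assoc_square[of "ident C X" h "ident C Z"] by simp

lemma assoc_slide_right: "\<lbrakk>Y \<in> Obj C; Z \<in> Obj C; h \<in> Arr C; X = Cod C h\<rbrakk> \<Longrightarrow>
    assoc C X Y Z \<cdot> ((h \<boxtimes> ident C Y) \<boxtimes> ident C Z) =
    (h \<boxtimes> ident C (Y \<otimes> Z)) \<cdot> assoc C (Dom C h) Y Z"
  using assoc_square[of h "ident C Y" "ident C Z"] by simp

end

context monoidal_functor
begin

abbreviation compD (infixr "\<bullet>" 55) where "g \<bullet> f \<equiv> g \<cdot>\<^bsub>D\<^esub> f"
abbreviation tensorD (infixr "\<odot>" 70) where "f \<odot> g \<equiv> f \<boxtimes>\<^bsub>D\<^esub> g"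

lemma mu_slide:
  "\<lbrakk>X \<in> Obj C; g \<in> Arr C; Y = Cod C g\<rbrakk> \<Longrightarrow> fmu G X Y \<bullet> farr G (ident C X \<boxtimes>\<^bsub>C\<^esub> g) =
    (ident D (fobj G X) \<odot> farr G g) \<bullet> fmu G X (Dom C g)"
  "\<lbrakk>Y \<in> Obj C; g \<in> Arr C; X = Cod C g\<rbrakk> \<Longrightarrow> fmu G X Y \<bullet> farr G (g \<boxtimes>\<^bsub>C\<^esub> ident C Y) =
    (farr G g \<odot> ident D (fobj G Y)) \<bullet> fmu G (Dom C g) Y"
  using mu_square[of "ident C X" g] mu_square[of g "ident C Y"] by simp_all

lemma mu_assoc_inv:
  assumes [simp]: "X \<in> Obj C" "Y \<in> Obj C" "Z \<in> Obj C"
  shows "farr G (assoc C X Y Z) \<bullet> inv_arr D (fmu G (X \<otimes>\<^bsub>C\<^esub> Y) Z) \<bullet>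
      (inv_arr D (fmu G X Y) \<odot> ident D (fobj G Z)) =
    inv_arr D (fmu G X (Y \<otimes>\<^bsub>C\<^esub> Z)) \<bullet> (ident D (fobj G X) \<odot> inv_arr D (fmu G Y Z)) \<bullet>
      assoc D (fobj G X) (fobj G Y) (fobj G Z)"
proof -
  let ?a = "assoc D (fobj G X) (fobj G Y) (fobj G Z)"
  let ?l = "(fmu G X Y \<odot> ident D (fobj G Z)) \<bullet> fmu G (X \<otimes>\<^bsub>C\<^esub> Y) Z"
  let ?l' = "(ident D (fobj G X) \<odot> fmu G Y Z) \<bullet> fmu G X (Y \<otimes>\<^bsub>C\<^esub> Z)"
  have "?l' \<bullet> farr G (assoc C X Y Z) = ?a \<bullet> ?l" using mu_assoc[of X Y Z] by simp
  from D.inv_square[OF this] show ?thesis by (simp add: D.inv_Comp D.inv_tarr)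
qed

text \<open>
  The pentagon for the left action \<open>G X \<otimes> S\<close>. It is proved for the inverse isomorphisms, where it
  is the pentagon of \<open>D\<close> pasted with naturality of the associator and the associativity of \<open>\<mu>\<close>.
\<close>

lemma mu_assoc_left:
  assumes [simp]: "X \<in> Obj C" "Y \<in> Obj C" "Z \<in> Obj C" "S \<in> Obj D"
  defines "\<kappa> \<equiv> \<lambda>X Y S. (inv_arr D (fmu G X Y) \<odot> ident D S) \<bullet>
    inv_arr D (assoc D (fobj G X) (fobj G Y) S)"
  shows "\<kappa> X (Y \<otimes>\<^bsub>C\<^esub> Z) S \<bullet> (ident D (fobj G X) \<odot> \<kappa> Y Z S) =
    (farr G (assoc C X Y Z) \<odot> ident D S) \<bullet> \<kappa> (X \<otimes>\<^bsub>C\<^esub> Y) Z S \<bullet> \<kappa> X Y (fobj G Z \<otimes>\<^bsub>D\<^esub> S)"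
  (is "?lhs = ?rhs")
proof (rule D.inv_eqI)
  let ?g = "fobj G"
  have mu: "(assoc D (?g X) (?g Y) (?g Z) \<odot> ident D S) \<bullet>
      ((fmu G X Y \<odot> ident D (?g Z)) \<odot> ident D S) \<bullet> (fmu G (X \<otimes>\<^bsub>C\<^esub> Y) Z \<odot> ident D S) =
    ((ident D (?g X) \<odot> fmu G Y Z) \<odot> ident D S) \<bullet> (fmu G X (Y \<otimes>\<^bsub>C\<^esub> Z) \<odot> ident D S) \<bullet>
      (farr G (assoc C X Y Z) \<odot> ident D S)"
    using mu_assoc[of X Y Z] by (simp flip: D.tarr_dist_right)
  have move: "(farr G (assoc C X Y Z) \<odot> ident D S) \<bullet> (inv_arr D (farr G (assoc C X Y Z)) \<odot> ident D S)
      = ident D (?g (X \<otimes>\<^bsub>C\<^esub> (Y \<otimes>\<^bsub>C\<^esub> Z)) \<otimes>\<^bsub>D\<^esub> S)"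
    by (simp add: D.interchange)
  have "assoc D (?g X) (?g Y) (?g Z \<otimes>\<^bsub>D\<^esub> S) \<bullet> (fmu G X Y \<odot> ident D (?g Z \<otimes>\<^bsub>D\<^esub> S)) \<bullet>
      assoc D (?g (X \<otimes>\<^bsub>C\<^esub> Y)) (?g Z) S \<bullet> (fmu G (X \<otimes>\<^bsub>C\<^esub> Y) Z \<odot> ident D S) =
    assoc D (?g X) (?g Y) (?g Z \<otimes>\<^bsub>D\<^esub> S) \<bullet> assoc D (?g X \<otimes>\<^bsub>D\<^esub> ?g Y) (?g Z) S \<bullet>
      ((fmu G X Y \<odot> ident D (?g Z)) \<odot> ident D S) \<bullet> (fmu G (X \<otimes>\<^bsub>C\<^esub> Y) Z \<odot> ident D S)"
    using D.front2[OF D.assoc_slide_right[of "?g Z" S "fmu G X Y", symmetric]] by simp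
  also have "\<dots> = (ident D (?g X) \<odot> assoc D (?g Y) (?g Z) S) \<bullet>
      assoc D (?g X) (?g Y \<otimes>\<^bsub>D\<^esub> ?g Z) S \<bullet> (assoc D (?g X) (?g Y) (?g Z) \<odot> ident D S) \<bullet>
      ((fmu G X Y \<odot> ident D (?g Z)) \<odot> ident D S) \<bullet> (fmu G (X \<otimes>\<^bsub>C\<^esub> Y) Z \<odot> ident D S)"
    using D.front2[OF D.pentagon[of "?g X" "?g Y" "?g Z" S, symmetric]] by simp
  also have "\<dots> = (ident D (?g X) \<odot> assoc D (?g Y) (?g Z) S) \<bullet>
      (ident D (?g X) \<odot> (fmu G Y Z \<odot> ident D S)) \<bullet> assoc D (?g X) (?g (Y \<otimes>\<^bsub>C\<^esub> Z)) S \<bullet>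
      (fmu G X (Y \<otimes>\<^bsub>C\<^esub> Z) \<odot> ident D S) \<bullet> (farr G (assoc C X Y Z) \<odot> ident D S)"
    using D.front2[OF D.assoc_slide_mid[of "?g X" S "fmu G Y Z"]] by (simp add: mu)
  finally show "inv_arr D ?lhs = inv_arr D ?rhs"
    using move
    by (simp add: \<kappa>_def D.inv_Comp D.inv_tarr D.tarr_dist_left)
qed (simp_all add: \<kappa>_def)

end

locale twisting = G1: monoidal_functor M N G1 + G2: monoidal_functor M N G2
  for M :: "('o, 'a, 'm) monoidal_scheme"
    and N :: "('x, 'y, 'n) monoidal_scheme"
    and G1 G2 :: "('o, 'a, 'x, 'y) mfunctor"
begin

abbreviation T where "T \<equiv> twisted N G1 G2"

lemma twisted_bimodule: "bimodule_category M T"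
proof -
  have cat: "category T" by (rule category_cong[OF G1.D.category_axioms]) simp_all
  have left: "left_module_category M T (left T)"
  proof (intro left_module_category.intro left_module_category_axioms.intro cat
      G1.C.monoidal_category_axioms)
    fix f X X' g Y Y' h S S'
    assume "f \<in> hom M X X'" "g \<in> hom M Y Y'" "h \<in> hom T S S'"
    then have [simp]: "f \<in> Arr M" "g \<in> Arr M" "h \<in> Arr N" and
      d: "X = Dom M f" "X' = Cod M f" "Y = Dom M g" "Y' = Cod M g" "S = Dom N h" "S' = Cod N h"
      by auto
    have a: "inv_arr N (assoc N (fobj G1 X') (fobj G1 Y') S') \<cdot>\<^bsub>N\<^esub>
        (farr G1 f \<boxtimes>\<^bsub>N\<^esub> (farr G1 g \<boxtimes>\<^bsub>N\<^esub> h)) =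
      ((farr G1 f \<boxtimes>\<^bsub>N\<^esub> farr G1 g) \<boxtimes>\<^bsub>N\<^esub> h) \<cdot>\<^bsub>N\<^esub> inv_arr N (assoc N (fobj G1 X) (fobj G1 Y) S)"
      using G1.D.inv_square[OF G1.D.assoc_square[of "farr G1 f" "farr G1 g" h]] by (simp add: d)
    have m: "(inv_arr N (fmu G1 X' Y') \<boxtimes>\<^bsub>N\<^esub> ident N S') \<cdot>\<^bsub>N\<^esub> ((farr G1 f \<boxtimes>\<^bsub>N\<^esub> farr G1 g) \<boxtimes>\<^bsub>N\<^esub> h) =
        (farr G1 (f \<boxtimes>\<^bsub>M\<^esub> g) \<boxtimes>\<^bsub>N\<^esub> h) \<cdot>\<^bsub>N\<^esub> (inv_arr N (fmu G1 X Y) \<boxtimes>\<^bsub>N\<^esub> ident N S)"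
      using G1.D.inv_square[OF G1.mu_square[of f g]] by (simp add: d G1.D.interchange)
    show "lassoc (left T) X' Y' S' \<cdot>\<^bsub>T\<^esub> (f \<unrhd>\<^bsub>left T\<^esub> (g \<unrhd>\<^bsub>left T\<^esub> h)) =
      ((f \<boxtimes>\<^bsub>M\<^esub> g) \<unrhd>\<^bsub>left T\<^esub> h) \<cdot>\<^bsub>T\<^esub> lassoc (left T) X Y S"
      using a G1.D.front2[OF m] by (simp add: d)
  qed (use G1.mu_assoc_left in \<open>auto simp: G1.D.interchange\<close>)
  have right: "right_module_category M T (right T)"
  proof (intro right_module_category.intro right_module_category_axioms.intro cat
      G1.C.monoidal_category_axioms)
    fix f X X' g Y Y' h S S'
    assume "h \<in> hom T S S'" "f \<in> hom M X X'" "g \<in> hom M Y Y'"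
    then have [simp]: "f \<in> Arr M" "g \<in> Arr M" "h \<in> Arr N" and
      d: "X = Dom M f" "X' = Cod M f" "Y = Dom M g" "Y' = Cod M g" "S = Dom N h" "S' = Cod N h"
      by auto
    have m: "(ident N S' \<boxtimes>\<^bsub>N\<^esub> inv_arr N (fmu G2 X' Y')) \<cdot>\<^bsub>N\<^esub> (h \<boxtimes>\<^bsub>N\<^esub> (farr G2 f \<boxtimes>\<^bsub>N\<^esub> farr G2 g)) =
        (h \<boxtimes>\<^bsub>N\<^esub> farr G2 (f \<boxtimes>\<^bsub>M\<^esub> g)) \<cdot>\<^bsub>N\<^esub> (ident N S \<boxtimes>\<^bsub>N\<^esub> inv_arr N (fmu G2 X Y))"
      using G1.D.inv_square[OF G2.mu_square[of f g]] by (simp add: d G1.D.interchange)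
    show "rassoc (right T) S' X' Y' \<cdot>\<^bsub>T\<^esub> ((h \<unlhd>\<^bsub>right T\<^esub> f) \<unlhd>\<^bsub>right T\<^esub> g) =
      (h \<unlhd>\<^bsub>right T\<^esub> (f \<boxtimes>\<^bsub>M\<^esub> g)) \<cdot>\<^bsub>T\<^esub> rassoc (right T) S X Y"
      using G1.D.assoc_square[of h "farr G2 f" "farr G2 g"] G1.D.front2[OF m] by (simp add: d)
  next
    fix S X Y Z assume "S \<in> Obj T" and [simp]: "X \<in> Obj M" "Y \<in> Obj M" "Z \<in> Obj M"
    then have [simp]: "S \<in> Obj N" by simp
    have mu: "(ident N S \<boxtimes>\<^bsub>N\<^esub> inv_arr N (fmu G2 X (Y \<otimes>\<^bsub>M\<^esub> Z))) \<cdot>\<^bsub>N\<^esub>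
        (ident N S \<boxtimes>\<^bsub>N\<^esub> (ident N (fobj G2 X) \<boxtimes>\<^bsub>N\<^esub> inv_arr N (fmu G2 Y Z))) \<cdot>\<^bsub>N\<^esub>
        (ident N S \<boxtimes>\<^bsub>N\<^esub> assoc N (fobj G2 X) (fobj G2 Y) (fobj G2 Z)) =
      (ident N S \<boxtimes>\<^bsub>N\<^esub> farr G2 (assoc M X Y Z)) \<cdot>\<^bsub>N\<^esub>
        (ident N S \<boxtimes>\<^bsub>N\<^esub> inv_arr N (fmu G2 (X \<otimes>\<^bsub>M\<^esub> Y) Z)) \<cdot>\<^bsub>N\<^esub>
        (ident N S \<boxtimes>\<^bsub>N\<^esub> (inv_arr N (fmu G2 X Y) \<boxtimes>\<^bsub>N\<^esub> ident N (fobj G2 Z)))"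
      using G2.mu_assoc_inv[of X Y Z] by (simp flip: G1.D.tarr_dist_left)
    have slide: "assoc N S (fobj G2 X) (fobj G2 (Y \<otimes>\<^bsub>M\<^esub> Z)) \<cdot>\<^bsub>N\<^esub>
        (ident N (S \<otimes>\<^bsub>N\<^esub> fobj G2 X) \<boxtimes>\<^bsub>N\<^esub> inv_arr N (fmu G2 Y Z)) =
        (ident N S \<boxtimes>\<^bsub>N\<^esub> (ident N (fobj G2 X) \<boxtimes>\<^bsub>N\<^esub> inv_arr N (fmu G2 Y Z))) \<cdot>\<^bsub>N\<^esub>
        assoc N S (fobj G2 X) (fobj G2 Y \<otimes>\<^bsub>N\<^esub> fobj G2 Z)"
      "assoc N S (fobj G2 (X \<otimes>\<^bsub>M\<^esub> Y)) (fobj G2 Z) \<cdot>\<^bsub>N\<^esub>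
        ((ident N S \<boxtimes>\<^bsub>N\<^esub> inv_arr N (fmu G2 X Y)) \<boxtimes>\<^bsub>N\<^esub> ident N (fobj G2 Z)) =
        (ident N S \<boxtimes>\<^bsub>N\<^esub> (inv_arr N (fmu G2 X Y) \<boxtimes>\<^bsub>N\<^esub> ident N (fobj G2 Z))) \<cdot>\<^bsub>N\<^esub>
        assoc N S (fobj G2 X \<otimes>\<^bsub>N\<^esub> fobj G2 Y) (fobj G2 Z)"
      by (simp_all add: G1.D.assoc_slide_left G1.D.assoc_slide_mid)
    show "rassoc (right T) S X (Y \<otimes>\<^bsub>M\<^esub> Z) \<cdot>\<^bsub>T\<^esub> rassoc (right T) (S \<triangleleft>\<^bsub>right T\<^esub> X) Y Z =
      (ident T S \<unlhd>\<^bsub>right T\<^esub> assoc M X Y Z) \<cdot>\<^bsub>T\<^esub> rassoc (right T) S (X \<otimes>\<^bsub>M\<^esub> Y) Z \<cdot>\<^bsub>T\<^esub>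
        (rassoc (right T) S X Y \<unlhd>\<^bsub>right T\<^esub> ident M Z)"
      using G1.D.front2[OF slide(1)] G1.D.front2[OF slide(2)] G1.D.front3[OF mu]
      by (simp add: G1.D.tarr_dist_right G1.D.pentagon[symmetric])
  qed (auto simp: G1.D.interchange)
  show ?thesis
  proof (intro bimodule_category.intro bimodule_category_axioms.intro left right)
    fix f X X' h S S' g Y Y'
    assume "f \<in> hom M X X'" "h \<in> hom T S S'" "g \<in> hom M Y Y'"
    then show "mid T X' S' Y' \<cdot>\<^bsub>T\<^esub> ((f \<unrhd>\<^bsub>left T\<^esub> h) \<unlhd>\<^bsub>right T\<^esub> g) =
        (f \<unrhd>\<^bsub>left T\<^esub> (h \<unlhd>\<^bsub>right T\<^esub> g)) \<cdot>\<^bsub>T\<^esub> mid T X S Y"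
      using G1.D.assoc_square[of "farr G1 f" h "farr G2 g"] by auto
  next
    fix X Y S Z assume [simp]: "X \<in> Obj M" "Y \<in> Obj M" "Z \<in> Obj M" and "S \<in> Obj T"
    then have [simp]: "S \<in> Obj N" by simp
    show "lassoc (left T) X Y (S \<triangleleft>\<^bsub>right T\<^esub> Z) \<cdot>\<^bsub>T\<^esub> (ident M X \<unrhd>\<^bsub>left T\<^esub> mid T Y S Z) \<cdot>\<^bsub>T\<^esub>
        mid T X (Y \<triangleright>\<^bsub>left T\<^esub> S) Z =
      mid T (X \<otimes>\<^bsub>M\<^esub> Y) S Z \<cdot>\<^bsub>T\<^esub> (lassoc (left T) X Y S \<unlhd>\<^bsub>right T\<^esub> ident M Z)"
      using G1.D.front2[OF G1.D.assoc_slide_right[of S "fobj G2 Z" "inv_arr N (fmu G1 X Y)"]]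
      by (simp add: G1.D.tarr_dist_right G1.D.pentagon_mid)
    show "(ident M X \<unrhd>\<^bsub>left T\<^esub> rassoc (right T) S Y Z) \<cdot>\<^bsub>T\<^esub> mid T X (S \<triangleleft>\<^bsub>right T\<^esub> Y) Z \<cdot>\<^bsub>T\<^esub>
        (mid T X S Y \<unlhd>\<^bsub>right T\<^esub> ident M Z) =
      mid T X S (Y \<otimes>\<^bsub>M\<^esub> Z) \<cdot>\<^bsub>T\<^esub> rassoc (right T) (X \<triangleright>\<^bsub>left T\<^esub> S) Y Z"
      using G1.D.front2[OF G1.D.assoc_slide_left[of "fobj G1 X" S "inv_arr N (fmu G2 Y Z)"]]
      by (simp add: G1.D.tarr_dist_left G1.D.pentagon)
  qed auto
qed

end

definition admissible ::
  "('p, 'b, 'k) braided_scheme \<Rightarrow> ('p, 'b, 'o, 'a) mfunctor \<Rightarrow> ('p \<Rightarrow> 'b) \<Rightarrow>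
    ('v, 'w, 'n) monoidal_scheme \<Rightarrow> ('v, 'w, 'p, 'b) mfunctor \<Rightarrow> ('o, 'a, 'v, 'w) mfunctor \<Rightarrow>
    ('o, 'a, 'v, 'w) mfunctor \<Rightarrow> 'v \<Rightarrow> ('o \<Rightarrow> 'w) \<Rightarrow> bool" where
  "admissible B P \<tau> N F' G1 G2 V c \<longleftrightarrow> (\<forall>Q\<in>Obj B.
      (\<tau> Q \<boxtimes>\<^bsub>B\<^esub> ident B (fobj F' V)) \<cdot>\<^bsub>B\<^esub>
      fmu F' (fobj G1 (fobj P Q)) V \<cdot>\<^bsub>B\<^esub>
      farr F' (c (fobj P Q)) \<cdot>\<^bsub>B\<^esub>
      inv_arr B (fmu F' V (fobj G2 (fobj P Q))) \<cdot>\<^bsub>B\<^esub>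
      (ident B (fobj F' V) \<boxtimes>\<^bsub>B\<^esub> inv_arr B (\<tau> Q)) =
      braid B (fobj F' V) Q)"

text \<open>
  Objects of the mixed center are the admissible half-braided objects of the twisted bimodule; the
  coherence \<open>\<mu>\<close> that occurs in their tensor condition is part of \<open>\<chi>\<close> and \<open>\<xi>\<close> there.
\<close>

lemma (in twisting) center_object_iff:
  assumes "strict_braided_category B"
  shows "center_object M B P \<tau> N F' G1 G2 V c \<longleftrightarrow>
    half_braiding M T V c \<and> c \<in> extensional (Obj M) \<and> admissible B P \<tau> N F' G1 G2 V c"
proof
  assume "center_object M B P \<tau> N F' G1 G2 V c"
  then interpret center_object M B P \<tau> N F' G1 G2 V c .
  have [simp]: "c X \<in> Arr N" "Dom N (c X) = V \<otimes>\<^bsub>N\<^esub> fobj G2 X" "Cod N (c X) = fobj G1 X \<otimes>\<^bsub>N\<^esub> V"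
    if "X \<in> Obj M" for X using c_iso[OF that] by (auto simp: isos_arr)
  have "half_braiding M T V c"
    using V_in c_iso c_natural
    by (intro half_braiding.intro half_braiding_axioms.intro twisted_bimodule)
      (auto simp: c_tensor G1.D.inv_Comp G1.D.inv_tarr)
  then show "half_braiding M T V c \<and> c \<in> extensional (Obj M) \<and> admissible B P \<tau> N F' G1 G2 V c"
    using c_extensional c_admissible by (simp add: admissible_def)
next
  assume h: "half_braiding M T V c \<and> c \<in> extensional (Obj M) \<and> admissible B P \<tau> N F' G1 G2 V c"
  then interpret half_braiding M T V c by simp
  have [simp]: "V \<in> Obj N" using Z_obj by simp
  note [simp] = c_isos[unfolded twisted_simps twisted_isos]
  have t: "c (X \<otimes>\<^bsub>M\<^esub> Y) = (inv_arr N (fmu G1 X Y) \<boxtimes>\<^bsub>N\<^esub> ident N V) \<cdot>\<^bsub>N\<^esub>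
      inv_arr N (assoc N (fobj G1 X) (fobj G1 Y) V) \<cdot>\<^bsub>N\<^esub>
      (ident N (fobj G1 X) \<boxtimes>\<^bsub>N\<^esub> c Y) \<cdot>\<^bsub>N\<^esub>
      assoc N (fobj G1 X) V (fobj G2 Y) \<cdot>\<^bsub>N\<^esub>
      (c X \<boxtimes>\<^bsub>N\<^esub> ident N (fobj G2 Y)) \<cdot>\<^bsub>N\<^esub>
      inv_arr N (assoc N V (fobj G2 X) (fobj G2 Y)) \<cdot>\<^bsub>N\<^esub>
      (ident N V \<boxtimes>\<^bsub>N\<^esub> fmu G2 X Y)" if "X \<in> Obj M" "Y \<in> Obj M" for X Y
    using that by (simp add: c_tensor G1.D.inv_Comp G1.D.inv_tarr)
  show "center_object M B P \<tau> N F' G1 G2 V c"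
    using h assms c_natural c_iso t
    by (intro center_object.intro center_object_axioms.intro G1.C.monoidal_category_axioms
        G1.D.monoidal_category_axioms) (auto simp: admissible_def)
qed

section \<open>Admissibility\<close>

lemma mfunctor_comp_simps [simp]:
  "fobj (mfunctor_comp D G F) X = fobj G (fobj F X)"
  "farr (mfunctor_comp D G F) f = farr G (farr F f)"
  "fmu (mfunctor_comp D G F) X Y = fmu G (fobj F X) (fobj F Y) \<cdot>\<^bsub>D\<^esub> farr G (fmu F X Y)"
  by (simp_all add: mfunctor_comp_def)

lemma mfunctor_id_simps [simp]:
  "fobj (mfunctor_id C) X = X" "farr (mfunctor_id C) f = f"
  "fmu (mfunctor_id C) X Y = ident C (X \<otimes>\<^bsub>C\<^esub> Y)"
  by (simp_all add: mfunctor_id_def)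

lemma (in monoidal_category) mfunctor_id_monoidal: "monoidal_functor C C (mfunctor_id C)"
  by unfold_locales auto

lemma (in monoidal_category) twisting_id: "twisting C C (mfunctor_id C) (mfunctor_id C)"
  by (intro twisting.intro mfunctor_id_monoidal)

lemma (in monoidal_functor) mfunctor_comp_id_eq: "mfunctor_eq C (mfunctor_comp D G (mfunctor_id C)) G"
  by (simp add: mfunctor_eq_def)

context strict_braided_category
begin

lemmas [simp] = strict_obj strict_assoc

lemma strict_arr [simp]: "\<lbrakk>f \<in> Arr C; g \<in> Arr C; h \<in> Arr C\<rbrakk> \<Longrightarrow> (f \<boxtimes> g) \<boxtimes> h = f \<boxtimes> (g \<boxtimes> h)"
  using assoc_square[of f g h] by simp

lemma strict_ident [simp]: "\<lbrakk>X \<in> Obj C; Y \<in> Obj C; h \<in> Arr C\<rbrakk> \<Longrightarrow>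
    ident C (X \<otimes> Y) \<boxtimes> h = ident C X \<boxtimes> (ident C Y \<boxtimes> h)"
  by (simp flip: tarr_ident)

lemma braid_isos [simp]:
  "\<lbrakk>X \<in> Obj C; Y \<in> Obj C\<rbrakk> \<Longrightarrow> braid C X Y \<in> isos C"
  "\<lbrakk>X \<in> Obj C; Y \<in> Obj C\<rbrakk> \<Longrightarrow> braid C X Y \<in> Arr C"
  "\<lbrakk>X \<in> Obj C; Y \<in> Obj C\<rbrakk> \<Longrightarrow> Dom C (braid C X Y) = X \<otimes> Y"
  "\<lbrakk>X \<in> Obj C; Y \<in> Obj C\<rbrakk> \<Longrightarrow> Cod C (braid C X Y) = Y \<otimes> X"
  using braid_iso[of X Y] by (auto simp: isos_arr)

lemma braid_slide: "\<lbrakk>f \<in> Arr C; Q \<in> Obj C; X = Cod C f\<rbrakk> \<Longrightarrow>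
    braid C X Q \<cdot> (f \<boxtimes> ident C Q) = (ident C Q \<boxtimes> f) \<cdot> braid C (Dom C f) Q"
  by (rule braid_natural) auto

text \<open>
  By the hexagon the braiding with the unit is an idempotent isomorphism.
\<close>

lemma braid_unit_left [simp]: assumes [simp]: "Q \<in> Obj C" shows "braid C (tunit C) Q = ident C Q"
proof -
  have "braid C (tunit C) Q \<cdot> braid C (tunit C) Q = braid C (tunit C) Q \<cdot> ident C Q"
    using hexagon_left[of "tunit C" "tunit C" Q] by simp
  then show ?thesis by (rule iso_cancel_left) simp_all
qed

end

text \<open>
  The data of the second half of the theorem. With \<open>N = M\<close>, \<open>F' = F\<close> and identity functors it
  specializes to the relative center, so the results on admissibility serve both.
\<close>

locale mixed_center_setting = twisting M N G1 G2 +
  B: strict_braided_category B + F: monoidal_functor M B F + P: monoidal_functor B M P +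
  F': monoidal_functor N B F' +
  \<tau>: monoidal_nat_isomorphism B B "mfunctor_comp B F P" "mfunctor_id B" \<tau>
  for M :: "('o, 'a) monoidal"
    and B :: "('p, 'b) braided"
    and F :: "('o, 'a, 'p, 'b) mfunctor"
    and P :: "('p, 'b, 'o, 'a) mfunctor"
    and \<tau> :: "'p \<Rightarrow> 'b"
    and N :: "('x, 'y) monoidal"
    and F' :: "('x, 'y, 'p, 'b) mfunctor"
    and G1 G2 :: "('o, 'a, 'x, 'y) mfunctor" +
  assumes eq1: "mfunctor_eq M (mfunctor_comp B F' G1) F"
    and eq2: "mfunctor_eq M (mfunctor_comp B F' G2) F"
begin

abbreviation compB (infixr "\<bullet>" 55) where "g \<bullet> f \<equiv> g \<cdot>\<^bsub>B\<^esub> f"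
abbreviation tensorB (infixr "\<odot>" 70) where "f \<odot> g \<equiv> f \<boxtimes>\<^bsub>B\<^esub> g"

lemma F'_G_simps [simp]:
  "X \<in> Obj M \<Longrightarrow> fobj F' (fobj G1 X) = fobj F X" "f \<in> Arr M \<Longrightarrow> farr F' (farr G1 f) = farr F f"
  "X \<in> Obj M \<Longrightarrow> fobj F' (fobj G2 X) = fobj F X" "f \<in> Arr M \<Longrightarrow> farr F' (farr G2 f) = farr F f"
  using eq1 eq2 by (simp_all add: mfunctor_eq_def)

lemma F'_mu: "\<lbrakk>X \<in> Obj M; Y \<in> Obj M\<rbrakk> \<Longrightarrow>
    fmu F' (fobj G1 X) (fobj G1 Y) \<bullet> farr F' (fmu G1 X Y) = fmu F X Y"
  using eq1 by (simp add: mfunctor_eq_def)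

lemma \<tau>_isos [simp]:
  "Q \<in> Obj B \<Longrightarrow> \<tau> Q \<in> isos B" "Q \<in> Obj B \<Longrightarrow> \<tau> Q \<in> Arr B"
  "Q \<in> Obj B \<Longrightarrow> Dom B (\<tau> Q) = fobj F (fobj P Q)" "Q \<in> Obj B \<Longrightarrow> Cod B (\<tau> Q) = Q"
  using \<tau>.component_iso[of Q] by (auto simp: isos_arr)

text \<open>
  Both sides of the admissibility condition are natural in the half-braided object: the left side by
  naturality of \<open>\<mu>\<close>, the right side by naturality of the braiding.
\<close>

lemma admissible_iso_invariant:
  assumes c': "half_braiding M T V' c'" "admissible B P \<tau> N F' G1 G2 V' c'"
    and c: "half_braiding M T V c"
    and u [simp]: "u \<in> isos N" "Dom N u = V" "Cod N u = V'"
    and comm: "\<And>X. X \<in> Obj M \<Longrightarrow> (ident N (fobj G1 X) \<boxtimes>\<^bsub>N\<^esub> u) \<cdot>\<^bsub>N\<^esub> c X =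
      c' X \<cdot>\<^bsub>N\<^esub> (u \<boxtimes>\<^bsub>N\<^esub> ident N (fobj G2 X))"
  shows "admissible B P \<tau> N F' G1 G2 V c"
  unfolding admissible_def
proof
  fix Q assume [simp]: "Q \<in> Obj B"
  interpret c: half_braiding M T V c by fact
  interpret c': half_braiding M T V' c' by fact
  note [simp] = c.c_isos[unfolded twisted_simps twisted_isos] c'.c_isos[unfolded twisted_simps twisted_isos]
  have [simp]: "V \<in> Obj N" "V' \<in> Obj N" using c.Z_obj c'.Z_obj by simp_all
  have [simp]: "u \<in> Arr N" by (simp add: isos_arr)
  let ?X = "fobj P Q" and ?v = "fobj F' V" and ?v' = "fobj F' V'"
  let ?E = "(\<tau> Q \<odot> ident B ?v) \<bullet> fmu F' (fobj G1 ?X) V \<bullet> farr F' (c ?X) \<bullet>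
      inv_arr B (fmu F' V (fobj G2 ?X)) \<bullet> (ident B ?v \<odot> inv_arr B (\<tau> Q))"
  let ?E' = "(\<tau> Q \<odot> ident B ?v') \<bullet> fmu F' (fobj G1 ?X) V' \<bullet> farr F' (c' ?X) \<bullet>
      inv_arr B (fmu F' V' (fobj G2 ?X)) \<bullet> (ident B ?v' \<odot> inv_arr B (\<tau> Q))"
  have ex: "(ident B Q \<odot> farr F' u) \<bullet> (\<tau> Q \<odot> ident B ?v) =
      (\<tau> Q \<odot> ident B ?v') \<bullet> (ident B (fobj F ?X) \<odot> farr F' u)"
    "(farr F' u \<odot> ident B (fobj F ?X)) \<bullet> (ident B ?v \<odot> inv_arr B (\<tau> Q)) =
      (ident B ?v' \<odot> inv_arr B (\<tau> Q)) \<bullet> (farr F' u \<odot> ident B Q)"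
    by (simp_all add: B.interchange)
  have mu: "(ident B (fobj F ?X) \<odot> farr F' u) \<bullet> fmu F' (fobj G1 ?X) V =
      fmu F' (fobj G1 ?X) V' \<bullet> farr F' (ident N (fobj G1 ?X) \<boxtimes>\<^bsub>N\<^esub> u)"
    "farr F' (u \<boxtimes>\<^bsub>N\<^esub> ident N (fobj G2 ?X)) \<bullet> inv_arr B (fmu F' V (fobj G2 ?X)) =
      inv_arr B (fmu F' V' (fobj G2 ?X)) \<bullet> (farr F' u \<odot> ident B (fobj F ?X))"
    using B.inv_square[OF F'.mu_slide(2)[of "fobj G2 ?X" u V']] by (simp_all add: F'.mu_slide)
  have com: "farr F' (ident N (fobj G1 ?X) \<boxtimes>\<^bsub>N\<^esub> u) \<bullet> farr F' (c ?X) =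
      farr F' (c' ?X) \<bullet> farr F' (u \<boxtimes>\<^bsub>N\<^esub> ident N (fobj G2 ?X))"
    using arg_cong[OF comm[of ?X], of "farr F'"] by simp
  have "(ident B Q \<odot> farr F' u) \<bullet> ?E = ?E' \<bullet> (farr F' u \<odot> ident B Q)"
    using B.front2[OF ex(1)] ex(2) B.front2[OF mu(1)] B.front2[OF mu(2)] B.front2[OF com] by simp
  also have "\<dots> = braid B ?v' Q \<bullet> (farr F' u \<odot> ident B Q)"
    using c'(2) by (simp add: admissible_def)
  also have "\<dots> = (ident B Q \<odot> farr F' u) \<bullet> braid B ?v Q"
    by (simp add: B.braid_slide)
  finally show "?E = braid B ?v Q" by (rule B.iso_cancel_left) simp_all
qed

text \<open>
  The only place where the hexagon identity enters in an essential way. Up to \<open>\<mu>\<close>, the functor \<open>F'\<close>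
  takes \<open>e\<close>, the half-braiding of \<open>G1 V \<otimes> W\<close>, to the composite of \<open>F c\<close> and \<open>F' d\<close>. By
  admissibility these become the braidings of \<open>F V\<close> and of \<open>F' W\<close> with \<open>Q\<close>, whose composite is the
  braiding of \<open>F V \<otimes> F' W\<close>.
\<close>

lemma admissible_tensor:
  assumes c: "half_braiding M (regular M) V c"
      "admissible B P \<tau> M F (mfunctor_id M) (mfunctor_id M) V c"
    and d: "half_braiding M T W d" "admissible B P \<tau> N F' G1 G2 W d"
    and e: "\<And>X. X \<in> Obj M \<Longrightarrow> e X =
      assoc N (fobj G1 X) (fobj G1 V) W \<cdot>\<^bsub>N\<^esub> (fmu G1 X V \<boxtimes>\<^bsub>N\<^esub> ident N W) \<cdot>\<^bsub>N\<^esub>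
      (farr G1 (c X) \<boxtimes>\<^bsub>N\<^esub> ident N W) \<cdot>\<^bsub>N\<^esub> (inv_arr N (fmu G1 V X) \<boxtimes>\<^bsub>N\<^esub> ident N W) \<cdot>\<^bsub>N\<^esub>
      inv_arr N (assoc N (fobj G1 V) (fobj G1 X) W) \<cdot>\<^bsub>N\<^esub>
      (ident N (fobj G1 V) \<boxtimes>\<^bsub>N\<^esub> d X) \<cdot>\<^bsub>N\<^esub> assoc N (fobj G1 V) W (fobj G2 X)"
  shows "admissible B P \<tau> N F' G1 G2 (fobj G1 V \<otimes>\<^bsub>N\<^esub> W) e"
  unfolding admissible_def
proof
  fix Q assume [simp]: "Q \<in> Obj B"
  interpret c: half_braiding M "regular M" V c by fact
  interpret d: half_braiding M T W d by fact
  note [simp] = c.c_isos[unfolded regular_simps regular_isos] d.c_isos[unfolded twisted_simps twisted_isos]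
  have [simp]: "V \<in> Obj M" "W \<in> Obj N" using c.Z_obj d.Z_obj by simp_all
  let ?X = "fobj P Q" and ?v = "fobj F V" and ?w = "fobj F' W"
  let ?X1 = "fobj G1 ?X" and ?X2 = "fobj G2 ?X" and ?V1 = "fobj G1 V" and ?x = "fobj F ?X"
  let ?u = "fmu F' ?V1 W"
  let ?cF = "fmu F ?X V \<bullet> farr F (c ?X) \<bullet> inv_arr B (fmu F V ?X)"
  let ?dF = "fmu F' ?X1 W \<bullet> farr F' (d ?X) \<bullet> inv_arr B (fmu F' W ?X2)"
  let ?E = "fmu F' ?X1 (?V1 \<otimes>\<^bsub>N\<^esub> W) \<bullet> farr F' (e ?X) \<bullet> inv_arr B (fmu F' (?V1 \<otimes>\<^bsub>N\<^esub> W) ?X2)"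
  have [simp]: "e ?X \<in> Arr N" "Dom N (e ?X) = (?V1 \<otimes>\<^bsub>N\<^esub> W) \<otimes>\<^bsub>N\<^esub> ?X2"
    "Cod N (e ?X) = ?X1 \<otimes>\<^bsub>N\<^esub> (?V1 \<otimes>\<^bsub>N\<^esub> W)"
    by (simp_all add: e)
  \<comment> \<open>Since \<open>B\<close> is strict, \<open>F'\<close> of an associator is a composite of \<open>\<mu>\<close> and its inverses.\<close>
  have key: "(ident B ?x \<odot> ?u) \<bullet> ?E =
      (?cF \<odot> ident B ?w) \<bullet> (ident B ?v \<odot> ?dF) \<bullet> (?u \<odot> ident B ?x)"
  proof -
    have s1: "(ident B ?x \<odot> ?u) \<bullet> fmu F' ?X1 (?V1 \<otimes>\<^bsub>N\<^esub> W) \<bullet> farr F' (assoc N ?X1 ?V1 W) =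
        (fmu F' ?X1 ?V1 \<odot> ident B ?w) \<bullet> fmu F' (?X1 \<otimes>\<^bsub>N\<^esub> ?V1) W"
      using F'.mu_assoc[of ?X1 ?V1 W] by simp
    have s3: "(fmu F' ?X1 ?V1 \<odot> ident B ?w) \<bullet> (farr F' (fmu G1 ?X V) \<odot> ident B ?w) =
        fmu F ?X V \<odot> ident B ?w"
      by (simp add: B.interchange F'_mu)
    have "inv_arr B (farr F' (fmu G1 V ?X)) = inv_arr B (fmu F V ?X) \<bullet> fmu F' ?V1 ?X1"
      by (simp add: B.inv_Comp flip: F'_mu)
    then have s4: "inv_arr B (farr F' (fmu G1 V ?X)) \<odot> ident B ?w =
        (inv_arr B (fmu F V ?X) \<odot> ident B ?w) \<bullet> (fmu F' ?V1 ?X1 \<odot> ident B ?w)"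
      by (simp add: B.tarr_dist_right)
    have "(fmu F' ?V1 ?X1 \<odot> ident B ?w) \<bullet> fmu F' (?V1 \<otimes>\<^bsub>N\<^esub> ?X1) W =
        (ident B ?v \<odot> fmu F' ?X1 W) \<bullet> fmu F' ?V1 (?X1 \<otimes>\<^bsub>N\<^esub> W) \<bullet>
          farr F' (assoc N ?V1 ?X1 W)"
      using F'.mu_assoc[of ?V1 ?X1 W] by simp
    note s5 = B.front2[OF this, of "inv_arr B (farr F' (assoc N ?V1 ?X1 W)) \<bullet> f" for f]
    have s6: "fmu F' ?V1 (W \<otimes>\<^bsub>N\<^esub> ?X2) \<bullet> farr F' (assoc N ?V1 W ?X2) \<bullet>
          inv_arr B (fmu F' (?V1 \<otimes>\<^bsub>N\<^esub> W) ?X2) =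
        (ident B ?v \<odot> inv_arr B (fmu F' W ?X2)) \<bullet> (?u \<odot> ident B ?x)"
    proof -
      have "(ident B ?v \<odot> fmu F' W ?X2) \<bullet> (fmu F' ?V1 (W \<otimes>\<^bsub>N\<^esub> ?X2) \<bullet> farr F' (assoc N ?V1 W ?X2))
          = (?u \<odot> ident B ?x) \<bullet> fmu F' (?V1 \<otimes>\<^bsub>N\<^esub> W) ?X2"
        using F'.mu_assoc[of ?V1 W ?X2] by simp
      from B.inv_square[OF this] show ?thesis by (simp add: B.inv_tarr)
    qed
    note slides = F'.mu_slide(2)[of W "fmu G1 ?X V"] F'.mu_slide(2)[of W "farr G1 (c ?X)"]
      F'.mu_slide(2)[of W "inv_arr N (fmu G1 V ?X)"] F'.mu_slide(1)[of ?V1 "d ?X"]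
    show ?thesis
      using B.front3[OF s1] B.front2[OF s3] s6 slides[THEN B.front2] s5
      by (simp add: e B.tarr_dist_left B.tarr_dist_right s4)
  qed
  have cF: "(\<tau> Q \<odot> ident B ?v) \<bullet> ?cF \<bullet> (ident B ?v \<odot> inv_arr B (\<tau> Q)) = braid B ?v Q"
    using c(2) by (simp add: admissible_def)
  have dF: "(\<tau> Q \<odot> ident B ?w) \<bullet> ?dF \<bullet> (ident B ?w \<odot> inv_arr B (\<tau> Q)) = braid B ?w Q"
    using d(2) by (simp add: admissible_def)
  \<comment> \<open>Inserting \<open>\<tau> Q\<close> and its inverse between the two half-braidings makes each admissibility apply.\<close>
  have hex: "(\<tau> Q \<odot> ident B (?v \<otimes>\<^bsub>B\<^esub> ?w)) \<bullet> (?cF \<odot> ident B ?w) \<bullet>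
      (ident B ?v \<odot> ?dF) \<bullet> (ident B (?v \<otimes>\<^bsub>B\<^esub> ?w) \<odot> inv_arr B (\<tau> Q)) =
      braid B (?v \<otimes>\<^bsub>B\<^esub> ?w) Q"
  proof -
    have [simp]: "?cF \<in> Arr B" "Dom B ?cF = ?v \<otimes>\<^bsub>B\<^esub> ?x" "Cod B ?cF = ?x \<otimes>\<^bsub>B\<^esub> ?v"
      "?dF \<in> Arr B" "Dom B ?dF = ?w \<otimes>\<^bsub>B\<^esub> ?x" "Cod B ?dF = ?x \<otimes>\<^bsub>B\<^esub> ?w"
      by simp_all
    have cancel: "(ident B ?v \<odot> (inv_arr B (\<tau> Q) \<odot> ident B ?w)) \<bullet>
        (ident B ?v \<odot> (\<tau> Q \<odot> ident B ?w)) = ident B (?v \<otimes>\<^bsub>B\<^esub> (?x \<otimes>\<^bsub>B\<^esub> ?w))"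
      by (simp add: B.interchange)
    have "braid B (?v \<otimes>\<^bsub>B\<^esub> ?w) Q = (braid B ?v Q \<odot> ident B ?w) \<bullet> (ident B ?v \<odot> braid B ?w Q)"
      by (simp add: B.hexagon_left)
    also have "\<dots> = (((\<tau> Q \<odot> ident B ?v) \<bullet> ?cF \<bullet> (ident B ?v \<odot> inv_arr B (\<tau> Q))) \<odot> ident B ?w) \<bullet>
        (ident B ?v \<odot> ((\<tau> Q \<odot> ident B ?w) \<bullet> ?dF \<bullet> (ident B ?w \<odot> inv_arr B (\<tau> Q))))"
      by (simp only: cF dF)
    also have "\<dots> = (\<tau> Q \<odot> ident B (?v \<otimes>\<^bsub>B\<^esub> ?w)) \<bullet> (?cF \<odot> ident B ?w) \<bullet>
      (ident B ?v \<odot> ?dF) \<bullet> (ident B (?v \<otimes>\<^bsub>B\<^esub> ?w) \<odot> inv_arr B (\<tau> Q))"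
      using B.front2[OF cancel] by (simp add: B.tarr_dist_left B.tarr_dist_right)
    finally show ?thesis ..
  qed
  let ?L = "(\<tau> Q \<odot> ident B (fobj F' (?V1 \<otimes>\<^bsub>N\<^esub> W))) \<bullet> ?E \<bullet>
      (ident B (fobj F' (?V1 \<otimes>\<^bsub>N\<^esub> W)) \<odot> inv_arr B (\<tau> Q))"
  have ex: "(ident B Q \<odot> ?u) \<bullet> (\<tau> Q \<odot> ident B (fobj F' (?V1 \<otimes>\<^bsub>N\<^esub> W))) =
      (\<tau> Q \<odot> ident B (?v \<otimes>\<^bsub>B\<^esub> ?w)) \<bullet> (ident B ?x \<odot> ?u)"
    "(?u \<odot> ident B ?x) \<bullet> (ident B (fobj F' (?V1 \<otimes>\<^bsub>N\<^esub> W)) \<odot> inv_arr B (\<tau> Q)) =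
      (ident B (?v \<otimes>\<^bsub>B\<^esub> ?w) \<odot> inv_arr B (\<tau> Q)) \<bullet> (?u \<odot> ident B Q)"
    by (simp_all add: B.interchange del: B.strict_ident)
  have "(ident B Q \<odot> ?u) \<bullet> ?L = (\<tau> Q \<odot> ident B (?v \<otimes>\<^bsub>B\<^esub> ?w)) \<bullet>
      ((ident B ?x \<odot> ?u) \<bullet> ?E) \<bullet> (ident B (fobj F' (?V1 \<otimes>\<^bsub>N\<^esub> W)) \<odot> inv_arr B (\<tau> Q))"
    using B.front2[OF ex(1)] by simp
  also have "\<dots> = (\<tau> Q \<odot> ident B (?v \<otimes>\<^bsub>B\<^esub> ?w)) \<bullet> ((?cF \<odot> ident B ?w) \<bullet>
      (ident B ?v \<odot> ?dF) \<bullet> (?u \<odot> ident B ?x)) \<bullet>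
      (ident B (fobj F' (?V1 \<otimes>\<^bsub>N\<^esub> W)) \<odot> inv_arr B (\<tau> Q))"
    by (simp only: key)
  also have "\<dots> = ((\<tau> Q \<odot> ident B (?v \<otimes>\<^bsub>B\<^esub> ?w)) \<bullet> (?cF \<odot> ident B ?w) \<bullet>
      (ident B ?v \<odot> ?dF) \<bullet> (ident B (?v \<otimes>\<^bsub>B\<^esub> ?w) \<odot> inv_arr B (\<tau> Q))) \<bullet>
      (?u \<odot> ident B Q)"
    using ex(2) by simp
  also have "\<dots> = braid B (?v \<otimes>\<^bsub>B\<^esub> ?w) Q \<bullet> (?u \<odot> ident B Q)"
    by (simp only: hex)
  also have "\<dots> = (ident B Q \<odot> ?u) \<bullet> braid B (fobj F' (?V1 \<otimes>\<^bsub>N\<^esub> W)) Q"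
    by (simp add: B.braid_slide)
  finally have "(ident B Q \<odot> ?u) \<bullet> ?L = (ident B Q \<odot> ?u) \<bullet> braid B (fobj F' (?V1 \<otimes>\<^bsub>N\<^esub> W)) Q" .
  then have "?L = braid B (fobj F' (?V1 \<otimes>\<^bsub>N\<^esub> W)) Q" by (rule B.iso_cancel_left) simp_all
  then show "(\<tau> Q \<odot> ident B (fobj F' (?V1 \<otimes>\<^bsub>N\<^esub> W))) \<bullet> fmu F' ?X1 (?V1 \<otimes>\<^bsub>N\<^esub> W) \<bullet>
      farr F' (e ?X) \<bullet> inv_arr B (fmu F' (?V1 \<otimes>\<^bsub>N\<^esub> W) ?X2) \<bullet>
      (ident B (fobj F' (?V1 \<otimes>\<^bsub>N\<^esub> W)) \<odot> inv_arr B (\<tau> Q)) =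
      braid B (fobj F' (?V1 \<otimes>\<^bsub>N\<^esub> W)) Q"
    by simp
qed

end

section \<open>The relative center is a monoidal category\<close>

lemma bfunctor_comp_regular: "bfunctor_comp M M W H K = bfunctor_comp M (regular M) W H K"
  by (simp add: bfunctor_comp_def)

lemma Phi_eq_free_functor:
  assumes "monoidal_category M" "V \<in> Obj M"
  shows "Phi M (V, c) = free_functor M (regular M) (V, c)"
proof -
  interpret monoidal_category M by fact
  show ?thesis using assms(2) by (auto simp: Phi_def free_functor_def fun_eq_iff restrict_def)
qed

lemma Phi_simps [simp]:
  "X \<in> Obj M \<Longrightarrow> fobj (Phi M (V, c)) X = X \<otimes>\<^bsub>M\<^esub> V"
  "f \<in> Arr M \<Longrightarrow> farr (Phi M (V, c)) f = f \<boxtimes>\<^bsub>M\<^esub> ident M V"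
  "\<lbrakk>X \<in> Obj M; Y \<in> Obj M\<rbrakk> \<Longrightarrow> lam (Phi M (V, c)) (X, Y) = assoc M X Y V"
  "\<lbrakk>X \<in> Obj M; Y \<in> Obj M\<rbrakk> \<Longrightarrow> rho (Phi M (V, c)) (X, Y) =
    inv_arr M (assoc M X V Y) \<cdot>\<^bsub>M\<^esub> (ident M X \<boxtimes>\<^bsub>M\<^esub> inv_arr M (c Y)) \<cdot>\<^bsub>M\<^esub> assoc M X Y V"
  by (simp_all add: Phi_def)

lemma center_tensor_simps [simp]:
  "fst (center_tensor M (V, c) (W, d)) = V \<otimes>\<^bsub>M\<^esub> W"
  "X \<in> Obj M \<Longrightarrow> snd (center_tensor M (V, c) (W, d)) X =
    assoc M X V W \<cdot>\<^bsub>M\<^esub> (c X \<boxtimes>\<^bsub>M\<^esub> ident M W) \<cdot>\<^bsub>M\<^esub> inv_arr M (assoc M V X W) \<cdot>\<^bsub>M\<^esub>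
      (ident M V \<boxtimes>\<^bsub>M\<^esub> d X) \<cdot>\<^bsub>M\<^esub> assoc M V W X"
  "snd (center_tensor M (V, c) (W, d)) \<in> extensional (Obj M)"
  by (simp_all add: center_tensor_def)

lemma Phi_bimodule_functor:
  assumes "half_braiding M (regular M) V c"
  shows "bimodule_functor M (regular M) (regular M) (Phi M (V, c))"
proof -
  interpret half_braiding M "regular M" V c by fact
  show ?thesis
    using free_functor_bimodule_functor Phi_eq_free_functor[OF L.M.monoidal_category_axioms, of V c]
      Z_obj by simp
qed

definition center_morphism ::
  "('o, 'a, 'm) monoidal_scheme \<Rightarrow> ('o, 'a, 'v, 'w) bimodule \<Rightarrow> 'v \<Rightarrow> ('o \<Rightarrow> 'w) \<Rightarrow> 'v \<Rightarrow> ('o \<Rightarrow> 'w) \<Rightarrow>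
    'w \<Rightarrow> bool" where
  "center_morphism M V Z c Z' c' f \<longleftrightarrow> f \<in> hom V Z Z' \<and>
    (\<forall>X\<in>Obj M. (ident M X \<unrhd>\<^bsub>left V\<^esub> f) \<cdot>\<^bsub>V\<^esub> c X = c' X \<cdot>\<^bsub>V\<^esub> (f \<unlhd>\<^bsub>right V\<^esub> ident M X))"

lemma Phi_btransformation:
  assumes "half_braiding M (regular M) V c" "half_braiding M (regular M) V' c'"
    "center_morphism M (regular M) V c V' c' f"
  shows "btransformation M (regular M) (regular M) (Phi M (V, c)) (Phi M (V', c'))
    (\<lambda>X\<in>Obj M. ident M X \<boxtimes>\<^bsub>M\<^esub> f)"
proof -
  interpret V: half_braiding M "regular M" V c by fact
  interpret V': half_braiding M "regular M" V' c' by fact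
  have "Phi M (V, c) = free_functor M (regular M) (V, c)"
    "Phi M (V', c') = free_functor M (regular M) (V', c')"
    using V.Z_obj V'.Z_obj by (simp_all add: Phi_eq_free_functor V.L.M.monoidal_category_axioms)
  then show ?thesis
    using free_btransformation[OF assms(1,2), of f] assms(3) by (simp add: center_morphism_def)
qed

text \<open>
  Tensor products in the center are studied through the composites \<open>PhiPhi\<close>: apart from
  admissibility, everything that has to be checked about \<open>center_tensor\<close> is the value at the unit of
  a statement about composition of bimodule functors, where it holds for general reasons.
\<close>

locale half_braiding_pair = S: half_braiding M "regular M" V c + T: half_braiding M "regular M" W d
  for M :: "('o, 'a, 'm) monoidal_scheme"
    and V :: 'o and c :: "'o \<Rightarrow> 'a" and W :: 'o and d :: "'o \<Rightarrow> 'a"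
begin

lemma VW [simp]: "V \<in> Obj M" "W \<in> Obj M"
  using S.Z_obj T.Z_obj by simp_all

lemmas [simp] = S.c_isos[unfolded regular_simps regular_isos] T.c_isos[unfolded regular_simps regular_isos]

abbreviation PhiPhi where
  "PhiPhi \<equiv> bfunctor_comp M (regular M) (regular M) (Phi M (W, d)) (Phi M (V, c))"

sublocale pair: bfunctor_pair M "regular M" "regular M" "regular M" "Phi M (V, c)" "Phi M (W, d)"
  by (intro bfunctor_pair.intro Phi_bimodule_functor S.half_braiding_axioms T.half_braiding_axioms)

sublocale PhiPhi: regular_functor M "regular M" PhiPhi
  by (intro regular_functor.intro pair.bimodule_functor_comp S.L.M.regular_bimodule)

text \<open>
  The formula for the half-braiding of a tensor product is no choice: it is forced by
  \<open>\<Phi>\<close> turning tensor products into composites.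
\<close>

lemma half_braiding_of_PhiPhi:
  "half_braiding_of M (regular M) PhiPhi = snd (center_tensor M (V, c) (W, d))"
proof (rule extensionalityI[of _ "Obj M"])
  fix X assume "X \<in> Obj M"
  then show "half_braiding_of M (regular M) PhiPhi X = snd (center_tensor M (V, c) (W, d)) X"
    by (simp add: S.L.M.inv_Comp S.L.M.inv_tarr S.L.M.tarr_dist_right)
qed (simp_all add: half_braiding_of_def)

lemma center_tensor_half_braiding:
  "half_braiding M (regular M) (V \<otimes>\<^bsub>M\<^esub> W) (snd (center_tensor M (V, c) (W, d)))"
  using PhiPhi.half_braiding_of_half_braiding by (simp add: half_braiding_of_PhiPhi)

lemma center_tensor_eq: "center_tensor M (V, c) (W, d) =
    (V \<otimes>\<^bsub>M\<^esub> W, snd (center_tensor M (V, c) (W, d)))"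
  by (simp add: prod_eq_iff)

lemma Phi_center_tensor: "Phi M (center_tensor M (V, c) (W, d)) =
    free_functor M (regular M) (V \<otimes>\<^bsub>M\<^esub> W, snd (center_tensor M (V, c) (W, d)))"
  by (subst center_tensor_eq) (simp add: Phi_eq_free_functor S.L.M.monoidal_category_axioms)

text \<open>
  The comparison between \<open>\<Phi>(W, d) \<circ> \<Phi>(V, c)\<close> and \<open>\<Phi>((V, c) \<otimes> (W, d))\<close> is the isomorphism
  of a functor with the free functor on its value at the unit.
\<close>

lemma Phi_center_tensor_btransformation:
  "btransformation M (regular M) (regular M) PhiPhi (Phi M (center_tensor M (V, c) (W, d)))
    (\<lambda>X\<in>Obj M. assoc M X V W)"
proof -
  have "(\<lambda>X\<in>Obj M. lam PhiPhi (X, tunit M)) = (\<lambda>X\<in>Obj M. assoc M X V W)"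
    by (intro restrict_ext) simp
  then show ?thesis
    using PhiPhi.unit_btransformation by (simp add: half_braiding_of_PhiPhi Phi_center_tensor)
qed

end

lemma bfunctor_comp_assoc:
  assumes "bimodule_functor M U V K" "bimodule_functor M V W H" "bimodule_functor M W W' L"
  shows "bfunctor_comp M U W' (bfunctor_comp M V W' L H) K = bfunctor_comp M U W' L (bfunctor_comp M U W H K)"
proof -
  interpret K: bimodule_functor M U V K by fact
  interpret H: bimodule_functor M V W H by fact
  interpret L: bimodule_functor M W W' L by fact
  show ?thesis by (auto simp: bfunctor_comp_def fun_eq_iff restrict_def)
qed

lemma (in half_braiding_pair) center_morphism_tensor:
  assumes "half_braiding_pair M V' c' W' d'"
    and "center_morphism M (regular M) V c V' c' f" "center_morphism M (regular M) W d W' d' g"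
  shows "center_morphism M (regular M) (V \<otimes>\<^bsub>M\<^esub> W) (snd (center_tensor M (V, c) (W, d)))
    (V' \<otimes>\<^bsub>M\<^esub> W') (snd (center_tensor M (V', c') (W', d'))) (f \<boxtimes>\<^bsub>M\<^esub> g)"
proof -
  interpret P': half_braiding_pair M V' c' W' d' by fact
  have [simp]: "f \<in> Arr M" "g \<in> Arr M" "Dom M f = V" "Cod M f = V'" "Dom M g = W" "Cod M g = W'"
    using assms(2,3) by (auto simp: center_morphism_def)
  interpret btransformation_pair M "regular M" "regular M" "regular M"
    "Phi M (V, c)" "Phi M (V', c')" "\<lambda>X\<in>Obj M. ident M X \<boxtimes>\<^bsub>M\<^esub> f"
    "Phi M (W, d)" "Phi M (W', d')" "\<lambda>X\<in>Obj M. ident M X \<boxtimes>\<^bsub>M\<^esub> g"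
    by (intro btransformation_pair.intro Phi_btransformation S.half_braiding_axioms
        T.half_braiding_axioms P'.S.half_braiding_axioms P'.T.half_braiding_axioms assms(2,3))
  show ?thesis
    using unit_component_half_braiding[OF horizontal_composite]
    by (simp add: center_morphism_def half_braiding_of_PhiPhi P'.half_braiding_of_PhiPhi
        S.L.M.interchange del: half_braiding_of_simps)
qed

text \<open>
  Both triple tensor products are compared with the value at the unit of the triple composite of
  \<open>\<Phi>\<close>. On one side the comparison is an identity at the unit, so the half-braidings agree; on
  the other side it is the associator.
\<close>

lemma center_morphism_assoc:
  assumes "half_braiding_pair M V c W d" "half_braiding_pair M W d U e"
  defines "VW \<equiv> center_tensor M (V, c) (W, d)" and "WU \<equiv> center_tensor M (W, d) (U, e)"
  shows "center_morphism M (regular M)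
    ((V \<otimes>\<^bsub>M\<^esub> W) \<otimes>\<^bsub>M\<^esub> U) (snd (center_tensor M VW (U, e)))
    (V \<otimes>\<^bsub>M\<^esub> (W \<otimes>\<^bsub>M\<^esub> U)) (snd (center_tensor M (V, c) WU)) (assoc M V W U)"
proof -
  interpret VW: half_braiding_pair M V c W d by fact
  interpret WU: half_braiding_pair M W d U e by fact
  interpret VW_U: half_braiding_pair M "V \<otimes>\<^bsub>M\<^esub> W" "snd VW" U e
    using VW.center_tensor_half_braiding WU.T.half_braiding_axioms
    by (simp add: half_braiding_pair_def VW_def)
  interpret V_WU: half_braiding_pair M V c "W \<otimes>\<^bsub>M\<^esub> U" "snd WU"
    using WU.center_tensor_half_braiding VW.S.half_braiding_axioms
    by (simp add: half_braiding_pair_def WU_def)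
  have eq: "VW = (V \<otimes>\<^bsub>M\<^esub> W, snd VW)" "WU = (W \<otimes>\<^bsub>M\<^esub> U, snd WU)"
    by (simp_all add: VW_def WU_def prod_eq_iff)
  have [simp]: "fobj (Phi M VW) Y = Y \<otimes>\<^bsub>M\<^esub> (V \<otimes>\<^bsub>M\<^esub> W)" "fobj (Phi M WU) Y = Y \<otimes>\<^bsub>M\<^esub> (W \<otimes>\<^bsub>M\<^esub> U)"
    if "Y \<in> Obj M" for Y
    using that by (subst eq, simp)+
  let ?R = "regular M"
  let ?PPP = "bfunctor_comp M ?R ?R WU.PhiPhi (Phi M (V, c))"
  have PPP: "?PPP = bfunctor_comp M ?R ?R (Phi M (U, e)) VW.PhiPhi"
    by (intro bfunctor_comp_assoc Phi_bimodule_functor VW.S.half_braiding_axioms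
        VW.T.half_braiding_axioms WU.T.half_braiding_axioms)
  interpret r: btransformation_pair M ?R ?R ?R "Phi M (V, c)" "Phi M (V, c)"
      "\<lambda>S\<in>Obj ?R. ident ?R (fobj (Phi M (V, c)) S)"
      WU.PhiPhi "Phi M WU" "\<lambda>X\<in>Obj M. assoc M X W U"
    unfolding WU_def
    by (intro btransformation_pair.intro WU.Phi_center_tensor_btransformation
        bimodule_functor.ident_btransformation Phi_bimodule_functor VW.S.half_braiding_axioms)
  interpret l: btransformation_pair M ?R ?R ?R VW.PhiPhi "Phi M VW" "\<lambda>X\<in>Obj M. assoc M X V W"
      "Phi M (U, e)" "Phi M (U, e)" "\<lambda>S\<in>Obj ?R. ident ?R (fobj (Phi M (U, e)) S)"
    unfolding VW_def
    by (intro btransformation_pair.intro VW.Phi_center_tensor_btransformation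
        bimodule_functor.ident_btransformation Phi_bimodule_functor WU.T.half_braiding_axioms)
  have "regular_functor M ?R l.HK.HK"
    by (intro regular_functor.intro l.HK.bimodule_functor_comp VW.S.L.M.regular_bimodule)
  note types = half_braiding.c_isos[OF regular_functor.half_braiding_of_half_braiding[OF this]]
    half_braiding.c_isos[OF VW_U.center_tensor_half_braiding[folded eq]]
  note types = types[unfolded regular_simps regular_isos]
  show ?thesis
    unfolding center_morphism_def
  proof (intro conjI ballI)
    fix X assume [simp]: "X \<in> Obj M"
    \<comment> \<open>The component of the transformation at the unit is an identity arrow here.\<close>
    have l: "half_braiding_of M ?R ?PPP X = snd (center_tensor M VW (U, e)) X"
      using unit_component_half_braiding[OF l.horizontal_composite, of X]
      by (simp add: PPP VW_U.half_braiding_of_PhiPhi[folded eq] types del: half_braiding_of_simps)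
    show "(ident M X \<unrhd>\<^bsub>left ?R\<^esub> assoc M V W U) \<cdot>\<^bsub>?R\<^esub> snd (center_tensor M VW (U, e)) X =
        snd (center_tensor M (V, c) WU) X \<cdot>\<^bsub>?R\<^esub> (assoc M V W U \<unlhd>\<^bsub>right ?R\<^esub> ident M X)"
      using unit_component_half_braiding[OF r.horizontal_composite, of X]
      by (simp add: l V_WU.half_braiding_of_PhiPhi[folded eq] del: half_braiding_of_simps)
  qed simp
qed

lemma mixed_center_simps:
  "(V, c) \<in> Obj (mixed_center M B P \<tau> N F' G1 G2) \<longleftrightarrow> center_object M B P \<tau> N F' G1 G2 V c"
  "Dom (mixed_center M B P \<tau> N F' G1 G2) (S, T, f) = S"
  "Cod (mixed_center M B P \<tau> N F' G1 G2) (S, T, f) = T"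
  "ident (mixed_center M B P \<tau> N F' G1 G2) S = (S, S, ident N (fst S))"
  "(S', T', g) \<cdot>\<^bsub>mixed_center M B P \<tau> N F' G1 G2\<^esub> (S, T, f) = (S, T', g \<cdot>\<^bsub>N\<^esub> f)"
  by (auto simp: mixed_center_def Let_def split: prod.split)

context bimodule_category
begin

lemma center_morphism_ident:
  "half_braiding M V Z c \<Longrightarrow> center_morphism M V Z c Z c (ident V Z)"
  using half_braiding.c_isos[of M V Z c] half_braiding.Z_obj[of M V Z c]
  by (simp add: center_morphism_def)

lemma center_morphism_comp:
  assumes c: "half_braiding M V Z c" "half_braiding M V Z' c'" "half_braiding M V Z'' c''"
    and f: "center_morphism M V Z c Z' c' f" and g: "center_morphism M V Z' c' Z'' c'' g"
  shows "center_morphism M V Z c Z'' c'' (g \<bullet> f)"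
proof -
  note [simp] = half_braiding.c_isos[OF c(1)] half_braiding.c_isos[OF c(2)]
    half_braiding.c_isos[OF c(3)]
  have [simp]: "f \<in> Arr V" "g \<in> Arr V" "Dom V f = Z" "Cod V f = Z'" "Dom V g = Z'" "Cod V g = Z''"
    using f g by (auto simp: center_morphism_def)
  have sq: "(ident M X \<succ> f) \<bullet> c X = c' X \<bullet> (f \<prec> ident M X)"
    "(ident M X \<succ> g) \<bullet> c' X = c'' X \<bullet> (g \<prec> ident M X)" if "X \<in> Obj M" for X
    using f g that by (auto simp: center_morphism_def)
  have "(ident M X \<succ> (g \<bullet> f)) \<bullet> c X = c'' X \<bullet> ((g \<bullet> f) \<prec> ident M X)" if [simp]: "X \<in> Obj M" for X
    using sq(1)[of X] L.V.front2[OF sq(2)[of X]] by (simp add: left_dist right_dist)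
  then show ?thesis by (simp add: center_morphism_def)
qed

lemma center_morphism_inv:
  assumes c: "half_braiding M V Z c" "half_braiding M V Z' c'"
    and f: "center_morphism M V Z c Z' c' f" "f \<in> isos V"
  shows "center_morphism M V Z' c' Z c (f\<^sup>-)"
proof -
  note [simp] = half_braiding.c_isos[OF c(1)] half_braiding.c_isos[OF c(2)]
  have [simp]: "f \<in> isos V" "f \<in> Arr V" "Dom V f = Z" "Cod V f = Z'"
    using f by (auto simp: center_morphism_def)
  have "(ident M X \<succ> f\<^sup>-) \<bullet> c' X = c X \<bullet> (f\<^sup>- \<prec> ident M X)" if [simp]: "X \<in> Obj M" for X
    using L.V.inv_square[of "ident M X \<succ> f" "c X" "c' X" "f \<prec> ident M X"] f(1)
    by (simp add: L.inv_larr R.inv_rarr center_morphism_def)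
  then show ?thesis by (simp add: center_morphism_def)
qed

end

context mixed_center_setting
begin

abbreviation Z where "Z \<equiv> mixed_center M B P \<tau> N F' G1 G2"

lemma Z_obj_iff: "(V, c) \<in> Obj Z \<longleftrightarrow>
    half_braiding M T V c \<and> c \<in> extensional (Obj M) \<and> admissible B P \<tau> N F' G1 G2 V c"
  by (simp add: mixed_center_simps center_object_iff[OF B.strict_braided_category_axioms])

lemma Z_arr_iff: "((V, c), (W, d), f) \<in> Arr Z \<longleftrightarrow>
    (V, c) \<in> Obj Z \<and> (W, d) \<in> Obj Z \<and> center_morphism M T V c W d f"
  by (auto simp: mixed_center_def Let_def center_morphism_def)

lemma Z_arrE:
  assumes "f \<in> Arr Z"
  obtains V c W d g where "f = ((V, c), (W, d), g)" "(V, c) \<in> Obj Z" "(W, d) \<in> Obj Z"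
    "center_morphism M T V c W d g"
  using assms by (cases f) (auto simp: Z_arr_iff)

lemma Z_category: "category Z"
proof -
  interpret T: bimodule_category M T by (rule twisted_bimodule)
  show ?thesis
  proof
    fix S assume "S \<in> Obj Z"
    then show "ident Z S \<in> hom Z S S"
      using T.center_morphism_ident
      by (cases S) (auto simp: mixed_center_simps(2-) Z_arr_iff Z_obj_iff)
  next
    fix f g S T' U assume "f \<in> hom Z S T'" "g \<in> hom Z T' U"
    then show "g \<cdot>\<^bsub>Z\<^esub> f \<in> hom Z S U"
      using T.center_morphism_comp
      by (auto elim!: Z_arrE simp: mixed_center_simps(2-) Z_arr_iff Z_obj_iff)
  next
    fix f g h S T' U R assume "f \<in> hom Z S T'" "g \<in> hom Z T' U" "h \<in> hom Z U R"
    then show "(h \<cdot>\<^bsub>Z\<^esub> g) \<cdot>\<^bsub>Z\<^esub> f = h \<cdot>\<^bsub>Z\<^esub> g \<cdot>\<^bsub>Z\<^esub> f"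
      by (auto elim!: Z_arrE simp: mixed_center_simps(2-) center_morphism_def)
  qed (auto elim!: Z_arrE simp: mixed_center_simps(2-) center_morphism_def)
qed

lemma Z_isos:
  assumes "(S, S', f) \<in> Arr Z" "f \<in> isos N"
  shows "(S, S', f) \<in> isos Z" "inv_arr Z (S, S', f) = (S', S, inv_arr N f)"
proof -
  interpret Z: category Z by (rule Z_category)
  interpret T: bimodule_category M T by (rule twisted_bimodule)
  obtain V c W d where d: "S = (V, c)" "S' = (W, d)" by (metis prod.exhaust)
  have [simp]: "half_braiding M T V c" "half_braiding M T W d" "center_morphism M T V c W d f"
    "Dom N f = V" "Cod N f = W"
    using assms(1) by (auto simp: d Z_arr_iff Z_obj_iff center_morphism_def)
  have "(S', S, inv_arr N f) \<in> Arr Z"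
    using assms T.center_morphism_inv[of V c W d f] by (auto simp: d Z_arr_iff)
  then show "(S, S', f) \<in> isos Z" "inv_arr Z (S, S', f) = (S', S, inv_arr N f)"
    using Z.isosI[of "(S, S', f)" "(S', S, inv_arr N f)"] assms
    by (simp_all add: mixed_center_simps(2-) d)
qed

end

text \<open>
  The twisted bimodule of two identity functors differs from the regular bimodule only in composites
  with identities.
\<close>

lemma half_braiding_regular_iff:
  assumes "monoidal_category M"
  shows "half_braiding M (twisted M (mfunctor_id M) (mfunctor_id M)) V c \<longleftrightarrow>
    half_braiding M (regular M) V c"
proof -
  interpret monoidal_category M by fact
  interpret id: twisting M M "mfunctor_id M" "mfunctor_id M" by (rule twisting_id)
  have "half_braiding_axioms M (twisted M (mfunctor_id M) (mfunctor_id M)) V c \<longleftrightarrow>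
      half_braiding_axioms M (regular M) V c"
  proof (cases "V \<in> Obj M \<and> (\<forall>X\<in>Obj M. c X \<in> iso M (V \<otimes>\<^bsub>M\<^esub> X) (X \<otimes>\<^bsub>M\<^esub> V))")
    case True
    then have [simp]: "V \<in> Obj M" "c X \<in> Arr M" "Dom M (c X) = V \<otimes>\<^bsub>M\<^esub> X" "Cod M (c X) = X \<otimes>\<^bsub>M\<^esub> V"
      if "X \<in> Obj M" for X using that by (auto simp: isos_arr)
    show ?thesis using True by (auto simp: half_braiding_axioms_def)
  next
    case False
    then show ?thesis by (auto simp: half_braiding_axioms_def)
  qed
  then show ?thesis
    by (simp add: half_braiding_def id.twisted_bimodule regular_bimodule)
qed

lemma relative_center_simps:
  "Obj (relative_center M B F P \<tau>) = Obj (mixed_center M B P \<tau> M F (mfunctor_id M) (mfunctor_id M))"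
  "Arr (relative_center M B F P \<tau>) = Arr (mixed_center M B P \<tau> M F (mfunctor_id M) (mfunctor_id M))"
  "Dom (relative_center M B F P \<tau>) (S, T, f) = S"
  "Cod (relative_center M B F P \<tau>) (S, T, f) = T"
  "ident (relative_center M B F P \<tau>) S = (S, S, ident M (fst S))"
  "(S', T', g) \<cdot>\<^bsub>relative_center M B F P \<tau>\<^esub> (S, T, f) = (S, T', g \<cdot>\<^bsub>M\<^esub> f)"
  "tunit (relative_center M B F P \<tau>) = (tunit M, \<lambda>X\<in>Obj M. ident M X)"
  "tobj (relative_center M B F P \<tau>) = center_tensor M"
  "(S, S', f) \<boxtimes>\<^bsub>relative_center M B F P \<tau>\<^esub> (T, T', g) =
    (center_tensor M S T, center_tensor M S' T', f \<boxtimes>\<^bsub>M\<^esub> g)"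
  "assoc (relative_center M B F P \<tau>) S T U = (center_tensor M (center_tensor M S T) U,
    center_tensor M S (center_tensor M T U), assoc M (fst S) (fst T) (fst U))"
  by (simp_all add: relative_center_def category.defs monoidal.defs mixed_center_simps(2-))

lemmas [simp] = relative_center_simps(3-)

lemma fst_center_tensor [simp]: "fst (center_tensor M S T) = fst S \<otimes>\<^bsub>M\<^esub> fst T"
  by (cases S; cases T) simp

locale relative_center_setting =
  M: monoidal_category M + B: strict_braided_category B + F: monoidal_functor M B F +
  P: monoidal_functor B M P +
  \<tau>: monoidal_nat_isomorphism B B "mfunctor_comp B F P" "mfunctor_id B" \<tau>
  for M :: "('o, 'a) monoidal"
    and B :: "('p, 'b) braided"
    and F :: "('o, 'a, 'p, 'b) mfunctor"
    and P :: "('p, 'b, 'o, 'a) mfunctor"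
    and \<tau> :: "'p \<Rightarrow> 'b"
begin

abbreviation RC where "RC \<equiv> relative_center M B F P \<tau>"
abbreviation idM where "idM \<equiv> mfunctor_id M"
abbreviation R where "R \<equiv> regular M"

lemma self_setting: "mixed_center_setting M B F P \<tau> M F idM idM"
  by (intro mixed_center_setting.intro mixed_center_setting_axioms.intro M.twisting_id
      F.mfunctor_comp_id_eq B.strict_braided_category_axioms F.monoidal_functor_axioms
      P.monoidal_functor_axioms \<tau>.monoidal_nat_isomorphism_axioms)

lemma RC_obj_iff: "(V, c) \<in> Obj RC \<longleftrightarrow> half_braiding M R V c \<and> c \<in> extensional (Obj M) \<and>
    admissible B P \<tau> M F idM idM V c"
  by (simp add: relative_center_simps(1) mixed_center_setting.Z_obj_iff[OF self_setting]
      half_braiding_regular_iff[OF M.monoidal_category_axioms])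

lemma RC_arr_iff: "((V, c), (W, d), f) \<in> Arr RC \<longleftrightarrow>
    (V, c) \<in> Obj RC \<and> (W, d) \<in> Obj RC \<and> center_morphism M R V c W d f"
  by (simp add: relative_center_simps(1,2) mixed_center_setting.Z_arr_iff[OF self_setting]
      center_morphism_def)

lemma RC_arr_iff_fst_snd: "(S, T, f) \<in> Arr RC \<longleftrightarrow>
    S \<in> Obj RC \<and> T \<in> Obj RC \<and> center_morphism M R (fst S) (snd S) (fst T) (snd T) f"
  using RC_arr_iff[of "fst S" "snd S" "fst T" "snd T" f] by simp

lemma RC_arrE:
  assumes "f \<in> Arr RC"
  obtains V c W d g where "f = ((V, c), (W, d), g)" "(V, c) \<in> Obj RC" "(W, d) \<in> Obj RC"
    "center_morphism M R V c W d g"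
  using assms by (cases f) (auto simp: RC_arr_iff)

lemma RC_category: "category RC"
  by (rule category_cong[OF mixed_center_setting.Z_category[OF self_setting]])
    (simp_all add: relative_center_def category.defs monoidal.defs)

lemma RC_isos:
  assumes "(S, T, f) \<in> Arr RC" "f \<in> isos M"
  shows "(S, T, f) \<in> isos RC"
proof -
  have "isos RC = isos (mixed_center M B P \<tau> M F idM idM)"
    by (rule isos_cong) (simp_all add: relative_center_def category.defs monoidal.defs)
  then show ?thesis
    using mixed_center_setting.Z_isos(1)[OF self_setting] assms
    by (simp add: relative_center_simps(2))
qed

lemma center_tensor_in:
  assumes "(V, c) \<in> Obj RC" "(W, d) \<in> Obj RC"
  shows "center_tensor M (V, c) (W, d) \<in> Obj RC"
proof -
  interpret half_braiding_pair M V c W d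
    using assms by (simp add: half_braiding_pair_def RC_obj_iff)
  have "admissible B P \<tau> M F idM idM (fobj idM V \<otimes>\<^bsub>M\<^esub> W) (snd (center_tensor M (V, c) (W, d)))"
  proof (rule mixed_center_setting.admissible_tensor[OF self_setting])
    show "half_braiding M (regular M) V c" "half_braiding M (twisted M idM idM) W d"
      "admissible B P \<tau> M F idM idM V c" "admissible B P \<tau> M F idM idM W d"
      using assms by (simp_all add: RC_obj_iff half_braiding_regular_iff M.monoidal_category_axioms)
  qed simp
  then show ?thesis
    using center_tensor_half_braiding
    by (subst center_tensor_eq) (simp add: RC_obj_iff)
qed

lemma unit_in: "tunit RC \<in> Obj RC"
proof -
  have "half_braiding M R (tunit M) (\<lambda>X\<in>Obj M. ident M X)"
    by (intro half_braiding.intro half_braiding_axioms.intro M.regular_bimodule) auto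
  moreover have "admissible B P \<tau> M F idM idM (tunit M) (\<lambda>X\<in>Obj M. ident M X)"
  proof -
    have "\<tau> Q \<in> iso B (fobj F (fobj P Q)) Q" if "Q \<in> Obj B" for Q
      using \<tau>.component_iso[OF that] by simp
    then show ?thesis by (auto simp: admissible_def isos_arr)
  qed
  ultimately show ?thesis
    by (simp add: RC_obj_iff)
qed

lemma RC_monoidal: "monoidal_category RC"
proof -
  interpret RC: category RC by (rule RC_category)
  have hb: "half_braiding M R V c" "V \<in> Obj M" "c \<in> extensional (Obj M)" if "(V, c) \<in> Obj RC" for V c
    using that half_braiding.Z_obj[of M R V c] by (auto simp: RC_obj_iff)
  have unit: "center_tensor M (tunit RC) (V, c) = (V, c)" "center_tensor M (V, c) (tunit RC) = (V, c)"
    if o: "(V, c) \<in> Obj RC" for V c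
  proof -
    interpret half_braiding M R V c using hb[OF o] by simp
    note [simp] = c_isos[unfolded regular_simps regular_isos]
    show "center_tensor M (tunit RC) (V, c) = (V, c)" "center_tensor M (V, c) (tunit RC) = (V, c)"
      using hb[OF o] by (auto simp: center_tensor_def intro!: extensionalityI[of _ "Obj M"])
  qed
  have pair: "half_braiding_pair M V c W d" if "(V, c) \<in> Obj RC" "(W, d) \<in> Obj RC" for V c W d
    using that by (simp add: half_braiding_pair_def hb)
  have in_tensor: "(V \<otimes>\<^bsub>M\<^esub> W, snd (center_tensor M (V, c) (W, d))) \<in> Obj RC"
    if "(V, c) \<in> Obj RC" "(W, d) \<in> Obj RC" for V c W d
    using center_tensor_in[OF that] by (metis center_tensor_simps(1) prod.collapse)
  have tensor_arr: "(center_tensor M S T, center_tensor M S' T', f) \<in> Arr RC \<longleftrightarrow>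
      center_morphism M R (fst S \<otimes>\<^bsub>M\<^esub> fst T) (snd (center_tensor M S T))
        (fst S' \<otimes>\<^bsub>M\<^esub> fst T') (snd (center_tensor M S' T')) f"
    if "S \<in> Obj RC" "T \<in> Obj RC" "S' \<in> Obj RC" "T' \<in> Obj RC" for S T S' T' f
    using center_tensor_in[of "fst S" "snd S" "fst T" "snd T"]
      center_tensor_in[of "fst S'" "snd S'" "fst T'" "snd T'"] that
      RC_arr_iff_fst_snd[of "center_tensor M S T" "center_tensor M S' T'" f]
    by simp
  have obj: "fst S \<in> Obj M" if "S \<in> Obj RC" for S
    using that hb(2)[of "fst S" "snd S"] by simp
  have tens: "center_tensor M S T \<in> Obj RC" if "S \<in> Obj RC" "T \<in> Obj RC" for S T
    using center_tensor_in[of "fst S" "snd S" "fst T" "snd T"] that by simp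
  have assoc_arr: "assoc RC S T U \<in> isos RC" "assoc RC S T U \<in> Arr RC"
    if "S \<in> Obj RC" "T \<in> Obj RC" "U \<in> Obj RC" for S T U
  proof -
    obtain V c W d X e where d: "S = (V, c)" "T = (W, d)" "U = (X, e)" by (metis prod.exhaust)
    show "assoc RC S T U \<in> Arr RC"
      using center_morphism_assoc[OF pair pair, of V c W d X e] that
      by (simp add: d tensor_arr tens)
    then show "assoc RC S T U \<in> isos RC"
      using RC_isos obj that by simp
  qed
  show ?thesis
  proof (intro monoidal_category.intro monoidal_category_axioms.intro RC_category unit_in)
    fix f g S S' T T'
    assume "f \<in> hom RC S S'" "g \<in> hom RC T T'"
    then obtain V c V' c' f0 W d W' d' g0 where
      d: "f = ((V, c), (V', c'), f0)" "g = ((W, d), (W', d'), g0)"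
        "S = (V, c)" "S' = (V', c')" "T = (W, d)" "T' = (W', d')" and
      o: "(V, c) \<in> Obj RC" "(V', c') \<in> Obj RC" "(W, d) \<in> Obj RC" "(W', d') \<in> Obj RC" and
      m: "center_morphism M R V c V' c' f0" "center_morphism M R W d W' d' g0"
      by (auto elim!: RC_arrE)
    show "f \<boxtimes>\<^bsub>RC\<^esub> g \<in> hom RC (S \<otimes>\<^bsub>RC\<^esub> T) (S' \<otimes>\<^bsub>RC\<^esub> T')"
      using half_braiding_pair.center_morphism_tensor[OF pair[OF o(1,3)] pair[OF o(2,4)] m] o
      by (simp add: d tensor_arr)
  next
    fix S T assume "S \<in> Obj RC" "T \<in> Obj RC"
    then show "ident RC S \<boxtimes>\<^bsub>RC\<^esub> ident RC T = ident RC (S \<otimes>\<^bsub>RC\<^esub> T)" "S \<otimes>\<^bsub>RC\<^esub> T \<in> Obj RC"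
      by (simp_all add: obj tens)
  next
    fix f f' g g' X X' X'' Y Y' Y''
    assume "f \<in> hom RC X X'" "f' \<in> hom RC X' X''" "g \<in> hom RC Y Y'" "g' \<in> hom RC Y' Y''"
    then show "(f' \<cdot>\<^bsub>RC\<^esub> f) \<boxtimes>\<^bsub>RC\<^esub> (g' \<cdot>\<^bsub>RC\<^esub> g) = (f' \<boxtimes>\<^bsub>RC\<^esub> g') \<cdot>\<^bsub>RC\<^esub> (f \<boxtimes>\<^bsub>RC\<^esub> g)"
      by (auto elim!: RC_arrE simp: center_morphism_def M.interchange)
  next
    fix S assume "S \<in> Obj RC"
    then show "tunit RC \<otimes>\<^bsub>RC\<^esub> S = S" "S \<otimes>\<^bsub>RC\<^esub> tunit RC = S"
      using unit[of "fst S" "snd S"] by simp_all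
  next
    fix f assume "f \<in> Arr RC"
    then show "ident RC (tunit RC) \<boxtimes>\<^bsub>RC\<^esub> f = f" "f \<boxtimes>\<^bsub>RC\<^esub> ident RC (tunit RC) = f"
      using unit by (auto elim!: RC_arrE simp: center_morphism_def)
  next
    fix S T U assume "S \<in> Obj RC" "T \<in> Obj RC" "U \<in> Obj RC"
    then show "assoc RC S T U \<in> iso RC ((S \<otimes>\<^bsub>RC\<^esub> T) \<otimes>\<^bsub>RC\<^esub> U) (S \<otimes>\<^bsub>RC\<^esub> (T \<otimes>\<^bsub>RC\<^esub> U))"
      using assoc_arr[of S T U] by simp
  next
    fix f g h S S' T T' U U'
    assume "f \<in> hom RC S S'" "g \<in> hom RC T T'" "h \<in> hom RC U U'"
    then obtain f0 g0 h0 where d: "f = (S, S', f0)" "g = (T, T', g0)" "h = (U, U', h0)" and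
      m: "f0 \<in> hom M (fst S) (fst S')" "g0 \<in> hom M (fst T) (fst T')" "h0 \<in> hom M (fst U) (fst U')"
      by (auto elim!: RC_arrE simp: center_morphism_def)
    show "assoc RC S' T' U' \<cdot>\<^bsub>RC\<^esub> ((f \<boxtimes>\<^bsub>RC\<^esub> g) \<boxtimes>\<^bsub>RC\<^esub> h) =
        (f \<boxtimes>\<^bsub>RC\<^esub> (g \<boxtimes>\<^bsub>RC\<^esub> h)) \<cdot>\<^bsub>RC\<^esub> assoc RC S T U"
      using M.assoc_natural[OF m] by (simp add: d)
  next
    fix S T U W assume "S \<in> Obj RC" "T \<in> Obj RC" "U \<in> Obj RC" "W \<in> Obj RC"
    then show "(ident RC S \<boxtimes>\<^bsub>RC\<^esub> assoc RC T U W) \<cdot>\<^bsub>RC\<^esub> assoc RC S (T \<otimes>\<^bsub>RC\<^esub> U) W \<cdot>\<^bsub>RC\<^esub>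
        (assoc RC S T U \<boxtimes>\<^bsub>RC\<^esub> ident RC W) =
      assoc RC S T (U \<otimes>\<^bsub>RC\<^esub> W) \<cdot>\<^bsub>RC\<^esub> assoc RC (S \<otimes>\<^bsub>RC\<^esub> T) U W"
      using M.pentagon[of "fst S" "fst T" "fst U" "fst W"] by (simp add: obj)
  next
    fix S T assume o: "S \<in> Obj RC" "T \<in> Obj RC"
    have "center_tensor M (tunit RC) S = S" "center_tensor M S (tunit RC) = S"
      if "S \<in> Obj RC" for S
      using unit[of "fst S" "snd S"] that by simp_all
    note u = this[OF o(1)] this[OF o(2)] this[OF tens[OF o]]
    show "assoc RC (tunit RC) S T = ident RC (S \<otimes>\<^bsub>RC\<^esub> T) \<and>
      assoc RC S (tunit RC) T = ident RC (S \<otimes>\<^bsub>RC\<^esub> T) \<and> assoc RC S T (tunit RC) = ident RC (S \<otimes>\<^bsub>RC\<^esub> T)"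
      using u o by (simp add: obj)
  qed
qed

end

section \<open>The action by composition\<close>

lemma composition_action_simps [simp]:
  "S \<triangleright>\<^bsub>composition_action M V\<^esub> H = bfunctor_comp M (regular M) V H (Phi M S)"
  "(S, T, f) \<unrhd>\<^bsub>composition_action M V\<^esub> (H, K, \<theta>) =
    (bfunctor_comp M (regular M) V H (Phi M S), bfunctor_comp M (regular M) V K (Phi M T),
      \<lambda>X\<in>Obj M. \<theta> (X \<otimes>\<^bsub>M\<^esub> fst T) \<cdot>\<^bsub>V\<^esub> farr H (ident M X \<boxtimes>\<^bsub>M\<^esub> f))"
  "lassoc (composition_action M V) S T H =
    (bfunctor_comp M (regular M) V (bfunctor_comp M (regular M) V H (Phi M T)) (Phi M S),
      bfunctor_comp M (regular M) V H (Phi M (center_tensor M S T)),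
      \<lambda>X\<in>Obj M. farr H (assoc M X (fst S) (fst T)))"
  by (simp_all add: composition_action_def Let_def bfunctor_comp_regular)

locale composition_setting = relative_center_setting M B F P \<tau> + V: bimodule_category M V
  for M :: "('o, 'a) monoidal"
    and B :: "('p, 'b) braided"
    and F :: "('o, 'a, 'p, 'b) mfunctor"
    and P :: "('p, 'b, 'o, 'a) mfunctor"
    and \<tau> :: "'p \<Rightarrow> 'b"
    and V :: "('o, 'a, 'v, 'w) bimodule"
begin

abbreviation BM where "BM \<equiv> BiMod M R V"
abbreviation A where "A \<equiv> composition_action M V"

lemma bfunctors_regular: "H \<in> bfunctors M R V \<Longrightarrow> regular_functor M V H"
  by (simp add: bfunctors_def regular_functor_def V.bimodule_category_axioms)

lemma Phi_RC: "S \<in> Obj RC \<Longrightarrow> bimodule_functor M R R (Phi M S)"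
  by (cases S) (simp add: RC_obj_iff Phi_bimodule_functor)

lemma Phi_simps_RC [simp]:
  "X \<in> Obj M \<Longrightarrow> fobj (Phi M S) X = X \<otimes>\<^bsub>M\<^esub> fst S"
  "f \<in> Arr M \<Longrightarrow> farr (Phi M S) f = f \<boxtimes>\<^bsub>M\<^esub> ident M (fst S)"
  by (cases S; simp)+

lemma RC_obj [simp]: "S \<in> Obj RC \<Longrightarrow> fst S \<in> Obj M"
  by (cases S) (auto simp: RC_obj_iff dest: half_braiding.Z_obj)

lemma act_in: "\<lbrakk>S \<in> Obj RC; H \<in> bfunctors M R V\<rbrakk> \<Longrightarrow> bfunctor_comp M R V H (Phi M S) \<in> bfunctors M R V"
  using bfunctor_pair.bimodule_functor_comp[of M R R V "Phi M S" H] Phi_RC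
  by (simp add: bfunctors_def bfunctor_comp_extensional bfunctor_pair_def)

lemma act_unit:
  assumes "H \<in> bfunctors M R V"
  shows "bfunctor_comp M R V H (Phi M (tunit RC)) = H"
proof -
  interpret regular_functor M V H using assms by (rule bfunctors_regular)
  have "extensional_bfunctor M R H" using assms by (simp add: bfunctors_def)
  then have e: "fobj H \<in> extensional (Obj M)" "farr H \<in> extensional (Arr M)"
    "lam H \<in> extensional (Obj M \<times> Obj M)" "rho H \<in> extensional (Obj M \<times> Obj M)"
    by (simp_all add: extensional_bfunctor_def)
  let ?K = "bfunctor_comp M R V H (Phi M (tunit RC))"
  have k: "fobj ?K \<in> extensional (Obj M)" "farr ?K \<in> extensional (Arr M)"
    "lam ?K \<in> extensional (Obj M \<times> Obj M)" "rho ?K \<in> extensional (Obj M \<times> Obj M)"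
    using bfunctor_comp_extensional[of M R V H "Phi M (tunit RC)"]
    by (simp_all add: extensional_bfunctor_def)
  have "fobj ?K = fobj H" by (rule extensionalityI[OF k(1) e(1)]) simp
  moreover have "farr ?K = farr H" by (rule extensionalityI[OF k(2) e(2)]) simp
  moreover have "lam ?K = lam H" by (rule extensionalityI[OF k(3) e(3)]) auto
  moreover have "rho ?K = rho H" by (rule extensionalityI[OF k(4) e(4)]) auto
  ultimately show ?thesis by (intro bfunctor.equality) simp_all
qed

lemma act_act:
  assumes "S \<in> Obj RC" "T \<in> Obj RC" "H \<in> bfunctors M R V"
  shows "bfunctor_comp M R V (bfunctor_comp M R V H (Phi M T)) (Phi M S) =
    bfunctor_comp M R V H (bfunctor_comp M R R (Phi M T) (Phi M S))"
  using assms bfunctor_comp_assoc[OF Phi_RC Phi_RC, of S T V H] by (simp add: bfunctors_def)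

lemma act_arr_in:
  assumes f: "(S, T, f) \<in> Arr RC" and \<theta>: "(H, K, \<theta>) \<in> Arr BM"
  shows "(S, T, f) \<unrhd>\<^bsub>A\<^esub> (H, K, \<theta>) \<in> Arr BM"
proof -
  have o: "S \<in> Obj RC" "T \<in> Obj RC" and [simp]: "f \<in> Arr M" "Dom M f = fst S" "Cod M f = fst T"
    using f by (auto simp: RC_arr_iff_fst_snd center_morphism_def)
  have "btransformation M R R (Phi M (fst S, snd S)) (Phi M (fst T, snd T)) (\<lambda>X\<in>Obj M. ident M X \<boxtimes>\<^bsub>M\<^esub> f)"
    using f by (intro Phi_btransformation)
      (auto simp: RC_arr_iff_fst_snd RC_obj_iff[of "fst S" "snd S", simplified]
        RC_obj_iff[of "fst T" "snd T", simplified])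
  then interpret btransformation_pair M R R V "Phi M S" "Phi M T" "\<lambda>X\<in>Obj M. ident M X \<boxtimes>\<^bsub>M\<^esub> f" H K \<theta>
    using \<theta> by (simp add: btransformation_pair_def)
  have "(\<lambda>X\<in>Obj M. \<theta> (fobj (Phi M T) X) \<cdot>\<^bsub>V\<^esub> farr H ((\<lambda>X\<in>Obj M. ident M X \<boxtimes>\<^bsub>M\<^esub> f) X)) =
      (\<lambda>X\<in>Obj M. \<theta> (X \<otimes>\<^bsub>M\<^esub> fst T) \<cdot>\<^bsub>V\<^esub> farr H (ident M X \<boxtimes>\<^bsub>M\<^esub> f))"
    by (intro restrict_ext) simp
  then show ?thesis
    using horizontal_composite \<theta> o act_in by simp
qed

text \<open>
  The associativity isomorphism of the action is \<open>H\<close> whiskered with the comparison between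
  composites of \<open>\<Phi>\<close> and \<open>\<Phi>\<close> of a tensor product.
\<close>

lemma act_assoc_in:
  assumes o: "S \<in> Obj RC" "T \<in> Obj RC" and H: "H \<in> bfunctors M R V"
  shows "lassoc A S T H \<in> Arr BM" "lassoc A S T H \<in> isos BM"
proof -
  interpret H: regular_functor M V H using H by (rule bfunctors_regular)
  obtain V1 c W d where d: "S = (V1, c)" "T = (W, d)" by (metis prod.exhaust)
  interpret half_braiding_pair M V1 c W d
    using o by (simp add: half_braiding_pair_def RC_obj_iff d)
  interpret btransformation_pair M R R V PhiPhi "Phi M (center_tensor M S T)"
      "\<lambda>X\<in>Obj M. assoc M X V1 W" H H "\<lambda>S\<in>Obj R. ident V (fobj H S)"
    unfolding d
    by (intro btransformation_pair.intro Phi_center_tensor_btransformation H.F.ident_btransformation)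
  have "(\<lambda>X\<in>Obj M. (\<lambda>S\<in>Obj R. ident V (fobj H S)) (fobj (Phi M (center_tensor M S T)) X) \<cdot>\<^bsub>V\<^esub>
        farr H ((\<lambda>X\<in>Obj M. assoc M X V1 W) X)) = (\<lambda>X\<in>Obj M. farr H (assoc M X V1 W))"
    using o by (intro restrict_ext) (simp add: d)
  then show *: "lassoc A S T H \<in> Arr BM"
    using horizontal_composite act_in[OF center_tensor_in[of V1 c W d] H] o H
      act_in[OF o(1) act_in[OF o(2) H]] act_act[OF o H]
    by (simp add: d)
  show "lassoc A S T H \<in> isos BM"
    using BiMod_isos(1)[OF *[unfolded composition_action_simps]] o by simp
qed

text \<open>
  Two transformations are equal when their components are, so the axioms hold pointwise: they follow
  from naturality of \<open>\<theta>\<close> and from \<open>H\<close> applied to naturality of the associator and to the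
  pentagon of \<open>M\<close>. Strict units use that bimodule functors are extensional.
\<close>

lemma composition_module: "left_module_category RC BM A"
proof (intro left_module_category.intro left_module_category_axioms.intro RC_monoidal BiMod_category)
  fix S H assume "S \<in> Obj RC" "H \<in> Obj BM"
  then show "S \<triangleright>\<^bsub>A\<^esub> H \<in> Obj BM" by (simp add: act_in)
next
  fix f h S S' H H' assume "f \<in> hom RC S S'" "h \<in> hom BM H H'"
  then obtain f0 \<theta> where d: "f = (S, S', f0)" "h = (H, H', \<theta>)" and "f \<in> Arr RC" "h \<in> Arr BM"
    by (cases f; cases h) auto
  then show "f \<unrhd>\<^bsub>A\<^esub> h \<in> hom BM (S \<triangleright>\<^bsub>A\<^esub> H) (S' \<triangleright>\<^bsub>A\<^esub> H')"
    using act_arr_in[of S S' f0 H H' \<theta>] by simp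
next
  fix S H assume o: "S \<in> Obj RC" "H \<in> Obj BM"
  interpret H: regular_functor M V H using o(2) by (simp add: bfunctors_regular)
  show "ident RC S \<unrhd>\<^bsub>A\<^esub> ident BM H = ident BM (S \<triangleright>\<^bsub>A\<^esub> H)"
    using o by (auto intro!: restrict_ext)
next
  fix f f' h h' S S' S'' H H' H''
  assume "f \<in> hom RC S S'" "f' \<in> hom RC S' S''" "h \<in> hom BM H H'" "h' \<in> hom BM H' H''"
  then obtain f0 f1 \<theta> \<theta>' where d: "f = (S, S', f0)" "f' = (S', S'', f1)" "h = (H, H', \<theta>)" "h' = (H', H'', \<theta>')"
    and a: "f \<in> Arr RC" "f' \<in> Arr RC" "h \<in> Arr BM" "h' \<in> Arr BM"
    by (cases f; cases f'; cases h; cases h') auto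
  have [simp]: "f0 \<in> Arr M" "Dom M f0 = fst S" "Cod M f0 = fst S'"
    "f1 \<in> Arr M" "Dom M f1 = fst S'" "Cod M f1 = fst S''" "S \<in> Obj RC" "S' \<in> Obj RC" "S'' \<in> Obj RC"
    using a by (auto simp: d RC_arr_iff_fst_snd center_morphism_def)
  interpret \<theta>: btransformation M R V H H' \<theta> using a by (simp add: d)
  interpret \<theta>': btransformation M R V H' H'' \<theta>' using a by (simp add: d)
  interpret H: regular_functor M V H using a by (simp add: d bfunctors_regular)
  interpret H': regular_functor M V H' using a by (simp add: d bfunctors_regular)
  have "(\<theta>' (X \<otimes>\<^bsub>M\<^esub> fst S'') \<cdot>\<^bsub>V\<^esub> \<theta> (X \<otimes>\<^bsub>M\<^esub> fst S'')) \<cdot>\<^bsub>V\<^esub> farr H (ident M X \<boxtimes>\<^bsub>M\<^esub> (f1 \<cdot>\<^bsub>M\<^esub> f0)) =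
      (\<theta>' (X \<otimes>\<^bsub>M\<^esub> fst S'') \<cdot>\<^bsub>V\<^esub> farr H' (ident M X \<boxtimes>\<^bsub>M\<^esub> f1)) \<cdot>\<^bsub>V\<^esub> \<theta> (X \<otimes>\<^bsub>M\<^esub> fst S') \<cdot>\<^bsub>V\<^esub>
        farr H (ident M X \<boxtimes>\<^bsub>M\<^esub> f0)" if [simp]: "X \<in> Obj M" for X
  proof -
    have "\<theta> (X \<otimes>\<^bsub>M\<^esub> fst S'') \<cdot>\<^bsub>V\<^esub> farr H (ident M X \<boxtimes>\<^bsub>M\<^esub> f1) =
        farr H' (ident M X \<boxtimes>\<^bsub>M\<^esub> f1) \<cdot>\<^bsub>V\<^esub> \<theta> (X \<otimes>\<^bsub>M\<^esub> fst S')"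
      by (rule \<theta>.naturality) simp
    from V.L.V.front2[OF this] show ?thesis by (simp add: M.tarr_dist_left)
  qed
  then show "(f' \<cdot>\<^bsub>RC\<^esub> f) \<unrhd>\<^bsub>A\<^esub> (h' \<cdot>\<^bsub>BM\<^esub> h) = (f' \<unrhd>\<^bsub>A\<^esub> h') \<cdot>\<^bsub>BM\<^esub> (f \<unrhd>\<^bsub>A\<^esub> h)"
    by (auto simp: d intro!: restrict_ext)
next
  fix H assume "H \<in> Obj BM"
  then show "tunit RC \<triangleright>\<^bsub>A\<^esub> H = H" using act_unit by simp
next
  fix h assume "h \<in> Arr BM"
  then obtain H K \<theta> where d: "h = (H, K, \<theta>)" and o: "H \<in> bfunctors M R V" "K \<in> bfunctors M R V"
    and "btransformation M R V H K \<theta>" and e: "\<theta> \<in> extensional (Obj M)"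
    by (auto elim!: BiMod_arrE)
  then interpret \<theta>: btransformation M R V H K \<theta> by simp
  interpret H: regular_functor M V H using o by (simp add: bfunctors_regular)
  have "(\<lambda>X\<in>Obj M. \<theta> (X \<otimes>\<^bsub>M\<^esub> tunit M) \<cdot>\<^bsub>V\<^esub> farr H (ident M X \<boxtimes>\<^bsub>M\<^esub> ident M (tunit M))) = \<theta>"
    using e by (intro extensionalityI[of _ "Obj M"]) auto
  then show "ident RC (tunit RC) \<unrhd>\<^bsub>A\<^esub> h = h"
    using act_unit o by (simp add: d)
next
  fix S T H assume "S \<in> Obj RC" "T \<in> Obj RC" "H \<in> Obj BM"
  then show "lassoc A S T H \<in> iso BM (S \<triangleright>\<^bsub>A\<^esub> (T \<triangleright>\<^bsub>A\<^esub> H)) ((S \<otimes>\<^bsub>RC\<^esub> T) \<triangleright>\<^bsub>A\<^esub> H)"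
    using act_assoc_in(2)[of S T H] by simp
next
  fix f S S' g T T' h H H'
  assume "f \<in> hom RC S S'" "g \<in> hom RC T T'" "h \<in> hom BM H H'"
  then obtain f0 g0 \<theta> where d: "f = (S, S', f0)" "g = (T, T', g0)" "h = (H, H', \<theta>)"
    and a: "f \<in> Arr RC" "g \<in> Arr RC" "h \<in> Arr BM"
    by (cases f; cases g; cases h) auto
  have [simp]: "f0 \<in> Arr M" "Dom M f0 = fst S" "Cod M f0 = fst S'"
    "g0 \<in> Arr M" "Dom M g0 = fst T" "Cod M g0 = fst T'"
    "S \<in> Obj RC" "S' \<in> Obj RC" "T \<in> Obj RC" "T' \<in> Obj RC"
    using a by (auto simp: d RC_arr_iff_fst_snd center_morphism_def)
  interpret \<theta>: btransformation M R V H H' \<theta> using a by (simp add: d)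
  interpret H: regular_functor M V H using a by (simp add: d bfunctors_regular)
  interpret H': regular_functor M V H' using a by (simp add: d bfunctors_regular)
  have "farr H' (assoc M X (fst S') (fst T')) \<cdot>\<^bsub>V\<^esub>
      (\<theta> ((X \<otimes>\<^bsub>M\<^esub> fst S') \<otimes>\<^bsub>M\<^esub> fst T') \<cdot>\<^bsub>V\<^esub> farr H (ident M (X \<otimes>\<^bsub>M\<^esub> fst S') \<boxtimes>\<^bsub>M\<^esub> g0)) \<cdot>\<^bsub>V\<^esub>
      farr H ((ident M X \<boxtimes>\<^bsub>M\<^esub> f0) \<boxtimes>\<^bsub>M\<^esub> ident M (fst T)) =
    (\<theta> (X \<otimes>\<^bsub>M\<^esub> (fst S' \<otimes>\<^bsub>M\<^esub> fst T')) \<cdot>\<^bsub>V\<^esub> farr H (ident M X \<boxtimes>\<^bsub>M\<^esub> (f0 \<boxtimes>\<^bsub>M\<^esub> g0))) \<cdot>\<^bsub>V\<^esub>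
      farr H (assoc M X (fst S) (fst T))" if [simp]: "X \<in> Obj M" for X
  proof -
    have n: "\<theta> (X \<otimes>\<^bsub>M\<^esub> (fst S' \<otimes>\<^bsub>M\<^esub> fst T')) \<cdot>\<^bsub>V\<^esub> farr H (assoc M X (fst S') (fst T')) =
        farr H' (assoc M X (fst S') (fst T')) \<cdot>\<^bsub>V\<^esub> \<theta> ((X \<otimes>\<^bsub>M\<^esub> fst S') \<otimes>\<^bsub>M\<^esub> fst T')"
      by (rule \<theta>.naturality) simp
    have "farr H (assoc M X (fst S') (fst T')) \<cdot>\<^bsub>V\<^esub> farr H ((ident M X \<boxtimes>\<^bsub>M\<^esub> f0) \<boxtimes>\<^bsub>M\<^esub> g0) =
        farr H (ident M X \<boxtimes>\<^bsub>M\<^esub> (f0 \<boxtimes>\<^bsub>M\<^esub> g0)) \<cdot>\<^bsub>V\<^esub> farr H (assoc M X (fst S) (fst T))"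
      using arg_cong[OF M.assoc_square[of "ident M X" f0 g0], of "farr H"] by simp
    moreover have "(ident M (X \<otimes>\<^bsub>M\<^esub> fst S') \<boxtimes>\<^bsub>M\<^esub> g0) \<cdot>\<^bsub>M\<^esub> ((ident M X \<boxtimes>\<^bsub>M\<^esub> f0) \<boxtimes>\<^bsub>M\<^esub> ident M (fst T)) =
        (ident M X \<boxtimes>\<^bsub>M\<^esub> f0) \<boxtimes>\<^bsub>M\<^esub> g0"
      by (simp add: M.interchange)
    from arg_cong[OF this, of "farr H"]
    have "farr H (ident M (X \<otimes>\<^bsub>M\<^esub> fst S') \<boxtimes>\<^bsub>M\<^esub> g0) \<cdot>\<^bsub>V\<^esub> farr H ((ident M X \<boxtimes>\<^bsub>M\<^esub> f0) \<boxtimes>\<^bsub>M\<^esub> ident M (fst T)) =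
        farr H ((ident M X \<boxtimes>\<^bsub>M\<^esub> f0) \<boxtimes>\<^bsub>M\<^esub> g0)"
      by simp
    ultimately show ?thesis using V.L.V.front2[OF n[symmetric]] by simp
  qed
  then show "lassoc A S' T' H' \<cdot>\<^bsub>BM\<^esub> (f \<unrhd>\<^bsub>A\<^esub> (g \<unrhd>\<^bsub>A\<^esub> h)) = ((f \<boxtimes>\<^bsub>RC\<^esub> g) \<unrhd>\<^bsub>A\<^esub> h) \<cdot>\<^bsub>BM\<^esub> lassoc A S T H"
    by (auto simp: d intro!: restrict_ext)
next
  fix S T U H assume o [simp]: "S \<in> Obj RC" "T \<in> Obj RC" "U \<in> Obj RC" and "H \<in> Obj BM"
  then interpret H: regular_functor M V H by (simp add: bfunctors_regular)
  have "farr H (assoc M X (fst S) (fst T \<otimes>\<^bsub>M\<^esub> fst U)) \<cdot>\<^bsub>V\<^esub> farr H (assoc M (X \<otimes>\<^bsub>M\<^esub> fst S) (fst T) (fst U)) =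
      farr H (ident M X \<boxtimes>\<^bsub>M\<^esub> assoc M (fst S) (fst T) (fst U)) \<cdot>\<^bsub>V\<^esub>
      farr H (assoc M X (fst S \<otimes>\<^bsub>M\<^esub> fst T) (fst U)) \<cdot>\<^bsub>V\<^esub>
      farr H (assoc M X (fst S) (fst T) \<boxtimes>\<^bsub>M\<^esub> ident M (fst U))" if [simp]: "X \<in> Obj M" for X
    using arg_cong[OF M.pentagon[of X "fst S" "fst T" "fst U"], of "farr H"] by simp
  then show "lassoc A S (T \<otimes>\<^bsub>RC\<^esub> U) H \<cdot>\<^bsub>BM\<^esub> (ident RC S \<unrhd>\<^bsub>A\<^esub> lassoc A T U H) =
      (assoc RC S T U \<unrhd>\<^bsub>A\<^esub> ident BM H) \<cdot>\<^bsub>BM\<^esub> lassoc A (S \<otimes>\<^bsub>RC\<^esub> T) U H \<cdot>\<^bsub>BM\<^esub> lassoc A S T (U \<triangleright>\<^bsub>A\<^esub> H)"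
    by (auto intro!: restrict_ext)
next
  fix S H assume o [simp]: "S \<in> Obj RC" and h: "H \<in> Obj BM"
  then interpret H: regular_functor M V H by (simp add: bfunctors_regular)
  interpret RC: monoidal_category RC by (rule RC_monoidal)
  show "lassoc A (tunit RC) S H = ident BM (S \<triangleright>\<^bsub>A\<^esub> H) \<and> lassoc A S (tunit RC) H = ident BM (S \<triangleright>\<^bsub>A\<^esub> H)"
    using RC.tunit_obj_left[OF o] RC.tunit_obj_right[OF o] act_unit[OF act_in[OF o]] act_unit[of H] h
    by (auto intro!: restrict_ext)
qed

end

section \<open>Full subcategories and transport of module structures\<close>

lemma full_subcategory_simps [simp]:
  "Obj (full_subcategory C D) = Obj C \<inter> D"
  "f \<in> Arr (full_subcategory C D) \<longleftrightarrow> f \<in> Arr C \<and> Dom C f \<in> D \<and> Cod C f \<in> D"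
  "Dom (full_subcategory C D) = Dom C" "Cod (full_subcategory C D) = Cod C"
  "ident (full_subcategory C D) = ident C" "Comp (full_subcategory C D) = Comp C"
  by (simp_all add: full_subcategory_def)

lemma (in category) full_subcategory_category: "category (full_subcategory C D)"
  by unfold_locales auto

lemma (in category) full_subcategory_isos:
  "f \<in> isos (full_subcategory C D) \<longleftrightarrow> f \<in> isos C \<and> Dom C f \<in> D \<and> Cod C f \<in> D"
proof
  assume "f \<in> isos (full_subcategory C D)"
  then show "f \<in> isos C \<and> Dom C f \<in> D \<and> Cod C f \<in> D"
    by (auto simp: isos_def inverse_arrows_def)
next
  assume f: "f \<in> isos C \<and> Dom C f \<in> D \<and> Cod C f \<in> D"
  then have "inverse_arrows (full_subcategory C D) f (inv_arr C f)"
    by (simp add: inverse_arrows_def isos_arr)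
  then show "f \<in> isos (full_subcategory C D)" using f by (auto simp: isos_def)
qed

lemma (in left_module_category) full_subcategory_module:
  assumes "\<And>X S. \<lbrakk>X \<in> Obj M; S \<in> Obj V; S \<in> D\<rbrakk> \<Longrightarrow> X \<triangleright> S \<in> D"
  shows "left_module_category M (full_subcategory V D) A"
  using assms
  by (intro left_module_category.intro left_module_category_axioms.intro M.monoidal_category_axioms
      V.full_subcategory_category)
    (auto simp: V.full_subcategory_isos linterchange lassoc_square lassoc_pentagon)

lemma cfunctor_id_comp_simps [simp]:
  "fobj cfunctor_id X = X" "farr cfunctor_id f = f"
  "fobj (cfunctor_comp G H) X = fobj G (fobj H X)" "farr (cfunctor_comp G H) f = farr G (farr H f)"
  by (simp_all add: cfunctor_id_def cfunctor_comp_def)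

text \<open>
  The action \<open>X \<triangleright> T = E (X \<triangleright> K T)\<close> along an equivalence \<open>E\<close> with quasi-inverse \<open>K\<close>. Acting
  twice produces \<open>E (X \<triangleright> K E (Y \<triangleright> K T))\<close>, and the unit \<open>\<eta>\<close> of the equivalence removes \<open>K E\<close>.
\<close>

definition transported_action ::
  "('o, 'a, 'm) monoidal_scheme \<Rightarrow> ('v, 'w, 'n) category_scheme \<Rightarrow> ('o, 'a, 'v, 'w) left_action \<Rightarrow>
    ('v, 'w, 'x, 'y) cfunctor \<Rightarrow> ('x, 'y, 'v, 'w) cfunctor \<Rightarrow> ('v \<Rightarrow> 'w) \<Rightarrow>
    ('o, 'a, 'x, 'y) left_action" where
  "transported_action M V A E K \<eta> =
    \<lparr>lobj = (\<lambda>X T. fobj E (X \<triangleright>\<^bsub>A\<^esub> fobj K T)),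
     larr = (\<lambda>f g. farr E (f \<unrhd>\<^bsub>A\<^esub> farr K g)),
     lassoc = (\<lambda>X Y T. farr E (lassoc A X Y (fobj K T) \<cdot>\<^bsub>V\<^esub>
       (ident M X \<unrhd>\<^bsub>A\<^esub> inv_arr V (\<eta> (Y \<triangleright>\<^bsub>A\<^esub> fobj K T)))))\<rparr>"

lemma transported_action_simps [simp]:
  "X \<triangleright>\<^bsub>transported_action M V A E K \<eta>\<^esub> T = fobj E (X \<triangleright>\<^bsub>A\<^esub> fobj K T)"
  "f \<unrhd>\<^bsub>transported_action M V A E K \<eta>\<^esub> g = farr E (f \<unrhd>\<^bsub>A\<^esub> farr K g)"
  "lassoc (transported_action M V A E K \<eta>) X Y T = farr E (lassoc A X Y (fobj K T) \<cdot>\<^bsub>V\<^esub>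
    (ident M X \<unrhd>\<^bsub>A\<^esub> inv_arr V (\<eta> (Y \<triangleright>\<^bsub>A\<^esub> fobj K T))))"
  by (simp_all add: transported_action_def)

text \<open>
  Module categories here have strict units. The transported action satisfies this because \<open>E K\<close> is
  the identity on the nose and \<open>\<eta>\<close> becomes an identity under \<open>E\<close> and on the image of \<open>K\<close>.
\<close>

locale module_transport = left_module_category M C A + E: cfunctor C D E + K: cfunctor D C K +
  \<eta>: nat_isomorphism C C cfunctor_id "cfunctor_comp K E" \<eta>
  for M :: "('o, 'a, 'm) monoidal_scheme"
    and C :: "('v, 'w, 'n) category_scheme"
    and A :: "('o, 'a, 'v, 'w) left_action"
    and D :: "('x, 'y, 'k) category_scheme"
    and E :: "('v, 'w, 'x, 'y) cfunctor"
    and K :: "('x, 'y, 'v, 'w) cfunctor"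
    and \<eta> :: "'v \<Rightarrow> 'w" +
  assumes EK_obj [simp]: "T \<in> Obj D \<Longrightarrow> fobj E (fobj K T) = T"
    and EK_arr [simp]: "f \<in> Arr D \<Longrightarrow> farr E (farr K f) = f"
    and E_\<eta> [simp]: "S \<in> Obj C \<Longrightarrow> farr E (\<eta> S) = ident D (fobj E S)"
    and \<eta>_K [simp]: "T \<in> Obj D \<Longrightarrow> \<eta> (fobj K T) = ident C (fobj K T)"
begin

abbreviation compC (infixr "\<bullet>" 55) where "g \<bullet> f \<equiv> g \<cdot>\<^bsub>C\<^esub> f"
abbreviation act (infixr "\<rhd>" 70) where "X \<rhd> S \<equiv> X \<triangleright>\<^bsub>A\<^esub> S"
abbreviation acta (infixr "\<succ>" 70) where "f \<succ> h \<equiv> f \<unrhd>\<^bsub>A\<^esub> h"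
abbreviation A' where "A' \<equiv> transported_action M C A E K \<eta>"

lemma \<eta>_isos [simp]:
  "S \<in> Obj C \<Longrightarrow> \<eta> S \<in> isos C" "S \<in> Obj C \<Longrightarrow> \<eta> S \<in> Arr C"
  "S \<in> Obj C \<Longrightarrow> Dom C (\<eta> S) = S" "S \<in> Obj C \<Longrightarrow> Cod C (\<eta> S) = fobj K (fobj E S)"
  using \<eta>.component_iso[of S] by (auto simp: isos_arr)

lemma \<eta>_square: "f \<in> Arr C \<Longrightarrow> \<eta> (Cod C f) \<bullet> f = farr K (farr E f) \<bullet> \<eta> (Dom C f)"
  using \<eta>.naturality[of f "Dom C f" "Cod C f"] by simp

lemma \<eta>_square_inv: "\<lbrakk>f \<in> Arr C; S = Cod C f\<rbrakk> \<Longrightarrow>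
    inv_arr C (\<eta> S) \<bullet> farr K (farr E f) = f \<bullet> inv_arr C (\<eta> (Dom C f))"
  using V.inv_square[OF \<eta>_square[of f]] by simp

lemma dist: "\<lbrakk>X \<in> Obj M; f \<in> Arr C; g \<in> Arr C; Dom C f = Cod C g\<rbrakk> \<Longrightarrow>
    ident M X \<succ> (f \<bullet> g) = (ident M X \<succ> f) \<bullet> (ident M X \<succ> g)"
  by (simp add: linterchange)

lemma lassoc_slide: "\<lbrakk>X \<in> Obj M; Y \<in> Obj M; h \<in> Arr C; S = Cod C h\<rbrakk> \<Longrightarrow>
    lassoc A X Y S \<bullet> (ident M X \<succ> (ident M Y \<succ> h)) =
    (ident M (X \<otimes>\<^bsub>M\<^esub> Y) \<succ> h) \<bullet> lassoc A X Y (Dom C h)"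
  using lassoc_square[of "ident M X" "ident M Y" h] by simp

lemma transported_module: "left_module_category M D A'"
proof (intro left_module_category.intro left_module_category_axioms.intro
    M.monoidal_category_axioms E.D.category_axioms)
  fix f f' h h' X X' X'' S S' S''
  assume "f \<in> hom M X X'" "f' \<in> hom M X' X''" "h \<in> hom D S S'" "h' \<in> hom D S' S''"
  then show "(f' \<cdot>\<^bsub>M\<^esub> f) \<unrhd>\<^bsub>A'\<^esub> (h' \<cdot>\<^bsub>D\<^esub> h) = (f' \<unrhd>\<^bsub>A'\<^esub> h') \<cdot>\<^bsub>D\<^esub> (f \<unrhd>\<^bsub>A'\<^esub> h)"
    by (auto simp: linterchange simp flip: E.farr_comp)
next
  fix f g h X X' Y Y' S S'
  assume "f \<in> hom M X X'" "g \<in> hom M Y Y'" "h \<in> hom D S S'"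
  then have [simp]: "f \<in> Arr M" "g \<in> Arr M" "h \<in> Arr D" and
    d: "X = Dom M f" "X' = Cod M f" "Y = Dom M g" "Y' = Cod M g" "S = Dom D h" "S' = Cod D h"
    by auto
  have "(ident M X' \<succ> inv_arr C (\<eta> (Y' \<rhd> fobj K S'))) \<bullet> (f \<succ> farr K (farr E (g \<succ> farr K h))) =
      (f \<succ> (g \<succ> farr K h)) \<bullet> (ident M X \<succ> inv_arr C (\<eta> (Y \<rhd> fobj K S)))"
    by (simp add: d linterchange \<eta>_square_inv)
  then have "(lassoc A X' Y' (fobj K S') \<bullet> (ident M X' \<succ> inv_arr C (\<eta> (Y' \<rhd> fobj K S')))) \<bullet>
        (f \<succ> farr K (farr E (g \<succ> farr K h))) =
      ((f \<boxtimes>\<^bsub>M\<^esub> g) \<succ> farr K h) \<bullet>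
        (lassoc A X Y (fobj K S) \<bullet> (ident M X \<succ> inv_arr C (\<eta> (Y \<rhd> fobj K S))))"
    using V.front2[OF lassoc_square[of f g "farr K h"]] by (simp add: d)
  from arg_cong[OF this, of "farr E"]
  show "lassoc A' X' Y' S' \<cdot>\<^bsub>D\<^esub> (f \<unrhd>\<^bsub>A'\<^esub> (g \<unrhd>\<^bsub>A'\<^esub> h)) = ((f \<boxtimes>\<^bsub>M\<^esub> g) \<unrhd>\<^bsub>A'\<^esub> h) \<cdot>\<^bsub>D\<^esub> lassoc A' X Y S"
    by (simp add: d)
next
  fix X Y Z S assume [simp]: "X \<in> Obj M" "Y \<in> Obj M" "Z \<in> Obj M" "S \<in> Obj D"
  let ?k = "fobj K S"
  let ?\<iota> = "\<lambda>S. inv_arr C (\<eta> S)"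
  let ?p = "lassoc A Y Z ?k \<bullet> (ident M Y \<succ> ?\<iota> (Z \<rhd> ?k))"
  let ?kk = "fobj K (fobj E (Z \<rhd> ?k))"
  let ?lhs = "(lassoc A X (Y \<otimes>\<^bsub>M\<^esub> Z) ?k \<bullet> (ident M X \<succ> ?\<iota> ((Y \<otimes>\<^bsub>M\<^esub> Z) \<rhd> ?k))) \<bullet>
        (ident M X \<succ> farr K (farr E ?p))"
  have "?lhs = lassoc A X (Y \<otimes>\<^bsub>M\<^esub> Z) ?k \<bullet> (ident M X \<succ> (?p \<bullet> ?\<iota> (Y \<rhd> ?kk)))"
    using \<eta>_square_inv[of ?p "(Y \<otimes>\<^bsub>M\<^esub> Z) \<rhd> ?k"]
    by (simp add: linterchange del: E.farr_comp K.farr_comp)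
  also have "\<dots> = (assoc M X Y Z \<succ> ident C ?k) \<bullet>
      (lassoc A (X \<otimes>\<^bsub>M\<^esub> Y) Z ?k \<bullet> (ident M (X \<otimes>\<^bsub>M\<^esub> Y) \<succ> ?\<iota> (Z \<rhd> ?k))) \<bullet>
      (lassoc A X Y ?kk \<bullet> (ident M X \<succ> ?\<iota> (Y \<rhd> ?kk)))"
    using V.front2[OF lassoc_pentagon[of X Y Z ?k]]
      V.front2[OF lassoc_slide[of X Y "?\<iota> (Z \<rhd> ?k)"]]
    by (simp add: dist)
  finally have e: "?lhs = \<dots>" .
  from arg_cong[OF e, of "farr E"]
  show "lassoc A' X (Y \<otimes>\<^bsub>M\<^esub> Z) S \<cdot>\<^bsub>D\<^esub> (ident M X \<unrhd>\<^bsub>A'\<^esub> lassoc A' Y Z S) =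
      (assoc M X Y Z \<unrhd>\<^bsub>A'\<^esub> ident D S) \<cdot>\<^bsub>D\<^esub> lassoc A' (X \<otimes>\<^bsub>M\<^esub> Y) Z S \<cdot>\<^bsub>D\<^esub> lassoc A' X Y (Z \<triangleright>\<^bsub>A'\<^esub> S)"
    by simp
qed (auto simp: linterchange)

lemma transported_module_functor:
  "left_module_functor M C A D A' E (\<lambda>(X, S). farr E (ident M X \<succ> \<eta> S))"
proof (intro left_module_functor.intro left_module_functor_axioms.intro transported_module
    left_module_category_axioms E.cfunctor_axioms)
  fix f X X' g S S' assume "f \<in> hom M X X'" "g \<in> hom C S S'"
  then have [simp]: "f \<in> Arr M" "g \<in> Arr C" and
    d: "X = Dom M f" "X' = Cod M f" "S = Dom C g" "S' = Cod C g" by auto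
  have "(ident M X' \<succ> \<eta> S') \<bullet> (f \<succ> g) = (f \<succ> farr K (farr E g)) \<bullet> (ident M X \<succ> \<eta> S)"
    by (simp add: d linterchange \<eta>_square)
  from arg_cong[OF this, of "farr E"]
  show "(\<lambda>(X, S). farr E (ident M X \<succ> \<eta> S)) (X', S') \<cdot>\<^bsub>D\<^esub> farr E (f \<succ> g) =
      (f \<unrhd>\<^bsub>A'\<^esub> farr E g) \<cdot>\<^bsub>D\<^esub> (\<lambda>(X, S). farr E (ident M X \<succ> \<eta> S)) (X, S)"
    by (simp add: d)
next
  fix X Y S assume [simp]: "X \<in> Obj M" "Y \<in> Obj M" "S \<in> Obj C"
  let ?k = "fobj K (fobj E S)"
  have n: "inv_arr C (\<eta> (Y \<rhd> ?k)) \<bullet> farr K (farr E (ident M Y \<succ> \<eta> S)) \<bullet> \<eta> (Y \<rhd> S) =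
      ident M Y \<succ> \<eta> S"
    using V.front2[OF \<eta>_square_inv[of "ident M Y \<succ> \<eta> S" "Y \<rhd> ?k"]] by simp
  have "(ident M (X \<otimes>\<^bsub>M\<^esub> Y) \<succ> \<eta> S) \<bullet> lassoc A X Y S =
      lassoc A X Y ?k \<bullet> (ident M X \<succ> (ident M Y \<succ> \<eta> S))"
    by (simp add: lassoc_slide)
  also have "\<dots> = lassoc A X Y ?k \<bullet> (ident M X \<succ> (inv_arr C (\<eta> (Y \<rhd> ?k)) \<bullet>
      farr K (farr E (ident M Y \<succ> \<eta> S)) \<bullet> \<eta> (Y \<rhd> S)))"
    by (simp only: n)
  also have "\<dots> = (lassoc A X Y ?k \<bullet> (ident M X \<succ> inv_arr C (\<eta> (Y \<rhd> ?k)))) \<bullet>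
      (ident M X \<succ> farr K (farr E (ident M Y \<succ> \<eta> S))) \<bullet> (ident M X \<succ> \<eta> (Y \<rhd> S))"
    by (simp add: dist)
  finally have e: "(ident M (X \<otimes>\<^bsub>M\<^esub> Y) \<succ> \<eta> S) \<bullet> lassoc A X Y S = \<dots>" .
  from arg_cong[OF e, of "farr E"]
  show "(\<lambda>(X, S). farr E (ident M X \<succ> \<eta> S)) (X \<otimes>\<^bsub>M\<^esub> Y, S) \<cdot>\<^bsub>D\<^esub> farr E (lassoc A X Y S) =
      lassoc A' X Y (fobj E S) \<cdot>\<^bsub>D\<^esub>
      (ident M X \<unrhd>\<^bsub>A'\<^esub> (\<lambda>(X, S). farr E (ident M X \<succ> \<eta> S)) (Y, S)) \<cdot>\<^bsub>D\<^esub>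
      (\<lambda>(X, S). farr E (ident M X \<succ> \<eta> S)) (X, Y \<rhd> S)"
    by simp
qed auto

lemma transport_equivalence: "equivalence C D E"
proof -
  have "nat_isomorphism D D (cfunctor_comp E K) cfunctor_id (ident D)"
    by (intro nat_isomorphism.intro nat_isomorphism_axioms.intro nat_transformationI cfunctor.intro
        cfunctor_axioms.intro E.D.category_axioms) auto
  then show ?thesis
    using E.cfunctor_axioms K.cfunctor_axioms \<eta>.nat_isomorphism_axioms
    unfolding equivalence_def by blast
qed

end

section \<open>The action on a mixed relative center\<close>

lemma cfunctor_comp_cfunctor:
  assumes "cfunctor C D F" "cfunctor D C' G"
  shows "cfunctor C C' (cfunctor_comp G F)"
proof -
  interpret F: cfunctor C D F by fact
  interpret G: cfunctor D C' G by fact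
  show ?thesis
    by (intro cfunctor.intro cfunctor_axioms.intro F.C.category_axioms G.D.category_axioms) auto
qed

lemma half_braiding_of_twisted: "half_braiding_of M (twisted N G1 G2) H = half_braiding_of M N H"
  by (simp add: half_braiding_of_def)

lemma center_functor_simps [simp]:
  "fobj (center_functor M N) H = (fobj H (tunit M), half_braiding_of M N H)"
  "farr (center_functor M N) (H, K, \<theta>) =
    ((fobj H (tunit M), half_braiding_of M N H), (fobj K (tunit M), half_braiding_of M N K), \<theta> (tunit M))"
  by (simp_all add: center_functor_def half_braiding_of_def Let_def)

lemma (in half_braiding) half_braiding_of_free_functor:
  assumes "c \<in> extensional (Obj M)"
  shows "half_braiding_of M V (free_functor M V (Z, c)) = c"
  using assms by (intro extensionalityI[of _ "Obj M"]) (simp_all add: L.V.inv_Comp L.inv_larr)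

text \<open>
  The quasi-inverse of \<open>center_functor\<close>.
\<close>

definition free_functor_functor ::
  "('o, 'a, 'm) monoidal_scheme \<Rightarrow> ('o, 'a, 'v, 'w) bimodule \<Rightarrow>
    (('o, 'v, 'w) cobj, ('o, 'v, 'w) carr,
     ('o, 'o, 'a, 'v, 'w) bfunctor, ('o, 'o, 'a, 'v, 'w) btrans) cfunctor" where
  "free_functor_functor M V =
    \<lparr>fobj = free_functor M V,
     farr = (\<lambda>(S, T, f). (free_functor M V S, free_functor M V T,
       \<lambda>X\<in>Obj M. ident M X \<unrhd>\<^bsub>left V\<^esub> f))\<rparr>"

lemma free_functor_functor_simps [simp]:
  "fobj (free_functor_functor M V) S = free_functor M V S"
  "farr (free_functor_functor M V) (S, T, f) =
    (free_functor M V S, free_functor M V T, \<lambda>X\<in>Obj M. ident M X \<unrhd>\<^bsub>left V\<^esub> f)"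
  by (simp_all add: free_functor_functor_def)

context mixed_center_setting
begin

lemma composition_setting: "composition_setting M B F P \<tau> T"
  by (intro composition_setting.intro relative_center_setting.intro twisted_bimodule
      G1.C.monoidal_category_axioms B.strict_braided_category_axioms F.monoidal_functor_axioms
      P.monoidal_functor_axioms \<tau>.monoidal_nat_isomorphism_axioms)

abbreviation E where "E \<equiv> center_functor M N"
abbreviation K where "K \<equiv> free_functor_functor M T"
abbreviation BM where "BM \<equiv> BiMod M (regular M) T"
abbreviation RC where "RC \<equiv> relative_center M B F P \<tau>"
abbreviation ABM where "ABM \<equiv> admissible_BiMod M B P \<tau> N F' G1 G2"
abbreviation A where "A \<equiv> composition_action M T"

lemma bfunctors_regular: "H \<in> bfunctors M (regular M) T \<Longrightarrow> regular_functor M T H"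
  by (rule composition_setting.bfunctors_regular[OF composition_setting])

text \<open>
  By \<open>unit_btransformation\<close>, \<open>H\<close> may be replaced by the free functor on \<open>H I\<close>; the value of the composite
  at the unit then is \<open>G1 V \<otimes> H I\<close> with the half-braiding treated in \<open>admissible_tensor\<close>. The
  isomorphism between the two values is \<open>\<lambda>\<close> at \<open>(V, I)\<close>.
\<close>

lemma act_admissible:
  assumes S: "S \<in> Obj RC" and H: "H \<in> bfunctors M (regular M) T" and adm: "fobj E H \<in> Obj Z"
  shows "fobj E (S \<triangleright>\<^bsub>A\<^esub> H) \<in> Obj Z"
proof -
  interpret C: composition_setting M B F P \<tau> T by (rule composition_setting)
  interpret H: regular_functor M T H using H by (rule bfunctors_regular)
  obtain V c where S_eq: "S = (V, c)" by (cases S)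
  have c: "half_braiding M (regular M) V c" "admissible B P \<tau> M F (mfunctor_id M) (mfunctor_id M) V c"
    using S by (simp_all add: S_eq C.RC_obj_iff)
  then interpret c: half_braiding M "regular M" V c by simp
  note [simp] = c.c_isos[unfolded regular_simps regular_isos]
  have [simp]: "V \<in> Obj M" using c.Z_obj by simp
  let ?W = "fobj H (tunit M)"
  \<comment> \<open>Kept folded, so that only the half-braidings of the two composites are expanded below.\<close>
  define d where "d = half_braiding_of M T H"
  let ?L = "free_functor M T (?W, d)"
  interpret btransformation_pair M "regular M" "regular M" T "Phi M (V, c)" "Phi M (V, c)"
      "\<lambda>X\<in>Obj (regular M). ident (regular M) (fobj (Phi M (V, c)) X)" H ?L "\<lambda>X\<in>Obj M. lam H (X, tunit M)"
    by (intro btransformation_pair.intro H.unit_btransformation[folded d_def]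
        bimodule_functor.ident_btransformation Phi_bimodule_functor c(1))
  have "regular_functor M T HK.HK" "regular_functor M T HK'.HK"
    by (intro regular_functor.intro HK.bimodule_functor_comp HK'.bimodule_functor_comp twisted_bimodule)+
  note hb = this[THEN regular_functor.half_braiding_of_half_braiding]
  note [simp] = H.F.lam_isos[unfolded twisted_simps twisted_isos regular_simps]
  note d_hb = H.half_braiding_of_half_braiding[folded d_def]
  note [simp] = half_braiding.c_isos[OF d_hb, unfolded twisted_simps twisted_isos]
  have [simp]: "?W \<in> Obj N" using half_braiding.Z_obj[OF d_hb] by simp
  have e: "half_braiding_of M T HK'.HK X =
      assoc N (fobj G1 X) (fobj G1 V) ?W \<cdot>\<^bsub>N\<^esub> (fmu G1 X V \<boxtimes>\<^bsub>N\<^esub> ident N ?W) \<cdot>\<^bsub>N\<^esub>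
      (farr G1 (c X) \<boxtimes>\<^bsub>N\<^esub> ident N ?W) \<cdot>\<^bsub>N\<^esub> (inv_arr N (fmu G1 V X) \<boxtimes>\<^bsub>N\<^esub> ident N ?W) \<cdot>\<^bsub>N\<^esub>
      inv_arr N (assoc N (fobj G1 V) (fobj G1 X) ?W) \<cdot>\<^bsub>N\<^esub>
      (ident N (fobj G1 V) \<boxtimes>\<^bsub>N\<^esub> d X) \<cdot>\<^bsub>N\<^esub> assoc N (fobj G1 V) ?W (fobj G2 X)"
    if "X \<in> Obj M" for X
    using that by (simp add: G1.D.inv_Comp G1.D.inv_tarr)
  have adm': "admissible B P \<tau> N F' G1 G2 (fobj G1 V \<otimes>\<^bsub>N\<^esub> ?W) (half_braiding_of M T HK'.HK)"
    using adm by (intro admissible_tensor[OF c d_hb _ e])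
      (simp_all add: Z_obj_iff half_braiding_of_twisted d_def)
  have "admissible B P \<tau> N F' G1 G2 (fobj HK.HK (tunit M)) (half_braiding_of M T HK.HK)"
  proof (rule admissible_iso_invariant[OF _ adm' hb(1)])
    show "half_braiding M T (fobj G1 V \<otimes>\<^bsub>N\<^esub> ?W) (half_braiding_of M T HK'.HK)"
      using hb(2) by simp
    show "lam H (V, tunit M) \<in> isos N" "Dom N (lam H (V, tunit M)) = fobj HK.HK (tunit M)"
      "Cod N (lam H (V, tunit M)) = fobj G1 V \<otimes>\<^bsub>N\<^esub> ?W"
      by simp_all
    fix X assume [simp]: "X \<in> Obj M"
    show "(ident N (fobj G1 X) \<boxtimes>\<^bsub>N\<^esub> lam H (V, tunit M)) \<cdot>\<^bsub>N\<^esub> half_braiding_of M T HK.HK X =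
        half_braiding_of M T HK'.HK X \<cdot>\<^bsub>N\<^esub> (lam H (V, tunit M) \<boxtimes>\<^bsub>N\<^esub> ident N (fobj G2 X))"
      using unit_component_half_braiding[OF horizontal_composite, of X]
      by (simp del: half_braiding_of_simps)
  qed
  then show ?thesis
    using hb(1) by (simp add: S_eq Z_obj_iff half_braiding_of_twisted half_braiding_of_def)
qed

lemma ABM_eq: "ABM = full_subcategory BM {H. fobj E H \<in> Obj Z}"
  by (simp add: admissible_BiMod_def)

lemma ABM_module: "left_module_category RC ABM A"
  unfolding ABM_eq
proof (rule left_module_category.full_subcategory_module[OF
      composition_setting.composition_module[OF composition_setting]])
  fix S H assume "S \<in> Obj RC" "H \<in> Obj BM" "H \<in> {H. fobj E H \<in> Obj Z}"
  then have "fobj E (S \<triangleright>\<^bsub>A\<^esub> H) \<in> Obj Z"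
    by (intro act_admissible) (simp_all only: BiMod_simps mem_Collect_eq)
  then show "S \<triangleright>\<^bsub>A\<^esub> H \<in> {H. fobj E H \<in> Obj Z}" by (simp only: mem_Collect_eq)
qed

lemma ABM_obj_iff: "H \<in> Obj ABM \<longleftrightarrow> H \<in> bfunctors M (regular M) T \<and> fobj E H \<in> Obj Z"
  by (simp add: ABM_eq del: center_functor_simps)

lemma ABM_arr_iff: "(H, H', \<theta>) \<in> Arr ABM \<longleftrightarrow> H \<in> Obj ABM \<and> H' \<in> Obj ABM \<and>
    btransformation M (regular M) T H H' \<theta> \<and> \<theta> \<in> extensional (Obj M)"
  by (auto simp: ABM_eq simp del: center_functor_simps)

lemma ABM_arrE:
  assumes "f \<in> Arr ABM"
  obtains H H' \<theta> where "f = (H, H', \<theta>)" "H \<in> Obj ABM" "H' \<in> Obj ABM"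
    "btransformation M (regular M) T H H' \<theta>" "\<theta> \<in> extensional (Obj M)"
  using assms by (cases f) (auto simp: ABM_arr_iff)

lemma ABM_simps [simp]:
  "Dom ABM (H, H', \<theta>) = H" "Cod ABM (H, H', \<theta>) = H'"
  "ident ABM H = (H, H, \<lambda>X\<in>Obj M. ident N (fobj H X))"
  "(H', H'', \<theta>') \<cdot>\<^bsub>ABM\<^esub> (H, L, \<theta>) = (H, H'', \<lambda>X\<in>Obj M. \<theta>' X \<cdot>\<^bsub>N\<^esub> \<theta> X)"
  by (simp_all add: ABM_eq)

lemma ABM_category: "category ABM"
  unfolding ABM_eq by (rule category.full_subcategory_category[OF BiMod_category])

lemma ABM_fobj_unit [simp]: "H \<in> Obj ABM \<Longrightarrow> fobj H (tunit M) \<in> Obj N"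
  using half_braiding.Z_obj by (fastforce simp: ABM_obj_iff Z_obj_iff)

lemma unit_component_center_morphism:
  assumes "btransformation M (regular M) T H H' \<theta>"
  shows "center_morphism M T (fobj H (tunit M)) (half_braiding_of M N H)
    (fobj H' (tunit M)) (half_braiding_of M N H') (\<theta> (tunit M))"
proof -
  interpret btransformation M "regular M" T H H' \<theta> by fact
  show ?thesis
    using unit_component_half_braiding[OF assms] component_arr[of "tunit M"]
    unfolding center_morphism_def half_braiding_of_twisted[symmetric] by simp
qed

lemma center_functor_functor: "cfunctor ABM Z E"
proof (intro cfunctor.intro cfunctor_axioms.intro ABM_category Z_category)
  fix H assume "H \<in> Obj ABM"
  then show "fobj E H \<in> Obj Z" "farr E (ident ABM H) = ident Z (fobj E H)"
    by (simp_all add: ABM_obj_iff mixed_center_simps(2-))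
next
  fix f H H' assume "f \<in> hom ABM H H'"
  then show "farr E f \<in> hom Z (fobj E H) (fobj E H')"
    using unit_component_center_morphism
    by (auto elim!: ABM_arrE simp: ABM_obj_iff Z_arr_iff mixed_center_simps(2-))
next
  fix f g H H' H'' assume "f \<in> hom ABM H H'" "g \<in> hom ABM H' H''"
  then show "farr E (g \<cdot>\<^bsub>ABM\<^esub> f) = farr E g \<cdot>\<^bsub>Z\<^esub> farr E f"
    by (auto elim!: ABM_arrE simp: mixed_center_simps(2-))
qed

lemma center_functor_free_functor: "(V, c) \<in> Obj Z \<Longrightarrow> fobj E (free_functor M T (V, c)) = (V, c)"
  using half_braiding.half_braiding_of_free_functor[of M T V c] half_braiding.Z_obj[of M T V c]
  by (simp add: Z_obj_iff half_braiding_of_twisted)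

lemma free_functor_in_ABM: "S \<in> Obj Z \<Longrightarrow> free_functor M T S \<in> Obj ABM"
  using center_functor_free_functor half_braiding.free_functor_bimodule_functor
  by (cases S) (auto simp: ABM_obj_iff bfunctors_def free_functor_extensional Z_obj_iff
      simp del: center_functor_simps)

lemma free_functor_functor_functor: "cfunctor Z ABM K"
proof (intro cfunctor.intro cfunctor_axioms.intro ABM_category Z_category)
  fix S assume S: "S \<in> Obj Z"
  then show "fobj K S \<in> Obj ABM" by (simp add: free_functor_in_ABM)
  obtain V c where d: "S = (V, c)" by (cases S)
  have "V \<in> Obj N" using S half_braiding.Z_obj[of M T V c] by (simp add: d Z_obj_iff)
  then show "farr K (ident Z S) = ident ABM (fobj K S)"
    by (auto simp: d mixed_center_simps(2-) intro!: restrict_ext)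
next
  fix f S S' assume "f \<in> hom Z S S'"
  then show "farr K f \<in> hom ABM (fobj K S) (fobj K S')"
    using free_btransformation[of M T]
    by (auto elim!: Z_arrE simp: ABM_arr_iff mixed_center_simps(2-) free_functor_in_ABM
        center_morphism_def Z_obj_iff)
next
  fix f g S S' S'' assume "f \<in> hom Z S S'" "g \<in> hom Z S' S''"
  then show "farr K (g \<cdot>\<^bsub>Z\<^esub> f) = farr K g \<cdot>\<^bsub>ABM\<^esub> farr K f"
    by (auto elim!: Z_arrE simp: mixed_center_simps(2-) center_morphism_def G1.D.interchange
        intro!: restrict_ext)
qed

abbreviation \<eta> where "\<eta> \<equiv> \<lambda>H. (H, fobj K (fobj E H), \<lambda>X\<in>Obj M. lam H (X, tunit M))"

lemma \<eta>_nat_isomorphism: "nat_isomorphism ABM ABM cfunctor_id (cfunctor_comp K E) \<eta>"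
proof (intro nat_isomorphism.intro nat_isomorphism_axioms.intro nat_transformationI)
  show "cfunctor ABM ABM cfunctor_id"
    by (intro cfunctor.intro cfunctor_axioms.intro ABM_category) auto
  show "cfunctor ABM ABM (cfunctor_comp K E)"
    by (rule cfunctor_comp_cfunctor[OF center_functor_functor free_functor_functor_functor])
  fix H assume H: "H \<in> Obj ABM"
  then interpret H: regular_functor M T H by (simp add: ABM_obj_iff bfunctors_regular)
  have Z: "fobj E H \<in> Obj Z" using H by (simp add: ABM_obj_iff)
  have "\<eta> H \<in> Arr ABM"
    using H free_functor_in_ABM[OF Z] H.unit_btransformation
    by (simp add: ABM_arr_iff half_braiding_of_twisted)
  then show "\<eta> H \<in> Arr ABM \<and> Dom ABM (\<eta> H) = fobj cfunctor_id H \<and>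
      Cod ABM (\<eta> H) = fobj (cfunctor_comp K E) H"
    by simp
  have "\<eta> H \<in> Arr BM" using \<open>\<eta> H \<in> Arr ABM\<close> by (simp add: ABM_eq)
  from BiMod_isos(1)[OF this] have "\<eta> H \<in> isos BM"
    using H.F.lam_isos(1) by simp
  then have "\<eta> H \<in> isos ABM"
    using \<open>\<eta> H \<in> Arr ABM\<close>
    by (simp add: ABM_eq category.full_subcategory_isos[OF BiMod_category] del: BiMod_simps(2) center_functor_simps)
  then show "\<eta> H \<in> iso ABM (fobj cfunctor_id H) (fobj (cfunctor_comp K E) H)"
    by simp
next
  fix f assume "f \<in> Arr ABM"
  then obtain H H' \<theta> where d: "f = (H, H', \<theta>)" and b: "btransformation M (regular M) T H H' \<theta>"
    by (auto elim!: ABM_arrE)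
  interpret btransformation M "regular M" T H H' \<theta> by fact
  have "lam H' (X, tunit M) \<cdot>\<^bsub>N\<^esub> \<theta> X =
      (ident N (fobj G1 X) \<boxtimes>\<^bsub>N\<^esub> \<theta> (tunit M)) \<cdot>\<^bsub>N\<^esub> lam H (X, tunit M)" if "X \<in> Obj M" for X
    using lam_compat[of X "tunit M"] that by simp
  then show "\<eta> (Cod ABM f) \<cdot>\<^bsub>ABM\<^esub> farr cfunctor_id f =
      farr (cfunctor_comp K E) f \<cdot>\<^bsub>ABM\<^esub> \<eta> (Dom ABM f)"
    by (auto simp: d intro!: restrict_ext)
qed

lemma module_transport: "module_transport RC ABM A Z E K \<eta>"
proof (intro module_transport.intro module_transport_axioms.intro ABM_module center_functor_functor
    free_functor_functor_functor \<eta>_nat_isomorphism)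
  fix S assume S: "S \<in> Obj Z"
  obtain V c where d: "S = (V, c)" by (cases S)
  have [simp]: "V \<in> Obj N" using S half_braiding.Z_obj[of M T V c] by (simp add: d Z_obj_iff)
  show "fobj E (fobj K S) = S"
    using center_functor_free_functor S by (simp add: d del: center_functor_simps)
  then show "\<eta> (fobj K S) = ident ABM (fobj K S)"
    by (auto simp: d simp del: center_functor_simps intro!: restrict_ext)
next
  fix f assume "f \<in> Arr Z"
  then show "farr E (farr K f) = f"
    using center_functor_free_functor by (auto elim!: Z_arrE simp: center_morphism_def)
next
  fix H assume H: "H \<in> Obj ABM"
  then interpret H: regular_functor M T H by (simp add: ABM_obj_iff bfunctors_regular)
  have "fobj E (fobj K (fobj E H)) = fobj E H"
    using center_functor_free_functor H by (simp add: ABM_obj_iff)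
  then show "farr E (\<eta> H) = ident Z (fobj E H)"
    using H by (simp add: mixed_center_simps(2-))
qed

end

theorem corollary2p2p10:
  fixes M :: "('o, 'a) monoidal"
    and B :: "('p, 'b) braided"
    and F :: "('o, 'a, 'p, 'b) mfunctor"
    and P :: "('p, 'b, 'o, 'a) mfunctor"
    and \<tau> :: "'p \<Rightarrow> 'b"
  assumes "monoidal_category M"
    and "strict_braided_category B"
    and "monoidal_functor M B F"
    and "monoidal_functor B M P"
    and "monoidal_nat_isomorphism B B (mfunctor_comp B F P) (mfunctor_id B) \<tau>"
  shows "(\<forall>V :: ('o, 'a, 'v, 'w) bimodule. bimodule_category M V \<longrightarrow>
      left_module_category (relative_center M B F P \<tau>) (BiMod M (regular M) V)
        (composition_action M V)) \<and>
    (\<forall>(N :: ('x, 'y) monoidal) (F' :: ('x, 'y, 'p, 'b) mfunctor)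
        (G1 :: ('o, 'a, 'x, 'y) mfunctor) (G2 :: ('o, 'a, 'x, 'y) mfunctor).
      monoidal_category N \<and> monoidal_functor N B F' \<and>
      monoidal_functor M N G1 \<and> monoidal_functor M N G2 \<and>
      mfunctor_eq M (mfunctor_comp B F' G1) F \<and> mfunctor_eq M (mfunctor_comp B F' G2) F \<longrightarrow>
      bimodule_category M (twisted N G1 G2) \<and>
      left_module_category (relative_center M B F P \<tau>) (admissible_BiMod M B P \<tau> N F' G1 G2)
        (composition_action M (twisted N G1 G2)) \<and>
      equivalence (admissible_BiMod M B P \<tau> N F' G1 G2) (mixed_center M B P \<tau> N F' G1 G2)
        (center_functor M N) \<and>
      (\<exists>A s. left_module_category (relative_center M B F P \<tau>) (mixed_center M B P \<tau> N F' G1 G2) A \<and>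
        left_module_functor (relative_center M B F P \<tau>)
          (admissible_BiMod M B P \<tau> N F' G1 G2) (composition_action M (twisted N G1 G2))
          (mixed_center M B P \<tau> N F' G1 G2) A (center_functor M N) s))"
proof (intro conjI allI impI)
  interpret relative_center_setting M B F P \<tau>
    using assms by (simp add: relative_center_setting_def)
  fix V :: "('o, 'a, 'v, 'w) bimodule"
  assume "bimodule_category M V"
  then have "composition_setting M B F P \<tau> V"
    by (simp add: composition_setting_def relative_center_setting_axioms)
  then show "left_module_category (relative_center M B F P \<tau>) (BiMod M (regular M) V) (composition_action M V)"
    by (rule composition_setting.composition_module)
next
  fix N :: "('x, 'y) monoidal" and F' :: "('x, 'y, 'p, 'b) mfunctor"
    and G1 G2 :: "('o, 'a, 'x, 'y) mfunctor"
  assume "monoidal_category N \<and> monoidal_functor N B F' \<and>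
      monoidal_functor M N G1 \<and> monoidal_functor M N G2 \<and>
      mfunctor_eq M (mfunctor_comp B F' G1) F \<and> mfunctor_eq M (mfunctor_comp B F' G2) F"
  then interpret mixed_center_setting M B F P \<tau> N F' G1 G2
    using assms by (simp add: mixed_center_setting_def mixed_center_setting_axioms_def twisting_def)
  interpret t: module_transport RC ABM A Z E K \<eta>
    by (rule module_transport)
  show "bimodule_category M T" by (rule twisted_bimodule)
  show "left_module_category RC ABM A" by (rule ABM_module)
  show "equivalence ABM Z E" by (rule t.transport_equivalence)
  show "\<exists>A' s. left_module_category RC Z A' \<and> left_module_functor RC ABM A Z A' E s"
    using t.transported_module t.transported_module_functor by blast
qed

end
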